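(* Let $E=\mathbb R^{p+q}$, $M=\mathbb R^p$, $\pi:E\to M$ the canonical projection, and $n\ge1$. The mapping $\theta_{\mathbf{J}^{n+1}(\pi)}^{\mathcal{J}^{n+1}(\pi)}:\mathcal{J}^{n+1}(\pi)\rightarrow\mathbf{J}^{n+1}(\pi)$, defined by induction on $n$ by $$\theta_{\mathbf{J}^{n+1}(\pi)}^{\mathcal{J}^{n+1}(\pi)}\left(x^{i},u^{j},u_{i_{1}}^{j},\dots,u_{i_{1},\dots,i_{n+1}}^{j}\right):\ \left[\delta\mapsto(x^{i})+(y^{i})\delta\right]\in(M\otimes\mathcal W_D)_{(x^i)}\ \longmapsto$$ $$\left[\delta\mapsto\theta_{\mathbf{J}^{n}(\pi)}^{\mathcal{J}^{n}(\pi)}\left((x^{i},u^{j},u_{i_{1}}^{j},\dots,u_{i_{1},\dots,i_{n}}^{j})+\Big(y^{i},\sum_{i_{1}=1}^{p}u_{i_{1}}^{j}y^{i_{1}},\sum_{i_2=1}^p u^j_{i_1,i_2}y^{i_2},\dots,\sum_{i_{n+1}=1}^{p}u_{i_{1},\dots,i_{n+1}}^{j}y^{i_{n+1}}\Big)\delta\right)\right]\in(\mathbf J^n(\pi)\otimes\mathcal W_D)_{\theta_{\mathbf{J}^{n}(\pi)}^{\mathcal{J}^{n}(\pi)}(x^i,u^j,u^j_{i_1},\dots,u^j_{i_1,\dots,i_n})},$$ starting from $$\theta_{\mathbf{J}^{1}(\pi)}^{\mathcal{J}^{1}(\pi)}(x^i,u^j,u^j_i):\ [\delta\mapsto(x^i)+(y^i)\delta]\longmapsto\Big[\delta\mapsto(x^i,u^j)+\Big(y^i,\sum_{i=1}^pu^j_iy^i\Big)\delta\Big],$$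 is bijective.
   Context: Everything takes place in the category of Fr\"olicher spaces; every "mapping" is smooth. For a Weil algebra $W=C^\infty(\mathbb R^k)/I$ and a Fr\"olicher space $X$, $X\otimes W$ is the quotient of $C^\infty(\mathbb R^k,X)$ by $f\sim g$ iff $h\circ f-h\circ g\in I$ for all smooth $h:X\to\mathbb R$; functorial in $X$ and $W$. Infinitesimal objects such as $D=\{d:d^2=0\}$, $D_m=\{d:d^{m+1}=0\}$, $D^2=D\times D$ have Weil algebras $\mathcal W_{\mathbb D}$ of functions (quotient of $C^\infty(\mathbb R^k)$ by the ideal generated by the equations), and a polynomial map $f:\mathbb D\to\mathbb D'$ with $f(0)=0$ induces $\mathrm{id}_X\otimes\mathcal W_f:X\otimes\mathcal W_{\mathbb D'}\to X\otimes\mathcal W_{\mathbb D}$ ("composition with $f$"). $(X\otimes\mathcal W_{\mathbb D})_x$ is the fibre over $x$ of $X\otimes\mathcal W_{\mathbb D}\to X$. A bracket $[\delta\mapsto f(\delta)]$ denotes the class of $f$ in $X\otimes\mathcal W_D$. First approach to jets. For a smooth map $\rho:Y\to M$ and $y\in Y$, $\mathbf J^1_y(\rho)$ is the set of mappings $\nabla_y:(M\otimes\mathcal W_D)_{\rho(y)}\to(Y\otimes\mathcal W_D)_y$ with $(\rho\otimes\mathrm{id})(\nabla_y(t))=t$, $\nabla_y(\alpha t)=\alpha\nabla_y(t)$ for $\alpha\in\mathbb R$, and, for all $m$ with $\mu:D\times D_m\to D$, $\mu(d,e)=ed$, $(\nabla_y\otimes\mathrm{id}_{\mathcal W_{D_m}})\circ(\mathrm{id}_M\otimes\mathcal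 W_\mu)=(\mathrm{id}_Y\otimes\mathcal W_\mu)\circ\nabla_y$. $\mathbf J^1(\rho)=\bigcup_y\mathbf J^1_y(\rho)$, with projections $\rho_{1,0}:\mathbf J^1(\rho)\to Y$ and $\rho_1=\rho\circ\rho_{1,0}$, and the fibrewise mapping-space structure: a curve $c$ in $\mathbf J^1(\rho)$ is smooth iff its base curve in $Y$ is smooth and $r\mapsto c(g(r))(t(r))$ is smooth for all smooth $g:\mathbb R\to\mathbb R$ and smooth $t:\mathbb R\to M\otimes\mathcal W_D$ with $t(r)$ over $\rho(\rho_{1,0}(c(g(r))))$. Put $\mathbf J^0(\pi)=E$, $\pi_0=\pi$, and let $\mathbf J^1(\pi)$ be the space $\mathbf J^1(\rho)$ for $\rho=\pi$, $Y=E$, i.e. the union over $y\in E$ of the sets of mappings $\nabla_y:(M\otimes\mathcal W_D)_{\pi(y)}\to(E\otimes\mathcal W_D)_y$ with $(\pi\otimes\mathrm{id})(\nabla_y(t))=t$, $\nabla_y(\alpha t)=\alpha\nabla_y(t)$ for $\alpha\in\mathbb R$, and $(\nabla_y\otimes\mathrm{id}_{\mathcal W_{D_m}})\circ(\mathrm{id}_M\otimes\mathcal W_\mu)=(\mathrm{id}_E\otimes\mathcal W_\mu)\circ\nabla_y$ for all $m$, with projections $\pi_{1,0}:\mathbf J^1(\pi)\to E$, $\nabla_y\mapsto y$, and $\pi_1=\pi\circ\pi_{1,0}:\mathbf J^1(\pi)\to M$. For $n\ge1$, $\mathbf J^{n+1}(\pi)$ is the subspace of $\mathbf J^1(\pi_n)$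 of those $\nabla_x$, with $x=\nabla_y\in\mathbf J^n(\pi)$, such that: (i) $\nabla_x$ is $\pi_{n,n-1}$-related to $\nabla_y$, i.e. $(\pi_{n,n-1}\otimes\mathrm{id}_{\mathcal W_D})(\nabla_x(t))=\nabla_y(t)$ for all $t$; (ii) for all $\gamma\in(M\otimes\mathcal W_{D^2})_{\pi_n(x)}$, $P(\gamma)=P(\gamma^\tau)^\tau$. Here $\tau$ interchanges the two variables of $D^2$, and $P(\gamma)\in\mathbf J^{n-1}(\pi)\otimes\mathcal W_{D^2}$ is informally $(d_1,d_2)\mapsto\big(\nabla_x(\gamma(\cdot,0))(d_1)\big)(\gamma(d_1,\cdot))(d_2)$; formally, apply $\mathrm{ev}\otimes\mathrm{id}_{\mathcal W_D}$, with $\mathrm{ev}:\mathbf J^n(\pi)\times_M(M\otimes\mathcal W_D)\to\mathbf J^{n-1}(\pi)\otimes\mathcal W_D$, $\mathrm{ev}(\nabla,t)=\nabla(t)$, to the pair of $\nabla_x(\gamma(\cdot,0))\in\mathbf J^n(\pi)\otimes\mathcal W_D$ and $\gamma$ viewed in $(M\otimes\mathcal W_D)\otimes\mathcal W_D$ as $d_1\mapsto\gamma(d_1,\cdot)$. The projections $\pi_{n+1,n}:\mathbf J^{n+1}(\pi)\to\mathbf J^n(\pi)$, $\pi_{n+1}:\mathbf J^{n+1}(\pi)\to M$ are the obvious ones. Coordinate jets. $D(p)_n\subset\mathbb R^p$ is defined by the vanishing of all products of $n+1$ coordinates; $\mathcal J^n(\pi)$ is the set of $\gamma\in E\otimes\mathcal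 W_{D(p)_n}$ with $(\pi\otimes\mathrm{id})(\gamma)$ constant. Via Taylor coefficients it is identified with the set of tuples $(x^i,u^j,u^j_{i_1},u^j_{i_1,i_2},\dots,u^j_{i_1,\dots,i_n})$, $1\le i\le p$, $1\le j\le q$, $1\le i_1\le\dots\le i_n\le p$, of real numbers; $u^j_{i_1,\dots,i_r}$ is extended to all index sequences by symmetry in the lower indices. *)

theory Defs
  imports "HOL-Analysis.Analysis" "HOL-Library.Multiset" "HOL-Library.FuncSet"
begin

section \<open>Smooth maps between Euclidean spaces\<close>

primrec Ck :: "nat \<Rightarrow> ('a::real_normed_vector \<Rightarrow> 'b::real_normed_vector) \<Rightarrow> bool" where
  "Ck 0 f \<longleftrightarrow> continuous_on UNIV f"
| "Ck (Suc k) f \<longleftrightarrow>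
     (\<forall>x. f differentiable (at x)) \<and> (\<forall>v. Ck k (\<lambda>x. frechet_derivative f (at x) v))"

definition smooth :: "('a::real_normed_vector \<Rightarrow> 'b::real_normed_vector) \<Rightarrow> bool" where
  "smooth f \<longleftrightarrow> (\<forall>k. Ck k f)"


section \<open>Froelicher spaces\<close>

text \<open>A Froelicher structure consists of smooth curves and smooth functions that determine each
  other. The record stores the curves; the smooth functions are those real functions whose
  composites with all smooth curves are smooth, and \<open>froelicher\<close> is the remaining axiom.\<close>

record 'a fspace =
  pts :: "'a set"
  curves :: "(real \<Rightarrow> 'a) set"

definition euclid :: "'a::euclidean_space fspace" where
  "euclid = \<lparr>pts = UNIV, curves = {c. smooth c}\<rparr>"

text \<open>Morphisms are extensional, so that equal morphisms are equal HOL functions.\<close>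

definition mor :: "'a fspace \<Rightarrow> 'b fspace \<Rightarrow> ('a \<Rightarrow> 'b) set" where
  "mor X Y = {f \<in> pts X \<rightarrow>\<^sub>E pts Y. \<forall>c \<in> curves X. f \<circ> c \<in> curves Y}"

abbreviation smooth_functions :: "'a fspace \<Rightarrow> ('a \<Rightarrow> real) set" where
  "smooth_functions X \<equiv> mor X (euclid :: real fspace)"

definition froelicher :: "'a fspace \<Rightarrow> bool" where
  "froelicher X \<longleftrightarrow> curves X = {c. range c \<subseteq> pts X \<and> (\<forall>h \<in> smooth_functions X. smooth (h \<circ> c))}"

definition subspace_on :: "'a fspace \<Rightarrow> 'a set \<Rightarrow> 'a fspace" where
  "subspace_on X A = \<lparr>pts = pts X \<inter> A, curves = {c \<in> curves X. range c \<subseteq> A}\<rparr>"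

definition prod_space :: "'a fspace \<Rightarrow> 'b fspace \<Rightarrow> ('a \<times> 'b) fspace" where
  "prod_space X Y =
     \<lparr>pts = pts X \<times> pts Y, curves = {c. fst \<circ> c \<in> curves X \<and> snd \<circ> c \<in> curves Y}\<rparr>"

lemma frechet_inner:
  assumes "f differentiable (at x)"
  shows "frechet_derivative (\<lambda>x. f x \<bullet> b) (at x) v = frechet_derivative f (at x) v \<bullet> b"
proof -
  have "((\<lambda>x. f x \<bullet> b) has_derivative (\<lambda>v. frechet_derivative f (at x) v \<bullet> b)) (at x)"
    using assms frechet_derivative_works has_derivative_inner_left by blast
  from frechet_derivative_at[OF this] show ?thesis by metis
qed

lemma Ck_componentwise:
  fixes f :: "'a::real_normed_vector \<Rightarrow> 'b::euclidean_space"
  shows "Ck k f \<longleftrightarrow> (\<forall>b\<in>Basis. Ck k (\<lambda>x. f x \<bullet> b))"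
proof (induction k arbitrary: f)
  case 0
  show ?case
    by (simp add: continuous_on_componentwise[of UNIV f])
next
  case (Suc k)
  have diff: "f differentiable (at x) \<longleftrightarrow> (\<forall>b\<in>Basis. (\<lambda>x. f x \<bullet> b) differentiable (at x))" for x
    by (rule differentiable_componentwise_within)
  show ?case
  proof (cases "\<forall>x. f differentiable (at x)")
    case True
    then have eq: "(\<lambda>x. frechet_derivative (\<lambda>x. f x \<bullet> b) (at x) v)
        = (\<lambda>x. frechet_derivative f (at x) v \<bullet> b)" for v b
      by (simp add: frechet_inner)
    have "Ck (Suc k) f \<longleftrightarrow> (\<forall>v. \<forall>b\<in>Basis. Ck k (\<lambda>x. frechet_derivative f (at x) v \<bullet> b))"
      using True by (simp add: Suc.IH[of "\<lambda>x. frechet_derivative f (at x) _"])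
    moreover have "(\<forall>b\<in>Basis. Ck (Suc k) (\<lambda>x. f x \<bullet> b))
        \<longleftrightarrow> (\<forall>b\<in>Basis. \<forall>v. Ck k (\<lambda>x. frechet_derivative f (at x) v \<bullet> b))"
      using True diff by (simp add: eq)
    ultimately show ?thesis by blast
  next
    case False
    then show ?thesis using diff by auto
  qed
qed

lemma smooth_componentwise:
  fixes f :: "'a::real_normed_vector \<Rightarrow> 'b::euclidean_space"
  shows "smooth f \<longleftrightarrow> (\<forall>b\<in>Basis. smooth (\<lambda>x. f x \<bullet> b))"
  by (auto simp: smooth_def Ck_componentwise[of _ f])

lemma froelicherI:
  assumes "\<And>c. c \<in> curves X \<Longrightarrow> range c \<subseteq> pts X"
    and "\<And>c. range c \<subseteq> pts X \<Longrightarrow> (\<forall>h \<in> smooth_functions X. smooth (h \<circ> c)) \<Longrightarrow> c \<in> curves X"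
  shows "froelicher X"
proof -
  have "smooth (h \<circ> c)" if "c \<in> curves X" "h \<in> smooth_functions X" for h c
    using that by (simp add: mor_def euclid_def)
  with assms show ?thesis unfolding froelicher_def by blast
qed

lemma froelicherD:
  assumes "froelicher X"
  shows "c \<in> curves X \<longleftrightarrow> range c \<subseteq> pts X \<and> (\<forall>h \<in> smooth_functions X. smooth (h \<circ> c))"
  by (subst assms[unfolded froelicher_def]) simp

lemma froelicher_euclid: "froelicher (euclid :: 'a::euclidean_space fspace)"
proof (rule froelicherI)
  fix c :: "real \<Rightarrow> 'a"
  assume c: "\<forall>h \<in> smooth_functions (euclid :: 'a fspace). smooth (h \<circ> c)"
  have "smooth (\<lambda>x. c x \<bullet> b)" if "b \<in> Basis" for b
  proof -
    have "smooth (\<lambda>r. c' r \<bullet> b)" if "smooth c'" for c' :: "real \<Rightarrow> 'a"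
      using that \<open>b \<in> Basis\<close> smooth_componentwise[of c'] by blast
    then have "(\<lambda>x. x \<bullet> b) \<in> smooth_functions (euclid :: 'a fspace)"
      by (simp add: mor_def euclid_def o_def)
    from c[rule_format, OF this] show ?thesis by (simp add: o_def)
  qed
  then have "smooth c" using smooth_componentwise[of c] by blast
  then show "c \<in> curves euclid" by (simp add: euclid_def)
qed (simp add: euclid_def)

lemma smooth_restrict_comp:
  assumes "range c \<subseteq> A" shows "restrict h A \<circ> c = h \<circ> c"
  using assms by (auto simp: fun_eq_iff)


lemma froelicher_subspace:
  assumes "froelicher X" shows "froelicher (subspace_on X A)"
proof (rule froelicherI)
  fix c assume "c \<in> curves (subspace_on X A)"
  then show "range c \<subseteq> pts (subspace_on X A)"
    using assms unfolding froelicher_def subspace_on_def by auto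
next
  fix c :: "real \<Rightarrow> _" assume r: "range c \<subseteq> pts (subspace_on X A)"
    and c: "\<forall>h \<in> smooth_functions (subspace_on X A). smooth (h \<circ> c)"
  have "smooth (h \<circ> c)" if h: "h \<in> smooth_functions X" for h
  proof -
    have "smooth (restrict h (pts X \<inter> A) \<circ> c')" if "c' \<in> curves X" "range c' \<subseteq> A" for c'
    proof -
      have "range c' \<subseteq> pts X \<inter> A" using that assms unfolding froelicher_def by auto
      then show ?thesis using h that by (simp add: smooth_restrict_comp mor_def euclid_def)
    qed
    then have "restrict h (pts X \<inter> A) \<in> smooth_functions (subspace_on X A)"
      by (auto simp: mor_def euclid_def subspace_on_def)
    with c have "smooth (restrict h (pts X \<inter> A) \<circ> c)" by blast
    moreover have "range c \<subseteq> pts X \<inter> A" using r by (simp add: subspace_on_def)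
    ultimately show ?thesis by (simp add: smooth_restrict_comp)
  qed
  then show "c \<in> curves (subspace_on X A)"
    using r by (auto simp: subspace_on_def froelicherD[OF assms])
qed

lemma froelicher_prod:
  assumes X: "froelicher X" and Y: "froelicher Y" shows "froelicher (prod_space X Y)"
proof (rule froelicherI)
  fix c assume "c \<in> curves (prod_space X Y)"
  then have "range (fst \<circ> c) \<subseteq> pts X" "range (snd \<circ> c) \<subseteq> pts Y"
    using X Y unfolding froelicher_def prod_space_def by auto
  then show "range c \<subseteq> pts (prod_space X Y)"
    by (auto simp: prod_space_def image_subset_iff mem_Times_iff)
next
  fix c :: "real \<Rightarrow> _" assume r: "range c \<subseteq> pts (prod_space X Y)"
    and c: "\<forall>h \<in> smooth_functions (prod_space X Y). smooth (h \<circ> c)"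
  have sub: "range c' \<subseteq> pts X \<times> pts Y" if "c' \<in> curves (prod_space X Y)" for c'
  proof -
    have "range (fst \<circ> c') \<subseteq> pts X" "range (snd \<circ> c') \<subseteq> pts Y"
      using that X Y unfolding froelicher_def prod_space_def by auto
    then show ?thesis by (auto simp: mem_Times_iff image_subset_iff)
  qed
  have 1: "smooth (h \<circ> (fst \<circ> c))" if h: "h \<in> smooth_functions X" for h
  proof -
    have "restrict (h \<circ> fst) (pts X \<times> pts Y) \<in> smooth_functions (prod_space X Y)"
      using h sub by (auto simp: mor_def euclid_def smooth_restrict_comp)
         (auto simp: prod_space_def o_assoc[symmetric])
    with c have "smooth (restrict (h \<circ> fst) (pts X \<times> pts Y) \<circ> c)" by blast
    then show ?thesis using r by (simp add: prod_space_def smooth_restrict_comp o_assoc)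
  qed
  have 2: "smooth (h \<circ> (snd \<circ> c))" if h: "h \<in> smooth_functions Y" for h
  proof -
    have "restrict (h \<circ> snd) (pts X \<times> pts Y) \<in> smooth_functions (prod_space X Y)"
      using h sub by (auto simp: mor_def euclid_def smooth_restrict_comp)
         (auto simp: prod_space_def o_assoc[symmetric])
    with c have "smooth (restrict (h \<circ> snd) (pts X \<times> pts Y) \<circ> c)" by blast
    then show ?thesis using r by (simp add: prod_space_def smooth_restrict_comp o_assoc)
  qed
  have "range (fst \<circ> c) \<subseteq> pts X" "range (snd \<circ> c) \<subseteq> pts Y"
    using r by (auto simp: prod_space_def image_subset_iff mem_Times_iff)
  then have "fst \<circ> c \<in> curves X" "snd \<circ> c \<in> curves Y"
    using 1 2 by (simp_all add: froelicherD[OF X] froelicherD[OF Y])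
  then show "c \<in> curves (prod_space X Y)" by (simp add: prod_space_def)
qed

text \<open>Transport of structure; only used for maps that are injective on the points.\<close>

definition image_space :: "('a \<Rightarrow> 'b) \<Rightarrow> 'a fspace \<Rightarrow> 'b fspace" where
  "image_space e X = \<lparr>pts = e ` pts X, curves = (\<lambda>c. e \<circ> c) ` curves X\<rparr>"


section \<open>Tensoring with a Weil algebra\<close>

text \<open>A Weil algebra \<open>C\<^sup>\<infinity>(V)/I\<close>, where \<open>V\<close> is a Euclidean space, is represented by the ideal \<open>I\<close>.\<close>

type_synonym 'k ideal = "('k \<Rightarrow> real) set"

definition gen_ideal :: "('k::euclidean_space \<Rightarrow> real) set \<Rightarrow> 'k ideal" where
  "gen_ideal S = {f. \<exists>F a. finite F \<and> F \<subseteq> S \<and> (\<forall>s\<in>F. smooth (a s)) \<and>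
                           f = (\<lambda>v. \<Sum>s\<in>F. a s v * s v)}"

text \<open>The ideals defining \<open>D\<close>, \<open>D\<^sub>m\<close>, \<open>D \<times> D\<close>, \<open>D \<times> D\<^sub>m\<close> and \<open>D(p)\<^sub>n\<close>.\<close>

definition ideal_D :: "real ideal" where
  "ideal_D = gen_ideal {\<lambda>d. d ^ 2}"

definition ideal_Dm :: "nat \<Rightarrow> real ideal" where
  "ideal_Dm m = gen_ideal {\<lambda>d. d ^ (m + 1)}"

definition ideal_DD :: "(real \<times> real) ideal" where
  "ideal_DD = gen_ideal {\<lambda>(d1, d2). d1 ^ 2, \<lambda>(d1, d2). d2 ^ 2}"

definition ideal_DDm :: "nat \<Rightarrow> (real \<times> real) ideal" where
  "ideal_DDm m = gen_ideal {\<lambda>(d, e). d ^ 2, \<lambda>(d, e). e ^ (m + 1)}"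

definition ideal_Dpn :: "nat \<Rightarrow> (real ^ 'p) ideal" where
  "ideal_Dpn n = gen_ideal {\<lambda>v. \<Prod>i\<in>#A. v $ i | A. size A = n + 1}"

type_synonym ('k, 'a) wclass = "('k \<Rightarrow> 'a) set"

definition tcls :: "'a fspace \<Rightarrow> 'k::euclidean_space ideal \<Rightarrow> ('k \<Rightarrow> 'a) \<Rightarrow> ('k, 'a) wclass" where
  "tcls X I f =
     {g \<in> mor (euclid :: 'k fspace) X. \<forall>h \<in> smooth_functions X. (\<lambda>v. h (f v) - h (g v)) \<in> I}"

text \<open>\<open>X \<otimes> C\<^sup>\<infinity>(V)/I\<close> with the quotient structure of the mapping space \<open>C\<^sup>\<infinity>(V, X)\<close>. A curve \<open>C\<close> in
  the mapping space is smooth iff its uncurried form \<open>\<real> \<times> V \<rightarrow> X\<close> is smooth, a function on the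
  quotient is smooth iff it is smooth on the mapping space, and these functions determine the
  smooth curves of the quotient.\<close>

definition tensor :: "'a fspace \<Rightarrow> 'k::euclidean_space ideal \<Rightarrow> ('k, 'a) wclass fspace" where
  "tensor X I =
     (let P = tcls X I ` mor (euclid :: 'k fspace) X;
          F = {h :: ('k, 'a) wclass \<Rightarrow> real.
                 \<forall>C. case_prod C \<in> mor (euclid :: (real \<times> 'k) fspace) X
                      \<longrightarrow> smooth (\<lambda>r. h (tcls X I (C r)))}
      in \<lparr>pts = P, curves = {c. range c \<subseteq> P \<and> (\<forall>h\<in>F. smooth (h \<circ> c))}\<rparr>)"

lemma froelicher_tensor: "froelicher (tensor X (I :: 'k::euclidean_space ideal))"
proof (rule froelicherI)
  fix c assume "c \<in> curves (tensor X I)"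
  then show "range c \<subseteq> pts (tensor X I)" by (simp add: tensor_def Let_def)
next
  fix c :: "real \<Rightarrow> _" assume r: "range c \<subseteq> pts (tensor X I)"
    and c: "\<forall>h \<in> smooth_functions (tensor X I). smooth (h \<circ> c)"
  have "smooth (h \<circ> c)"
    if h: "\<forall>C. case_prod C \<in> mor (euclid :: (real \<times> 'k) fspace) X \<longrightarrow> smooth (\<lambda>r. h (tcls X I (C r)))"
    for h :: "('k, 'a) wclass \<Rightarrow> real"
  proof -
    have "smooth (restrict h (pts (tensor X I)) \<circ> c')" if "c' \<in> curves (tensor X I)" for c'
    proof -
      have "range c' \<subseteq> pts (tensor X I)" "smooth (h \<circ> c')"
        using that h by (auto simp: tensor_def Let_def)
      then show ?thesis by (simp add: smooth_restrict_comp)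
    qed
    then have "restrict h (pts (tensor X I)) \<in> smooth_functions (tensor X I)"
      by (auto simp: mor_def euclid_def)
    with c r show ?thesis by (metis smooth_restrict_comp)
  qed
  with r show "c \<in> curves (tensor X I)" by (auto simp: tensor_def Let_def)
qed

definition trep :: "('k, 'a) wclass \<Rightarrow> 'k \<Rightarrow> 'a" where
  "trep t = (SOME f. f \<in> t)"

text \<open>\<open>\<phi> \<otimes> id\<close> into \<open>Y \<otimes> C\<^sup>\<infinity>(V)/I\<close>, and \<open>id \<otimes> W\<^sub>f\<close> into \<open>X \<otimes> C\<^sup>\<infinity>(V)/I\<close>, where \<open>f\<close> is defined
  on \<open>V\<close>.\<close>

definition tmap :: "'b fspace \<Rightarrow> 'k::euclidean_space ideal \<Rightarrow> ('a \<Rightarrow> 'b)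
    \<Rightarrow> ('k, 'a) wclass \<Rightarrow> ('k, 'b) wclass" where
  "tmap Y I \<phi> t = tcls Y I (\<phi> \<circ> trep t)"

definition tpull :: "'a fspace \<Rightarrow> 'k::euclidean_space ideal \<Rightarrow> ('k \<Rightarrow> 'l)
    \<Rightarrow> ('l, 'a) wclass \<Rightarrow> ('k, 'a) wclass" where
  "tpull X I f t = tcls X I (trep t \<circ> f)"

definition tbase :: "('k::zero, 'a) wclass \<Rightarrow> 'a" where
  "tbase t = trep t 0"

definition fibre :: "'a fspace \<Rightarrow> 'k::euclidean_space ideal \<Rightarrow> 'a \<Rightarrow> ('k, 'a) wclass fspace" where
  "fibre X I x = subspace_on (tensor X I) {t. tbase t = x}"

text \<open>The canonical maps from \<open>X \<otimes> W\<close>, with \<open>W\<close> the Weil algebra of a product of infinitesimal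
  objects, to iterated tensor products. The outer variable (with ideal \<open>K\<close>) is the first one for
  \<open>outer1\<close> and the second one for \<open>outer2\<close>; the inner variable has the ideal \<open>I\<close>.\<close>

definition outer1 :: "'a fspace \<Rightarrow> 'l::euclidean_space ideal \<Rightarrow> 'k::euclidean_space ideal
    \<Rightarrow> ('l \<times> 'k, 'a) wclass \<Rightarrow> ('l, ('k, 'a) wclass) wclass" where
  "outer1 X K I t = tcls (tensor X I) K (\<lambda>e. tcls X I (\<lambda>d. trep t (e, d)))"

definition outer2 :: "'a fspace \<Rightarrow> 'l::euclidean_space ideal \<Rightarrow> 'k::euclidean_space ideal
    \<Rightarrow> ('k \<times> 'l, 'a) wclass \<Rightarrow> ('l, ('k, 'a) wclass) wclass" where
  "outer2 X K I t = tcls (tensor X I) K (\<lambda>e. tcls X I (\<lambda>d. trep t (d, e)))"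


section \<open>The space of 1-jets of a smooth map\<close>

definition scale :: "'a fspace \<Rightarrow> real \<Rightarrow> (real, 'a) wclass \<Rightarrow> (real, 'a) wclass" where
  "scale X \<alpha> t = tpull X ideal_D (\<lambda>d. \<alpha> * d) t"

definition mu :: "real \<times> real \<Rightarrow> real" where
  "mu = (\<lambda>(d, e). e * d)"

text \<open>For \<open>t\<close> in the fibre of \<open>M \<otimes> W\<^sub>D\<close> over \<open>x\<close>, the element \<open>t \<circ> \<mu>\<close> of \<open>M \<otimes> W\<^bsub>D\<times>D_m\<^esub>\<close>, regarded as
  an element of (fibre over \<open>x\<close>) \<open>\<otimes> W\<^bsub>D_m\<^esub>\<close>. The fibre has to be used here because a jet is defined
  on the fibre only.\<close>

definition mu_fibre :: "'m fspace \<Rightarrow> 'm \<Rightarrow> nat \<Rightarrow> (real, 'm) wclass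
    \<Rightarrow> (real, (real, 'm) wclass) wclass" where
  "mu_fibre M x m t =
     (THE z. z \<in> pts (tensor (fibre M ideal_D x) (ideal_Dm m)) \<and>
             tmap (tensor M ideal_D) (ideal_Dm m) (\<lambda>s. s) z
               = outer2 M (ideal_Dm m) ideal_D (tpull M (ideal_DDm m) mu t))"

definition jets1_at :: "'m fspace \<Rightarrow> 'y fspace \<Rightarrow> ('y \<Rightarrow> 'm) \<Rightarrow> 'y
    \<Rightarrow> ((real, 'm) wclass \<Rightarrow> (real, 'y) wclass) set" where
  "jets1_at M Y \<rho> y =
     {F \<in> mor (fibre M ideal_D (\<rho> y)) (fibre Y ideal_D y).
        \<forall>t \<in> pts (fibre M ideal_D (\<rho> y)).
          tmap M ideal_D \<rho> (F t) = t \<and>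
          (\<forall>\<alpha>. F (scale M \<alpha> t) = scale Y \<alpha> (F t)) \<and>
          (\<forall>m. tmap (tensor Y ideal_D) (ideal_Dm m) F (mu_fibre M (\<rho> y) m t)
                 = outer2 Y (ideal_Dm m) ideal_D (tpull Y (ideal_DDm m) mu (F t)))}"

text \<open>The structure is the fibrewise mapping-space structure: its smooth curves are prescribed.\<close>

definition jets1 :: "'m fspace \<Rightarrow> 'y fspace \<Rightarrow> ('y \<Rightarrow> 'm)
    \<Rightarrow> ('y \<times> ((real, 'm) wclass \<Rightarrow> (real, 'y) wclass)) fspace" where
  "jets1 M Y \<rho> =
     (let P = Sigma (pts Y) (jets1_at M Y \<rho>)
      in \<lparr>pts = P,
          curves = {c. range c \<subseteq> P \<and> fst \<circ> c \<in> curves Y \<and>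
            (\<forall>g t. smooth (g :: real \<Rightarrow> real) \<and> t \<in> curves (tensor M ideal_D) \<and>
                   (\<forall>r. tbase (t r) = \<rho> (fst (c (g r))))
              \<longrightarrow> (\<lambda>r. snd (c (g r)) (t r)) \<in> curves (tensor Y ideal_D))}\<rparr>)"


section \<open>The iterated jet spaces\<close>

text \<open>The points of the iterated jet spaces live in one type. \<open>Jet x f\<close> encodes the jet at \<open>x\<close>
  whose value at \<open>t\<close> is the class of the curve \<open>f t\<close>. Making \<open>f t\<close> the representative chosen by
  \<open>trep\<close> makes the encoding injective on 1-jets.\<close>

datatype ('p, 'q) tower =
    Pt "(real ^ 'p) \<times> (real ^ 'q)"
  | Jet "('p, 'q) tower" "(real, real ^ 'p) wclass \<Rightarrow> real \<Rightarrow> ('p, 'q) tower"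

definition encode :: "('p::finite, 'q::finite) tower
      \<times> ((real, real ^ 'p) wclass \<Rightarrow> (real, ('p, 'q) tower) wclass) \<Rightarrow> ('p, 'q) tower" where
  "encode = (\<lambda>(x, F). Jet x (\<lambda>t. trep (F t)))"

text \<open>\<open>jet_map Y x\<close> is the mapping encoded by \<open>x\<close>, for a jet \<open>x\<close> of a map with domain \<open>Y\<close>.\<close>

primrec jet_map :: "('p::finite, 'q::finite) tower fspace \<Rightarrow> ('p, 'q) tower
    \<Rightarrow> (real, real ^ 'p) wclass \<Rightarrow> (real, ('p, 'q) tower) wclass" where
  "jet_map Y (Jet x f) = (\<lambda>t. tcls Y ideal_D (f t))"
| "jet_map Y (Pt e) = undefined"

text \<open>\<open>lower\<close> is \<open>\<pi>\<^bsub>n+1,n\<^esub>\<close> and \<open>foot\<close> is \<open>\<pi>\<^sub>n\<close>, for all \<open>n\<close>.\<close>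

primrec lower :: "('p::finite, 'q::finite) tower \<Rightarrow> ('p, 'q) tower" where
  "lower (Jet x f) = x"
| "lower (Pt e) = undefined"

primrec foot :: "('p::finite, 'q::finite) tower \<Rightarrow> real ^ 'p" where
  "foot (Pt e) = fst e"
| "foot (Jet x f) = foot x"

text \<open>\<open>iterate Z Y F \<gamma>\<close> is \<open>P(\<gamma>)\<close>, where \<open>F\<close> is a jet of \<open>\<pi>\<^sub>n\<close>, \<open>Y = J\<^sup>n(\<pi>)\<close> and \<open>Z = J\<^bsup>n-1\<^esup>(\<pi>)\<close>. The
  first \<open>THE\<close> inverts the canonical map from \<open>(Y \<times>\<^sub>M TM) \<otimes> W\<^sub>D\<close> to pairs, the second one the
  canonical map from \<open>Z \<otimes> W\<^bsub>D\<times>D\<^esub>\<close> to \<open>(Z \<otimes> W\<^sub>D) \<otimes> W\<^sub>D\<close>.\<close>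

definition iterate :: "('p::finite, 'q::finite) tower fspace \<Rightarrow> ('p, 'q) tower fspace
    \<Rightarrow> ((real, real ^ 'p) wclass \<Rightarrow> (real, ('p, 'q) tower) wclass)
    \<Rightarrow> (real \<times> real, real ^ 'p) wclass \<Rightarrow> (real \<times> real, ('p, 'q) tower) wclass" where
  "iterate Z Y F \<gamma> =
     (let M = (euclid :: (real ^ 'p) fspace);
          TM = tensor M ideal_D;
          Q = subspace_on (prod_space Y TM) {(x, t). foot x = tbase t};
          ev = (\<lambda>(x, t). jet_map Z x t);
          pair = (THE z. z \<in> pts (tensor Q ideal_D) \<and>
                         tmap Y ideal_D fst z = F (tpull M ideal_D (\<lambda>d. (d, 0)) \<gamma>) \<and>
                         tmap TM ideal_D snd z = outer1 M ideal_D ideal_D \<gamma>)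
      in THE w. w \<in> pts (tensor Z ideal_DD) \<and>
                outer1 Z ideal_D ideal_D w = tmap (tensor Z ideal_D) ideal_D ev pair)"

definition transpose2 :: "'a fspace \<Rightarrow> (real \<times> real, 'a) wclass \<Rightarrow> (real \<times> real, 'a) wclass" where
  "transpose2 X = tpull X ideal_DD prod.swap"

text \<open>The conditions singling out \<open>J\<^bsup>n+1\<^esup>(\<pi>)\<close> in \<open>J\<^sup>1(\<pi>\<^sub>n)\<close>, with \<open>Y\<close> and \<open>Z\<close> as above.\<close>

definition holonomic :: "('p::finite, 'q::finite) tower fspace \<Rightarrow> ('p, 'q) tower fspace
    \<Rightarrow> (('p, 'q) tower \<times> ((real, real ^ 'p) wclass \<Rightarrow> (real, ('p, 'q) tower) wclass)) set" where
  "holonomic Z Y =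
     {(x, F).
        (\<forall>t \<in> pts (fibre euclid ideal_D (foot x)). tmap Z ideal_D lower (F t) = jet_map Z x t) \<and>
        (\<forall>\<gamma> \<in> pts (fibre euclid ideal_DD (foot x)).
           iterate Z Y F \<gamma> = transpose2 Z (iterate Z Y F (transpose2 euclid \<gamma>)))}"

fun jets :: "nat \<Rightarrow> ('p::finite, 'q::finite) tower fspace" where
  "jets 0 = image_space Pt euclid"
| "jets (Suc 0) = image_space encode (jets1 euclid (jets 0) foot)"
| "jets (Suc (Suc n)) = image_space encode
     (subspace_on (jets1 euclid (jets (Suc n)) foot) (holonomic (jets n) (jets (Suc n))))"


section \<open>Coordinate jets\<close>

definition coord_jets :: "nat \<Rightarrow> (real ^ 'p, (real ^ 'p) \<times> (real ^ 'q)) wclass set" where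
  "coord_jets n = {\<gamma> \<in> pts (tensor euclid (ideal_Dpn n)).
     \<exists>x. tmap euclid (ideal_Dpn n) fst \<gamma> = tcls euclid (ideal_Dpn n) (\<lambda>_. x)}"

text \<open>A weakly increasing index sequence \<open>i\<^sub>1 \<le> \<dots> \<le> i\<^sub>r\<close> is a multiset of size \<open>r\<close>, and a family
  extended to all sequences by symmetry is a function of the multiset: the \<open>j\<close>-th component of
  \<open>u {#i\<^sub>1, \<dots>, i\<^sub>r#}\<close> is the coordinate with upper index \<open>j\<close> and lower indices \<open>i\<^sub>1, \<dots>, i\<^sub>r\<close>.\<close>

type_synonym ('p, 'q) jcoords = "(real ^ 'p) \<times> ('p multiset \<Rightarrow> real ^ 'q)"

definition jet_coords :: "nat \<Rightarrow> ('p::finite, 'q::finite) jcoords set" where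
  "jet_coords n = {(x, u). \<forall>A. n < size A \<longrightarrow> u A = 0}"

text \<open>The coordinates are the partial derivatives at \<open>0\<close>; the product of factorials is that of
  Taylor's formula in multi-index notation.\<close>

definition taylor :: "nat \<Rightarrow> ('p::finite, 'q::finite) jcoords
    \<Rightarrow> (real ^ 'p, (real ^ 'p) \<times> (real ^ 'q)) wclass" where
  "taylor n = (\<lambda>(x, u). tcls euclid (ideal_Dpn n)
     (\<lambda>v. (x, \<Sum>A | size A \<le> n. ((\<Prod>i\<in>#A. v $ i) / (\<Prod>i\<in>UNIV. fact (count A i))) *\<^sub>R u A)))"

definition coords :: "nat \<Rightarrow> (real ^ 'p, (real ^ 'p) \<times> (real ^ 'q)) wclass
    \<Rightarrow> ('p::finite, 'q::finite) jcoords" where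
  "coords n = inv_into (jet_coords n) (taylor n)"


section \<open>The comparison map\<close>

definition truncate_jet :: "nat \<Rightarrow> ('p::finite, 'q::finite) jcoords \<Rightarrow> ('p, 'q) jcoords" where
  "truncate_jet n = (\<lambda>(x, u). (x, \<lambda>A. if size A \<le> n then u A else 0))"

text \<open>The point at parameter \<open>\<delta>\<close> of the line through the coordinates up to order \<open>n\<close> of an
  \<open>(n+1)\<close>-jet, in the direction determined by \<open>y\<close>.\<close>

definition line :: "nat \<Rightarrow> ('p::finite, 'q::finite) jcoords \<Rightarrow> real ^ 'p \<Rightarrow> real
    \<Rightarrow> ('p, 'q) jcoords" where
  "line n = (\<lambda>(x, u) y \<delta>. truncate_jet n
     (x + \<delta> *\<^sub>R y, \<lambda>A. u A + \<delta> *\<^sub>R (\<Sum>i\<in>UNIV. y $ i *\<^sub>R u (add_mset i A))))"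

definition velocity :: "(real, real ^ 'p) wclass \<Rightarrow> real ^ 'p" where
  "velocity t = (THE y. t = tcls euclid ideal_D (\<lambda>\<delta>. tbase t + \<delta> *\<^sub>R y))"

primrec theta_coords :: "nat \<Rightarrow> ('p::finite, 'q::finite) jcoords \<Rightarrow> ('p, 'q) tower" where
  "theta_coords 0 z = Pt (fst z, snd z {#})"
| "theta_coords (Suc n) z = encode
     (theta_coords n (truncate_jet n z),
      \<lambda>t \<in> pts (fibre euclid ideal_D (fst z)).
        tcls (jets n) ideal_D (\<lambda>\<delta>. theta_coords n (line n z (velocity t) \<delta>)))"

definition theta :: "nat \<Rightarrow> (real ^ 'p, (real ^ 'p) \<times> (real ^ 'q)) wclass
    \<Rightarrow> ('p::finite, 'q::finite) tower" where
  "theta n \<gamma> = theta_coords n (coords n \<gamma>)"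

end

theory Submission
  imports Defs
begin

text \<open>In the coordinates \<open>(x, u)\<close> every space of the tower is a Euclidean space: by induction on \<open>n\<close>,
  \<open>theta_coords n\<close> is a bijection onto the points of \<open>jets n\<close> under which the smooth curves are the
  coordinatewise smooth ones. In such coordinates a 1-jet is a smooth homogeneous map between
  tangent spaces, hence linear, that is, a matrix. For a 1-jet over a point of \<open>jets (n + 1)\<close>,
  condition (i) says that the rows of order at most \<open>n\<close> are the coordinates of the point itself, and
  condition (ii), expanded to second order, says that the rows of order \<open>n + 1\<close> are symmetric in all
  their lower indices; so the matrix amounts to the coordinates of order \<open>n + 2\<close>.

  The reduction to coordinates rests on Boman's theorem, that a function on a Euclidean space which
  is smooth along all smooth curves is smooth, because points and morphisms of Froelicher spaces
  are tested on curves only, and on Hadamard's lemma, which identifies the classes in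
  \<open>X \<otimes> C\<^sup>\<infinity>(V)/I\<close> with tuples of Taylor coefficients.\<close>

text \<open>The description of the smooth curves has to travel through the induction together with
  the bijection: a jet of order n + 1 takes values in tangent vectors of the space of n-jets, and
  these are known only once the Froelicher structure of that space is. Condition (ii) for order n +
  2 involves both spaces below, so two consecutive orders are carried. Several definitions invert
  canonical maps by \<open>THE\<close>. In coordinates such an inversion compares finitely many
  coefficients, which settles existence and uniqueness; for this, classes over D and D x D are
  brought into the normal forms \<open>tvec\<close> and \<open>quad\<close>. The analytic obstacle
  is in Boman's theorem. Threading a curve through a bad sequence yields continuity and local bounds
  for repeated derivatives in one direction, but nothing about mixed derivatives. They are reached
  by interpolation, which plays a geometric rate of convergence off against a geometric rate of
  growth.\<close>

section \<open>Calculus of C^k and smooth maps\<close>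

lemma Ck_SucI:
  assumes "\<And>x. (f has_derivative f' x) (at x)" "\<And>v. Ck k (\<lambda>x. f' x v)"
  shows "Ck (Suc k) f"
proof -
  have "frechet_derivative f (at x) = f' x" for x
    using assms(1) frechet_derivative_at by metis
  then show ?thesis using assms by (auto simp: differentiable_def)
qed

lemma Ck_SucD:
  assumes "Ck (Suc k) f"
  shows "(f has_derivative frechet_derivative f (at x)) (at x)"
    and "Ck k (\<lambda>x. frechet_derivative f (at x) v)"
  using assms by (auto simp: frechet_derivative_works[symmetric])

lemma Ck_mono_Suc: "Ck (Suc k) f \<Longrightarrow> Ck k f"
proof (induction k arbitrary: f)
  case 0
  then show ?case
    by (simp add: continuous_on_eq_continuous_at differentiable_imp_continuous_within)
next
  case (Suc k)
  have "Ck k (\<lambda>x. frechet_derivative f (at x) v)" for v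
    using Ck_SucD(2)[OF Suc.prems] by (rule Suc.IH)
  with Suc.prems show ?case by simp
qed

lemma Ck_const: "Ck k (\<lambda>x. a)"
proof (induction k arbitrary: a)
  case (Suc k) show ?case by (rule Ck_SucI[where f'="\<lambda>x v. 0"]) (auto simp: Suc)
qed simp

lemma Ck_linear:
  assumes "bounded_linear f" shows "Ck k f"
proof (cases k)
  case 0 with assms show ?thesis by (simp add: linear_continuous_on)
next
  case (Suc m)
  with assms show ?thesis
    using Ck_SucI[of f "\<lambda>x. f"] by (auto simp: Ck_const bounded_linear_imp_has_derivative)
qed

lemma Ck_add:
  assumes "Ck k f" "Ck k g" shows "Ck k (\<lambda>x. f x + g x)"
  using assms
proof (induction k arbitrary: f g)
  case 0 then show ?case by (simp add: continuous_on_add)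
next
  case (Suc k)
  show ?case
  proof (rule Ck_SucI)
    show "((\<lambda>x. f x + g x) has_derivative
       (\<lambda>v. frechet_derivative f (at x) v + frechet_derivative g (at x) v)) (at x)" for x
      by (intro has_derivative_add Ck_SucD(1)[OF Suc.prems(1)] Ck_SucD(1)[OF Suc.prems(2)])
    show "Ck k (\<lambda>x. frechet_derivative f (at x) v + frechet_derivative g (at x) v)" for v
      using Suc.prems by (intro Suc.IH Ck_SucD(2))
  qed
qed

lemma Ck_scaleR:
  assumes "Ck k f" "Ck k g" shows "Ck k (\<lambda>x. f x *\<^sub>R g x)"
  using assms
proof (induction k arbitrary: f g)
  case 0 then show ?case by (simp add: continuous_on_scaleR)
next
  case (Suc k)
  show ?case
  proof (rule Ck_SucI)
    show "((\<lambda>x. f x *\<^sub>R g x) has_derivative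
       (\<lambda>v. f x *\<^sub>R frechet_derivative g (at x) v + frechet_derivative f (at x) v *\<^sub>R g x)) (at x)" for x
      by (intro has_derivative_scaleR Ck_SucD(1)[OF Suc.prems(1)] Ck_SucD(1)[OF Suc.prems(2)])
    show "Ck k (\<lambda>x. f x *\<^sub>R frechet_derivative g (at x) v + frechet_derivative f (at x) v *\<^sub>R g x)" for v
      using Suc.prems[THEN Ck_mono_Suc] Suc.prems[THEN Ck_SucD(2)] by (intro Ck_add Suc.IH)
  qed
qed

lemma Ck_sum: "(\<And>i. i \<in> S \<Longrightarrow> Ck k (f i)) \<Longrightarrow> Ck k (\<lambda>x. \<Sum>i\<in>S. f i x)"
  by (induction S rule: infinite_finite_induct) (auto simp: Ck_const Ck_add)

text \<open>The direction in f'(g x) (g' x v) moves with x, whereas \<open>Ck\<close> differentiates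
  in fixed directions. Expanding it in the basis leaves products of a C^k coefficient and a
  derivative in a fixed basis direction; hence the Euclidean middle space.\<close>

lemma Ck_compose:
  fixes f :: "'b::euclidean_space \<Rightarrow> 'c::real_normed_vector"
  assumes "Ck k f" "Ck k g" shows "Ck k (\<lambda>x. f (g x))"
  using assms
proof (induction k arbitrary: f g)
  case 0 then show ?case by (auto intro: continuous_on_compose2)
next
  case (Suc k)
  let ?f' = "\<lambda>y. frechet_derivative f (at y)" and ?g' = "\<lambda>x. frechet_derivative g (at x)"
  show ?case
  proof (rule Ck_SucI)
    fix x
    show "((\<lambda>x. f (g x)) has_derivative (\<lambda>v. \<Sum>b\<in>Basis. (?g' x v \<bullet> b) *\<^sub>R ?f' (g x) b)) (at x)"
    proof -
      have l: "linear (?f' (g x))"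
        using Ck_SucD(1)[OF Suc.prems(1)] has_derivative_linear by blast
      have "(\<Sum>b\<in>Basis. (?g' x v \<bullet> b) *\<^sub>R ?f' (g x) b) = ?f' (g x) (?g' x v)" for v
        by (subst (3) euclidean_representation[symmetric])
          (simp only: linear_sum[OF l] linear_scale[OF l])
      then show ?thesis
        using has_derivative_compose[OF Ck_SucD(1)[OF Suc.prems(2)] Ck_SucD(1)[OF Suc.prems(1)]] by simp
    qed
  next
    fix v
    show "Ck k (\<lambda>x. \<Sum>b\<in>Basis. (?g' x v \<bullet> b) *\<^sub>R ?f' (g x) b)"
    proof (intro Ck_sum Ck_scaleR)
      fix b :: 'b assume "b \<in> Basis"
      then show "Ck k (\<lambda>x. ?g' x v \<bullet> b)"
        using Ck_componentwise[of k "\<lambda>x. ?g' x v"] Ck_SucD(2)[OF Suc.prems(2), of v] by blast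
      show "Ck k (\<lambda>x. ?f' (g x) b)"
        by (rule Suc.IH[OF Ck_SucD(2)[OF Suc.prems(1)] Ck_mono_Suc[OF Suc.prems(2)]])
    qed
  qed
qed

named_theorems smooth_intros

lemma smooth_const [smooth_intros, simp]: "smooth (\<lambda>x. a)"
  by (simp add: smooth_def Ck_const)

lemma smooth_linear: "bounded_linear f \<Longrightarrow> smooth f"
  by (simp add: smooth_def Ck_linear)

lemma smooth_ident [smooth_intros, simp]: "smooth (\<lambda>x. x)"
  by (rule smooth_linear) (rule bounded_linear_ident)

lemma smooth_add [smooth_intros]: "smooth f \<Longrightarrow> smooth g \<Longrightarrow> smooth (\<lambda>x. f x + g x)"
  by (simp add: smooth_def Ck_add)

lemma smooth_scaleR [smooth_intros]: "smooth f \<Longrightarrow> smooth g \<Longrightarrow> smooth (\<lambda>x. f x *\<^sub>R g x)"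
  by (simp add: smooth_def Ck_scaleR)

lemma smooth_mult [smooth_intros]:
  fixes f g :: "_ \<Rightarrow> real"
  shows "smooth f \<Longrightarrow> smooth g \<Longrightarrow> smooth (\<lambda>x. f x * g x)"
  using smooth_scaleR[of f g] by simp

lemma smooth_minus [smooth_intros]: "smooth f \<Longrightarrow> smooth (\<lambda>x. - f x)"
  using smooth_scaleR[of "\<lambda>_. -1" f] by simp

lemma smooth_diff [smooth_intros]: "smooth f \<Longrightarrow> smooth g \<Longrightarrow> smooth (\<lambda>x. f x - g x)"
  using smooth_add[OF _ smooth_minus[of g]] by simp

lemma smooth_sum [smooth_intros]:
  "(\<And>i. i \<in> S \<Longrightarrow> smooth (f i)) \<Longrightarrow> smooth (\<lambda>x. \<Sum>i\<in>S. f i x)"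
  by (simp add: smooth_def Ck_sum)

lemma smooth_power [smooth_intros]:
  fixes f :: "_ \<Rightarrow> real" shows "smooth f \<Longrightarrow> smooth (\<lambda>x. f x ^ n)"
  by (induction n) (auto intro!: smooth_intros)

lemma smooth_compose:
  fixes f :: "'b::euclidean_space \<Rightarrow> 'c::real_normed_vector"
  shows "smooth f \<Longrightarrow> smooth g \<Longrightarrow> smooth (\<lambda>x. f (g x))"
  by (simp add: smooth_def Ck_compose)

lemma smooth_bounded_linear:
  fixes h :: "'b::euclidean_space \<Rightarrow> 'c::real_normed_vector"
  shows "bounded_linear h \<Longrightarrow> smooth g \<Longrightarrow> smooth (\<lambda>x. h (g x))"
  by (rule smooth_compose[OF smooth_linear])

lemma smooth_inner [smooth_intros]:
  fixes g :: "_ \<Rightarrow> 'b::euclidean_space" shows "smooth g \<Longrightarrow> smooth (\<lambda>x. g x \<bullet> b)"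
  by (rule smooth_bounded_linear[OF bounded_linear_inner_left])

lemma smooth_vec_nth [smooth_intros]:
  fixes g :: "_ \<Rightarrow> real ^ 'p::finite" shows "smooth g \<Longrightarrow> smooth (\<lambda>x. g x $ i)"
  by (rule smooth_bounded_linear[OF bounded_linear_vec_nth])

lemma smooth_fst [smooth_intros]:
  fixes g :: "_ \<Rightarrow> 'b::euclidean_space \<times> 'c::euclidean_space"
  shows "smooth g \<Longrightarrow> smooth (\<lambda>x. fst (g x))"
  by (rule smooth_bounded_linear[OF bounded_linear_fst])

lemma smooth_snd [smooth_intros]:
  fixes g :: "_ \<Rightarrow> 'b::euclidean_space \<times> 'c::euclidean_space"
  shows "smooth g \<Longrightarrow> smooth (\<lambda>x. snd (g x))"
  by (rule smooth_bounded_linear[OF bounded_linear_snd])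

lemma smooth_Pair [smooth_intros]:
  fixes f :: "_ \<Rightarrow> 'b::euclidean_space" and g :: "_ \<Rightarrow> 'c::euclidean_space"
  assumes "smooth f" "smooth g" shows "smooth (\<lambda>x. (f x, g x))"
  unfolding smooth_componentwise[of "\<lambda>x. (f x, g x)"]
  using assms by (auto simp: Basis_prod_def smooth_inner)

lemma smooth_vec_iff:
  fixes f :: "_ \<Rightarrow> real ^ 'p::finite"
  shows "smooth f \<longleftrightarrow> (\<forall>i. smooth (\<lambda>x. f x $ i))"
  by (simp add: smooth_componentwise[of f] Basis_vec_def inner_axis)

lemma smooth_imp_continuous: "smooth f \<Longrightarrow> continuous_on UNIV f"
  unfolding smooth_def by (metis Ck.simps(1))


subsection \<open>Smooth functions of one real variable\<close>

text \<open>Series and parametric integrals have derivatives of the same form again, so the class of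
  all such expressions is closed under differentiation; this coinduction principle then concludes
  smoothness at once.\<close>

lemma smooth_real_coinduct:
  fixes f :: "real \<Rightarrow> real"
  assumes "P f"
    and "\<And>f. P f \<Longrightarrow> \<exists>f'. P f' \<and> (\<forall>x. (f has_real_derivative f' x) (at x))"
  shows "smooth f"
proof -
  have "Ck k f" if "P f" for k f
    using that
  proof (induction k arbitrary: f)
    case 0
    then show ?case using assms(2)[OF 0]
      by (auto intro: DERIV_continuous_on has_field_derivative_at_within)
  next
    case (Suc k)
    then obtain f' where f': "P f'" "\<And>x. (f has_real_derivative f' x) (at x)"
      using assms(2) by blast
    show ?case
    proof (rule Ck_SucI)
      show "(f has_derivative (\<lambda>v. f' x * v)) (at x)" for x
        using f'(2) by (simp add: has_field_derivative_def)
      show "Ck k (\<lambda>x. f' x * v)" for v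
        using Ck_scaleR[OF Suc.IH[OF f'(1)] Ck_const[of k v]] by simp
    qed
  qed
  with assms(1) show ?thesis by (simp add: smooth_def)
qed

lemma smooth_real_derivative:
  fixes f :: "real \<Rightarrow> real"
  assumes "smooth f"
  shows smooth_has_deriv: "(f has_real_derivative deriv f x) (at x)"
    and smooth_deriv: "smooth (deriv f)"
proof -
  have d: "(f has_real_derivative frechet_derivative f (at x) 1) (at x)" for x
  proof -
    have "(f has_derivative frechet_derivative f (at x)) (at x)"
      using Ck_SucD(1)[of 0 f x] assms[unfolded smooth_def, rule_format, of "Suc 0"] by blast
    moreover have "frechet_derivative f (at x) = (\<lambda>v. frechet_derivative f (at x) 1 * v)"
    proof
      fix v
      show "frechet_derivative f (at x) v = frechet_derivative f (at x) 1 * v"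
        using linear_scale[OF has_derivative_linear[OF calculation], of v 1] by simp
    qed
    ultimately show ?thesis unfolding has_field_derivative_def by metis
  qed
  then have "deriv f = (\<lambda>x. frechet_derivative f (at x) 1)"
    using DERIV_imp_deriv by blast
  then show "(f has_real_derivative deriv f x) (at x)" "smooth (deriv f)"
    using d Ck_SucD(2)[OF assms[unfolded smooth_def, rule_format]] by (auto simp: smooth_def)
qed

lemma smooth_higher_deriv: "smooth f \<Longrightarrow> smooth ((deriv ^^ n) (f :: real \<Rightarrow> real))"
  by (induction n) (auto simp: smooth_deriv)

lemma higher_deriv_has_deriv:
  "smooth f \<Longrightarrow> ((deriv ^^ n) f has_real_derivative (deriv ^^ Suc n) f x) (at (x::real))"
  using smooth_has_deriv[OF smooth_higher_deriv[of f n]] by simp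

lemma deriv_affine:
  assumes "smooth (f :: real \<Rightarrow> real)"
  shows "deriv (\<lambda>t. f (a + m * t)) = (\<lambda>t. m * deriv f (a + m * t))"
proof
  fix t
  have "((\<lambda>t. f (a + m * t)) has_real_derivative deriv f (a + m * t) * m) (at t)"
    by (rule DERIV_chain2[OF smooth_has_deriv[OF assms]]) (auto intro!: derivative_eq_intros)
  then show "deriv (\<lambda>t. f (a + m * t)) t = m * deriv f (a + m * t)"
    by (simp add: DERIV_imp_deriv mult.commute)
qed

lemma deriv_cmult: "smooth (f :: real \<Rightarrow> real) \<Longrightarrow> deriv (\<lambda>x. c * f x) = (\<lambda>x. c * deriv f x)"
  by (rule ext) (metis DERIV_cmult DERIV_imp_deriv smooth_has_deriv)

lemma higher_deriv_cmult:
  "smooth (f :: real \<Rightarrow> real) \<Longrightarrow> (deriv ^^ n) (\<lambda>x. c * f x) = (\<lambda>x. c * (deriv ^^ n) f x)"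
  by (induction n) (auto simp: deriv_cmult smooth_higher_deriv)

lemma higher_deriv_diff:
  fixes f g :: "real \<Rightarrow> real"
  assumes "smooth f" "smooth g"
  shows "(deriv ^^ n) (\<lambda>x. f x - g x) = (\<lambda>x. (deriv ^^ n) f x - (deriv ^^ n) g x)"
proof (induction n)
  case (Suc n)
  have "deriv (\<lambda>x. (deriv ^^ n) f x - (deriv ^^ n) g x) x = (deriv ^^ Suc n) f x - (deriv ^^ Suc n) g x" for x
    by (intro DERIV_imp_deriv DERIV_diff higher_deriv_has_deriv assms)
  with Suc show ?case by auto
qed simp

lemma higher_deriv_affine:
  assumes "smooth (f :: real \<Rightarrow> real)"
  shows "(deriv ^^ n) (\<lambda>t. f (a + m * t)) = (\<lambda>t. m ^ n * (deriv ^^ n) f (a + m * t))"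
proof (induction n)
  case (Suc n)
  have s: "smooth (\<lambda>t. (deriv ^^ n) f (a + m * t))"
    by (intro smooth_compose[OF smooth_higher_deriv[OF assms]] smooth_intros)
  have "deriv (\<lambda>t. m ^ n * (deriv ^^ n) f (a + m * t)) = (\<lambda>t. m ^ n * (m * deriv ((deriv ^^ n) f) (a + m * t)))"
    using deriv_cmult[OF s] deriv_affine[OF smooth_higher_deriv[OF assms]] by simp
  with Suc show ?case by (simp add: mult_ac)
qed simp

lemma higher_deriv_cong_eventually:
  assumes "\<forall>\<^sub>F x in nhds a. f x = g (x :: real)"
  shows "(deriv ^^ n) f a = (deriv ^^ n) (g :: real \<Rightarrow> real) a"
proof -
  have "\<forall>\<^sub>F x in nhds a. (deriv ^^ n) f x = (deriv ^^ n) g x"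
  proof (induction n)
    case (Suc n)
    then have "\<forall>\<^sub>F y in nhds a. \<forall>\<^sub>F x in nhds y. (deriv ^^ n) f x = (deriv ^^ n) g x"
      by (simp only: eventually_eventually)
    then show ?case
      by eventually_elim (simp add: deriv_cong_ev)
  qed (use assms in simp)
  then show ?thesis by (rule eventually_nhds_x_imp_x)
qed

text \<open>The locally uniform bounds on every derivative permit termwise differentiation any
  number of times. The invariant class for the coinduction consists of the termwise j-th
  derivatives, for all j.\<close>

lemma smooth_series:
  fixes f :: "nat \<Rightarrow> real \<Rightarrow> real"
  assumes sm: "\<And>k. smooth (f k)"
    and bound: "\<And>j R. \<exists>M. summable M \<and> (\<forall>k x. \<bar>x\<bar> \<le> R \<longrightarrow> \<bar>(deriv ^^ j) (f k) x\<bar> \<le> M k)"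
  shows "smooth (\<lambda>x. \<Sum>k. f k x)"
proof (rule smooth_real_coinduct[where P="\<lambda>g. \<exists>j. g = (\<lambda>x. \<Sum>k. (deriv ^^ j) (f k) x)"])
  show "\<exists>j. (\<lambda>x. \<Sum>k. f k x) = (\<lambda>x. \<Sum>k. (deriv ^^ j) (f k) x)"
    by (rule exI[of _ 0]) simp
next
  fix g :: "real \<Rightarrow> real"
  assume "\<exists>j. g = (\<lambda>x. \<Sum>k. (deriv ^^ j) (f k) x)"
  then obtain j where g: "g = (\<lambda>x. \<Sum>k. (deriv ^^ j) (f k) x)" by blast
  have "(g has_real_derivative (\<Sum>k. (deriv ^^ Suc j) (f k) x)) (at x)" for x
  proof -
    \<comment> \<open>Termwise differentiation yields a derivative within a convex set only; the
      margin 1 keeps x in the interior, where it is a derivative at x.\<close>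
    define S where "S = {-(\<bar>x\<bar>+1)..\<bar>x\<bar>+1}"
    obtain M where M: "summable M" "\<And>k y. y \<in> S \<Longrightarrow> \<bar>(deriv ^^ Suc j) (f k) y\<bar> \<le> M k"
    proof -
      have S: "\<bar>y\<bar> \<le> \<bar>x\<bar> + 1" if "y \<in> S" for y
        using that by (auto simp: S_def)
      obtain M where "summable M" "\<forall>k y. \<bar>y\<bar> \<le> \<bar>x\<bar> + 1 \<longrightarrow> \<bar>(deriv ^^ Suc j) (f k) y\<bar> \<le> M k"
        using bound[of "\<bar>x\<bar> + 1" "Suc j"] by (elim exE conjE)
      then show ?thesis using S that by meson
    qed
    have summ: "summable (\<lambda>k. (deriv ^^ j) (f k) y)" for y
    proof -
      obtain M where "summable M" "\<forall>k x. \<bar>x\<bar> \<le> \<bar>y\<bar> \<longrightarrow> \<bar>(deriv ^^ j) (f k) x\<bar> \<le> M k"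
        using bound[of "\<bar>y\<bar>" j] by (elim exE conjE)
      then show ?thesis by (auto intro: summable_comparison_test'[of M])
    qed
    have u: "uniform_limit S (\<lambda>n x. \<Sum>i<n. (deriv ^^ Suc j) (f i) x) (\<lambda>x. \<Sum>k. (deriv ^^ Suc j) (f k) x) sequentially"
      by (rule Weierstrass_m_test[OF _ M(1)]) (use M(2) in auto)
    have S: "convex S" "x \<in> S" "x \<in> interior S" by (auto simp: S_def)
    have "\<exists>h. \<forall>y\<in>S. (\<lambda>k. (deriv ^^ j) (f k) y) sums h y \<and>
      (h has_real_derivative (\<Sum>k. (deriv ^^ Suc j) (f k) y)) (at y within S)"
      by (rule has_field_derivative_series[OF S(1) _ u S(2) summ])
        (rule has_field_derivative_at_within[OF higher_deriv_has_deriv[OF sm]])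
    then obtain h where h: "\<And>y. y \<in> S \<Longrightarrow> (\<lambda>k. (deriv ^^ j) (f k) y) sums h y"
      "\<And>y. y \<in> S \<Longrightarrow> (h has_real_derivative (\<Sum>k. (deriv ^^ Suc j) (f k) y)) (at y within S)"
      by metis
    have "(h has_real_derivative (\<Sum>k. (deriv ^^ Suc j) (f k) x)) (at x)"
      using h(2)[OF S(2)] unfolding at_within_interior[OF S(3)] .
    moreover have "\<forall>\<^sub>F y in nhds x. h y = g y"
    proof -
      have "\<forall>\<^sub>F y in nhds x. y \<in> interior S"
        using S(3) by (intro eventually_nhds_in_open) auto
      then show ?thesis
      proof eventually_elim
        fix y assume "y \<in> interior S"
        then have "y \<in> S" using interior_subset by blast
        from h(1)[OF this] show "h y = g y" by (simp add: g sums_iff)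
      qed
    qed
    ultimately show ?thesis using DERIV_cong_ev[OF refl _ refl, of h g x] by metis
  qed
  then show "\<exists>g'. (\<exists>j. g' = (\<lambda>x. \<Sum>k. (deriv ^^ j) (f k) x)) \<and> (\<forall>x. (g has_real_derivative g' x) (at x))"
    by blast
qed

subsection \<open>Bump functions and curves through fast convergent sequences\<close>

lemma Ck_inverse:
  fixes f :: "'a::real_normed_vector \<Rightarrow> real"
  assumes "Ck k f" "\<And>x. f x \<noteq> 0"
  shows "Ck k (\<lambda>x. inverse (f x))"
  using assms(1)
proof (induction k)
  case 0 then show ?case using assms(2) by (auto intro: continuous_on_inverse)
next
  case (Suc k)
  show ?case
  proof (rule Ck_SucI)
    show "((\<lambda>x. inverse (f x)) has_derivative
        (\<lambda>v. - (inverse (f x) * frechet_derivative f (at x) v * inverse (f x)))) (at x)" for x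
      by (rule Deriv.has_derivative_inverse[OF assms(2) Ck_SucD(1)[OF Suc.prems]])
    have 1: "Ck k (\<lambda>x. inverse (f x))" by (rule Suc.IH[OF Ck_mono_Suc[OF Suc.prems]])
    show "Ck k (\<lambda>x. - (inverse (f x) * frechet_derivative f (at x) v * inverse (f x)))" for v
      using Ck_scaleR[OF Ck_const[of k "-1"] Ck_scaleR[OF Ck_scaleR[OF 1 Ck_SucD(2)[OF Suc.prems, of v]] 1]] by simp
  qed
qed

text \<open>\<open>flat 0\<close> is the classical exp(-1/x), extended by zero. The powers of 1/x
  close the family under differentiation, so that smoothness of all members is one induction on the
  order.\<close>

definition flat :: "nat \<Rightarrow> real \<Rightarrow> real" where
  "flat k x = (if x > 0 then inverse x ^ k / exp (inverse x) else 0)"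

lemma flat_tendsto_0: "(flat k \<longlongrightarrow> 0) (at 0)"
proof -
  have "((\<lambda>x. inverse x ^ k / exp (inverse x)) \<longlongrightarrow> 0) (at_right (0::real))"
    by (rule filterlim_compose[OF tendsto_power_div_exp_0 filterlim_inverse_at_top_right])
  then have r: "(flat k \<longlongrightarrow> 0) (at_right 0)"
    by (rule Lim_transform_eventually) (auto simp: flat_def eventually_at_right_less eventually_at_filter)
  have l: "(flat k \<longlongrightarrow> 0) (at_left 0)"
    by (rule Lim_transform_eventually[OF tendsto_const[of 0]]) (auto simp: flat_def eventually_at_filter)
  show ?thesis using l r by (simp add: filterlim_split_at)
qed

lemma flat_has_deriv:
  "(flat k has_real_derivative flat (k + 2) x - real k * flat (k + 1) x) (at x)"
proof (cases x "0 :: real" rule: linorder_cases)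
  case less
  have "((\<lambda>_. 0) has_real_derivative flat (k + 2) x - real k * flat (k + 1) x) (at x)"
    using less by (simp add: flat_def)
  moreover have "\<forall>\<^sub>F y in nhds x. 0 = flat k y"
    using eventually_nhds_in_open[of "{..<0}" x] less by (auto elim!: eventually_mono simp: flat_def)
  ultimately show ?thesis using DERIV_cong_ev[OF refl _ refl, of "\<lambda>_. 0" "flat k" x] by metis
next
  case equal
  \<comment> \<open>Away from 0 the difference quotient of \<open>flat k\<close> is
    \<open>flat (k + 1)\<close>, so the limit at 0 already established for all members gives the
    derivative.\<close>
  have "((\<lambda>h. flat k (0 + h) / h) \<longlongrightarrow> 0) (at 0)"
    by (rule Lim_transform_eventually[OF flat_tendsto_0[of "k+1"]])
      (auto simp: flat_def eventually_at_filter field_simps)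
  then show ?thesis using equal by (simp add: DERIV_def flat_def)
next
  case greater
  have "((\<lambda>x. inverse x ^ k / exp (inverse x)) has_real_derivative
      flat (k + 2) x - real k * flat (k + 1) x) (at x)"
  proof -
    define y where "y = inverse x"
    have 1: "((\<lambda>y. y ^ k / exp y) has_real_derivative (real k * y ^ (k - 1) - y ^ k) / exp y) (at y)"
      by (auto intro!: derivative_eq_intros simp: field_simps)
    have 2: "(inverse has_real_derivative - (y ^ 2)) (at x)"
      using DERIV_inverse[of x UNIV] greater by (simp add: y_def power2_eq_square numeral_2_eq_2)
    have fl: "flat j x = y ^ j / exp y" for j
      using greater by (simp add: flat_def y_def)
    have "(real k * y ^ (k - 1) - y ^ k) / exp y * - (y ^ 2) = flat (k + 2) x - real k * flat (k + 1) x"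
      unfolding fl by (cases k) (simp_all add: field_simps power2_eq_square)
    with DERIV_chain2[OF 1[unfolded y_def] 2[unfolded y_def]] show ?thesis by (simp add: y_def)
  qed
  moreover have "\<forall>\<^sub>F y in nhds x. inverse y ^ k / exp (inverse y) = flat k y"
    using eventually_nhds_in_open[of "{0<..}" x] greater by (auto elim!: eventually_mono simp: flat_def)
  ultimately show ?thesis
    using DERIV_cong_ev[OF refl _ refl, of "\<lambda>x. inverse x ^ k / exp (inverse x)" "flat k" x] by metis
qed

lemma smooth_flat: "smooth (flat k)"
proof -
  have "Ck m (flat k)" for m k
  proof (induction m arbitrary: k)
    case 0 show ?case
      by (simp add: DERIV_continuous_on[OF has_field_derivative_at_within[OF flat_has_deriv]])
  next
    case (Suc m)
    show ?case
    proof (rule Ck_SucI)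
      show "(flat k has_derivative (\<lambda>v. v *\<^sub>R (flat (k + 2) x + (- real k) *\<^sub>R flat (k + 1) x))) (at x)" for x
        using flat_has_deriv[of k x] by (simp add: has_field_derivative_def mult_commute_abs)
      show "Ck m (\<lambda>x. v *\<^sub>R (flat (k + 2) x + (- real k) *\<^sub>R flat (k + 1) x))" for v
        by (intro Ck_scaleR Ck_add Ck_const Suc)
    qed
  qed
  then show ?thesis by (simp add: smooth_def)
qed

lemma smooth_bump_exists:
  obtains b :: "real \<Rightarrow> real" where "smooth b" "\<And>x. \<bar>x\<bar> \<le> 1/2 \<Longrightarrow> b x = 1" "\<And>x. \<bar>x\<bar> \<ge> 1 \<Longrightarrow> b x = 0"
proof -
  \<comment> \<open>\<open>S\<close> rises from 0 to 1 between the arguments 0 and 1. The argument 2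
    - 2 x^2 used in \<open>b\<close> is at least 3/2 for |x| \<le> 1/2 and at most 0 for |x| \<ge>
    1.\<close>
  define S where "S x = flat 0 x * inverse (flat 0 x + flat 0 (1 - x))" for x
  define b where "b x = S (2 - 2 * x ^ 2)" for x
  have pos: "flat 0 x + flat 0 (1 - x) \<noteq> 0" for x
    by (auto simp: flat_def add_nonneg_eq_0_iff)
  have "smooth (\<lambda>x. flat 0 x + flat 0 (1 - x))"
    by (intro smooth_add smooth_flat smooth_compose[OF smooth_flat] smooth_diff smooth_const smooth_ident)
  then have "smooth (\<lambda>x. inverse (flat 0 x + flat 0 (1 - x)))"
    unfolding smooth_def by (intro allI Ck_inverse pos) blast
  then have "smooth S"
    unfolding S_def by (intro smooth_mult smooth_flat)
  then have "smooth b"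
    unfolding b_def by (rule smooth_compose) (intro smooth_mult smooth_power smooth_diff smooth_const smooth_ident)
  moreover have "b x = 1" if "\<bar>x\<bar> \<le> 1/2" for x
  proof -
    have "x ^ 2 \<le> (1/2) ^ 2" using that by (metis abs_ge_zero power2_abs power_mono)
    then have "1 - (2 - 2 * x ^ 2) \<le> 0" "2 - 2 * x ^ 2 > 0" by (auto simp: power2_eq_square)
    then show ?thesis by (simp add: b_def S_def flat_def)
  qed
  moreover have "b x = 0" if "\<bar>x\<bar> \<ge> 1" for x
  proof -
    have "x ^ 2 \<ge> 1" using that by (metis abs_ge_zero one_le_power power2_abs)
    then show ?thesis by (simp add: b_def S_def flat_def)
  qed
  ultimately show ?thesis using that by blast
qed

lemma higher_deriv_bounded:
  fixes b :: "real \<Rightarrow> real"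
  assumes "smooth b" and 0: "\<And>x. \<bar>x\<bar> \<ge> 1 \<Longrightarrow> b x = 0"
  shows "\<exists>B\<ge>0. \<forall>x. \<bar>(deriv ^^ j) b x\<bar> \<le> B"
proof -
  have "compact ((deriv ^^ j) b ` {-1..1})"
    by (intro compact_continuous_image compact_Icc
        continuous_on_subset[OF smooth_imp_continuous[OF smooth_higher_deriv[OF assms(1)]]]) auto
  then obtain B where B: "\<And>x. x \<in> {-1..1} \<Longrightarrow> \<bar>(deriv ^^ j) b x\<bar> \<le> B"
    using compact_imp_bounded bounded_iff by (metis imageI real_norm_def)
  have "\<bar>(deriv ^^ j) b x\<bar> \<le> max B 0" for x
  proof (cases "\<bar>x\<bar> \<le> 1")
    case True then show ?thesis using B[of x] by (simp add: abs_le_iff le_max_iff_disj)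
  next
    case False
    have "\<forall>\<^sub>F y in nhds x. b y = 0"
      using eventually_nhds_in_open[of "{y. \<bar>y\<bar> > 1}" x] False
      by (auto elim!: eventually_mono simp: 0 open_Collect_less continuous_intros)
    then have "(deriv ^^ j) b x = (deriv ^^ j) (\<lambda>_. 0) x"
      by (rule higher_deriv_cong_eventually)
    also have "(deriv ^^ j) (\<lambda>_. 0 :: real) = (\<lambda>_. 0)" by (induction j) auto
    finally show ?thesis by simp
  qed
  then show ?thesis by (intro exI[of _ "max B 0"]) auto
qed

text \<open>The k-th bump is centred at 2^-k with width proportional to 2^-k, so its j-th derivative
  is of size (4 * 2^k)^j. The quadratic exponent in the bound on \<open>a k\<close> beats every such
  factor, and the derivatives of each order are summable.\<close>

lemma smooth_bump_series:
  fixes b :: "real \<Rightarrow> real"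
  assumes b: "smooth b" "\<And>x. \<bar>x\<bar> \<ge> 1 \<Longrightarrow> b x = 0"
    and a: "\<And>k. \<bar>a k\<bar> \<le> (1/2) ^ (k * k)"
  shows "smooth (\<lambda>r. \<Sum>k. a k * b (- 4 + 4 * 2 ^ k * r))"
proof (rule smooth_series)
  have sm: "smooth (\<lambda>r. b (- 4 + 4 * 2 ^ k * r))" for k
    by (intro smooth_compose[OF b(1)] smooth_add smooth_mult smooth_const smooth_ident)
  then show "smooth (\<lambda>r. a k * b (- 4 + 4 * 2 ^ k * r))" for k
    by (intro smooth_mult smooth_const)
  fix j :: nat and R :: real
  obtain B where B: "B \<ge> 0" "\<And>x. \<bar>(deriv ^^ j) b x\<bar> \<le> B"
    using higher_deriv_bounded[OF b] by blast
  define M where "M k = (1/2) ^ (k * k) * ((4 * 2 ^ k) ^ j * B)" for k :: nat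
  have "\<bar>(deriv ^^ j) (\<lambda>r. a k * b (- 4 + 4 * 2 ^ k * r)) x\<bar> \<le> M k" for k x
    unfolding higher_deriv_cmult[OF sm] higher_deriv_affine[OF b(1)] M_def abs_mult power_abs abs_numeral
    using B a[of k] by (intro mult_mono) auto
  moreover have "summable M"
  proof (rule summable_comparison_test)
    show "summable (\<lambda>k. 4 ^ j * B * (1/2) ^ k :: real)"
      by (intro summable_mult summable_geometric) simp
    have "norm (M k) \<le> 4 ^ j * B * (1/2) ^ k" if "k \<ge> j + 1" for k
    proof -
      have "k * j + k \<le> k * k" using mult_le_mono2[OF that, of k] by (simp add: algebra_simps)
      then obtain d where d: "k * k = k * j + k + d" using le_Suc_ex by blast
      have "(1/2) ^ (k * k) * (2 ^ k) ^ j = (1/2 :: real) ^ k * (1/2) ^ d"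
        by (simp add: d power_add power_mult[symmetric] power_one_over)
      also have "\<dots> \<le> (1/2 :: real) ^ k" by (simp add: power_le_one mult_left_le)
      finally have "(1/2) ^ (k * k) * (2 ^ k) ^ j \<le> (1/2 :: real) ^ k" .
      from mult_left_mono[OF this, of "4 ^ j * B"] B(1) show ?thesis
        by (simp add: M_def power_mult_distrib mult_ac)
    qed
    then show "\<exists>N. \<forall>n\<ge>N. norm (M n) \<le> 4 ^ j * B * (1/2) ^ n" by blast
  qed
  ultimately show "\<exists>M. summable M \<and> (\<forall>k x. \<bar>x\<bar> \<le> R \<longrightarrow>
      \<bar>(deriv ^^ j) (\<lambda>r. a k * b (- 4 + 4 * 2 ^ k * r)) x\<bar> \<le> M k)"
    by blast
qed

text \<open>The special curve lemma: points that converge to 0 faster than any power of the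
  parameters 2^-k lie on one smooth curve. Near each parameter the curve is moreover a straight line
  with prescribed velocity, so that directional derivatives at those points can be read off along
  it.\<close>

lemma special_curve:
  fixes x v :: "nat \<Rightarrow> 'a::euclidean_space"
  assumes x: "\<And>k. norm (x k) \<le> (1/2) ^ (k * k)" and v: "\<And>k. norm (v k) \<le> (1/2) ^ (k * k)"
  obtains c :: "real \<Rightarrow> 'a" where "smooth c" "c 0 = 0"
    "\<And>k r. \<bar>r - (1/2) ^ k\<bar> \<le> (1/2) ^ k / 8 \<Longrightarrow> c r = x k + (r - (1/2) ^ k) *\<^sub>R v k"
proof -
  obtain b :: "real \<Rightarrow> real" where b: "smooth b" "\<And>x. \<bar>x\<bar> \<le> 1/2 \<Longrightarrow> b x = 1" "\<And>x. \<bar>x\<bar> \<ge> 1 \<Longrightarrow> b x = 0"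
    using smooth_bump_exists by blast
  define g where "g t = t * b t" for t
  have g: "smooth g" "\<And>x. \<bar>x\<bar> \<ge> 1 \<Longrightarrow> g x = 0"
    unfolding g_def using b by (auto intro!: smooth_mult)
  define s where "s k r = - 4 + 4 * 2 ^ k * r" for k :: nat and r :: real
  define X where "X r e = (\<Sum>k. (x k \<bullet> e) * b (s k r))" for r e
  \<comment> \<open>Where \<open>b\<close> is 1, \<open>g (s k r)\<close> is 4 * 2^k times the
    signed distance of r from 2^-k; the divisor normalizes the velocity to
    \<open>v k\<close>.\<close>
  define V where "V r e = (\<Sum>k. (v k \<bullet> e) / (4 * 2 ^ k) * g (s k r))" for r e
  define c where "c r = (\<Sum>e\<in>Basis. (X r e + V r e) *\<^sub>R e)" for r
  have inn: "\<bar>y \<bullet> e\<bar> \<le> C" if "e \<in> Basis" "norm y \<le> C" for y e :: 'a and C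
    using that Basis_le_norm[of e y] by linarith
  have "smooth (\<lambda>r. X r e)" "smooth (\<lambda>r. V r e)" if "e \<in> Basis" for e
  proof -
    show "smooth (\<lambda>r. X r e)"
      unfolding X_def s_def by (rule smooth_bump_series[OF b(1,3) inn[OF that x]])
    have "\<bar>(v k \<bullet> e) / (4 * 2 ^ k)\<bar> \<le> (1/2) ^ (k * k)" for k
    proof -
      have "1 * 1 \<le> 4 * (2 :: real) ^ k"
        by (intro mult_mono) auto
      then have "\<bar>v k \<bullet> e\<bar> / (4 * 2 ^ k) \<le> \<bar>v k \<bullet> e\<bar> / 1"
        by (intro divide_left_mono) auto
      then show ?thesis using inn[OF that v, of k] by (simp add: abs_div)
    qed
    then show "smooth (\<lambda>r. V r e)"
      unfolding V_def s_def by (intro smooth_bump_series[OF g])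
  qed
  then have "smooth c"
    unfolding c_def by (intro smooth_sum smooth_scaleR smooth_add smooth_const)
  moreover have "c 0 = 0"
    by (simp add: c_def X_def V_def s_def b(3) g(2))
  moreover have "c r = x k + (r - (1/2) ^ k) *\<^sub>R v k" if r: "\<bar>r - (1/2) ^ k\<bar> \<le> (1/2) ^ k / 8" for k r
  proof -
    define t where "t = s k r"
    have t: "t = 4 * 2 ^ k * (r - (1/2) ^ k)"
      by (simp add: t_def s_def right_diff_distrib power_one_over)
    have "\<bar>t\<bar> = 4 * 2 ^ k * \<bar>r - (1/2) ^ k\<bar>" by (simp add: t abs_mult)
    also have "\<dots> \<le> 4 * 2 ^ k * ((1/2) ^ k / 8)" by (intro mult_left_mono r) auto
    also have "\<dots> = 1/2" by (simp add: power_one_over)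
    finally have t2: "\<bar>t\<bar> \<le> 1/2" .
    \<comment> \<open>Only one bump is active: 2^k * r lies in [7/8, 9/8], hence 2^l * r is at most
      9/16 for l < k and at least 7/4 for l > k, outside the support of the l-th bump in both
      cases.\<close>
    have far: "\<bar>s l r\<bar> \<ge> 1" if "l \<noteq> k" for l
    proof -
      have kr: "2 ^ k * r = 1 + t / 4" by (simp add: t_def s_def field_simps)
      show ?thesis
      proof (cases "l < k")
        case True
        then obtain d where d: "k = Suc l + d" using less_iff_Suc_add by auto
        have "0 \<le> 2 ^ k * r" using kr t2 by (simp add: abs_le_iff)
        then have "r \<ge> 0" by (meson mult_pos_neg not_le zero_less_numeral zero_less_power)
        then have r0: "2 ^ l * r \<ge> 0" by simp
        have "2 * (2 ^ l * r) * 1 \<le> 2 * (2 ^ l * r) * 2 ^ d"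
          by (intro mult_left_mono) (use r0 in auto)
        also have "\<dots> = 2 ^ k * r" by (simp add: d power_add)
        finally have "2 ^ l * r \<le> 5/8" using kr t2 by (simp add: abs_le_iff)
        then show ?thesis by (simp add: s_def)
      next
        case False
        then obtain d where d: "l = Suc k + d" using \<open>l \<noteq> k\<close> less_iff_Suc_add[of k l] by auto
        have kr0: "2 ^ k * r \<ge> 7/8" using kr t2 by (simp add: abs_le_iff)
        have "2 * (2 ^ k * r) * 1 \<le> 2 * (2 ^ k * r) * 2 ^ d"
          by (intro mult_left_mono) (use kr0 in auto)
        also have "\<dots> = 2 ^ l * r" by (simp add: d power_add)
        finally have "2 ^ l * r \<ge> 7/4" using kr0 by simp
        then show ?thesis by (simp add: s_def)
      qed
    qed
    have "X r e = x k \<bullet> e" for e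
    proof -
      have "X r e = (\<Sum>l\<in>{k}. (x l \<bullet> e) * b (s l r))"
        unfolding X_def by (rule suminf_finite) (auto simp: b(3)[OF far])
      then show ?thesis using b(2)[OF t2] by (simp add: t_def)
    qed
    moreover have "V r e = (r - (1/2) ^ k) * (v k \<bullet> e)" for e
    proof -
      have "V r e = (\<Sum>l\<in>{k}. (v l \<bullet> e) / (4 * 2 ^ l) * g (s l r))"
        unfolding V_def by (rule suminf_finite) (auto simp: g(2)[OF far])
      also have "\<dots> = (v k \<bullet> e) / (4 * 2 ^ k) * t" using b(2)[OF t2] by (simp add: t_def g_def)
      finally show ?thesis by (simp add: t)
    qed
    ultimately have "c r = (\<Sum>e\<in>Basis. ((x k + (r - (1/2) ^ k) *\<^sub>R v k) \<bullet> e) *\<^sub>R e)"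
      by (simp add: c_def inner_add_left)
    then show ?thesis by (simp add: euclidean_representation)
  qed
  ultimately show ?thesis using that by blast
qed

subsection \<open>Boman's theorem\<close>

definition curve_smooth :: "('a::euclidean_space \<Rightarrow> real) \<Rightarrow> bool" where
  "curve_smooth f \<longleftrightarrow> (\<forall>c :: real \<Rightarrow> 'a. smooth c \<longrightarrow> smooth (\<lambda>r. f (c r)))"

lemma curve_smoothD: "curve_smooth f \<Longrightarrow> smooth (c :: real \<Rightarrow> _) \<Longrightarrow> smooth (\<lambda>r. f (c r))"
  by (simp add: curve_smooth_def)

lemma curve_smooth_line: "curve_smooth f \<Longrightarrow> smooth (\<lambda>t :: real. f (x + t *\<^sub>R w))"
  by (erule curve_smoothD) (intro smooth_add smooth_scaleR smooth_const smooth_ident)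

text \<open>A sequence violating continuity can be chosen to converge fast enough for the special
  curve lemma. Along the resulting curve f would be discontinuous at 0.\<close>

lemma curve_smooth_isCont:
  fixes f :: "'a::euclidean_space \<Rightarrow> real"
  assumes f: "curve_smooth f" shows "isCont f x"
proof (rule ccontr)
  assume "\<not> isCont f x"
  then obtain e where e: "e > 0" "\<And>d. d > 0 \<Longrightarrow> \<exists>y. norm (y - x) < d \<and> \<bar>f y - f x\<bar> \<ge> e"
    unfolding continuous_at_eps_delta dist_norm real_norm_def by (meson not_le)
  have "\<exists>y. norm (y - x) < (1/2) ^ (k * k) \<and> \<bar>f y - f x\<bar> \<ge> e" for k :: nat
    by (rule e(2)) simp
  then obtain y where y: "\<And>k. norm (y k - x) < (1/2) ^ (k * k)" "\<And>k. \<bar>f (y k) - f x\<bar> \<ge> e"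
    by metis
  obtain c where c: "smooth c" "c 0 = 0"
    "\<And>k r. \<bar>r - (1/2) ^ k\<bar> \<le> (1/2) ^ k / 8 \<Longrightarrow> c r = (y k - x) + (r - (1/2) ^ k) *\<^sub>R (0 :: 'a)"
    using special_curve[of "\<lambda>k. y k - x" "\<lambda>k. 0"] y(1) less_imp_le[OF y(1)] by auto
  define F where "F r = f (x + c r)" for r
  have "smooth F" unfolding F_def
    by (rule curve_smoothD[OF f]) (intro smooth_add smooth_const c)
  then have "isCont F 0"
    using smooth_imp_continuous continuous_on_eq_continuous_at open_UNIV by blast
  moreover have "(\<lambda>k. (1/2 :: real) ^ k) \<longlonglongrightarrow> 0" by (rule LIMSEQ_power_zero) simp
  ultimately have "(\<lambda>k. F ((1/2) ^ k)) \<longlonglongrightarrow> F 0"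
    by (rule isCont_tendsto_compose)
  then have "(\<lambda>k. \<bar>F ((1/2) ^ k) - F 0\<bar>) \<longlonglongrightarrow> \<bar>F 0 - F 0\<bar>"
    by (intro tendsto_rabs tendsto_diff tendsto_const)
  moreover have "F ((1/2) ^ k) = f (y k)" for k
    using c(3)[of "(1/2) ^ k" k] by (simp add: F_def)
  ultimately have "(\<lambda>k. \<bar>f (y k) - f x\<bar>) \<longlonglongrightarrow> 0" using c(2) by (simp add: F_def)
  then have "e \<le> 0" by (rule LIMSEQ_le_const) (use y(2) in blast)
  with e(1) show False by simp
qed

text \<open>Again a bad sequence is threaded by a curve, now with velocity
  \<open>(1/2) ^ (k * k)\<close> times w near the k-th point. The n-th derivative along the curve
  picks up the n-th power of that speed, so the sequence is chosen with derivatives exceeding k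
  times the inverse power; the n-th derivative along the curve would be unbounded on [0, 1].\<close>

lemma curve_smooth_dir_locally_bounded:
  fixes f :: "'a::euclidean_space \<Rightarrow> real"
  assumes f: "curve_smooth f" and w: "norm w \<le> 1"
  shows "\<exists>\<delta>>0. \<exists>C. \<forall>y. dist y x < \<delta> \<longrightarrow> \<bar>(deriv ^^ n) (\<lambda>t. f (y + t *\<^sub>R w)) 0\<bar> \<le> C"
proof (rule ccontr)
  define D where "D y = (deriv ^^ n) (\<lambda>t. f (y + t *\<^sub>R w)) 0" for y
  assume "\<not> ?thesis"
  then have unb: "\<exists>y. dist y x < \<delta> \<and> \<bar>D y\<bar> > C" if "\<delta> > 0" for \<delta> C
    using that unfolding D_def by (meson not_le)
  have "\<exists>y. dist y x < (1/2) ^ (k * k) \<and> \<bar>D y\<bar> > real k * (2 ^ (k * k)) ^ n" for k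
    by (rule unb) simp
  then obtain y where y: "\<And>k. norm (y k - x) < (1/2) ^ (k * k)" "\<And>k. \<bar>D (y k)\<bar> > real k * (2 ^ (k * k)) ^ n"
    unfolding dist_norm by metis
  define m where "m k = (1/2 :: real) ^ (k * k)" for k :: nat
  have "norm (m k *\<^sub>R w) \<le> (1/2) ^ (k * k)" for k
    using w by (simp add: m_def mult_left_le)
  then obtain c where c: "smooth c"
    "\<And>k r. \<bar>r - (1/2) ^ k\<bar> \<le> (1/2) ^ k / 8 \<Longrightarrow> c r = (y k - x) + (r - (1/2) ^ k) *\<^sub>R (m k *\<^sub>R w)"
    using special_curve[of "\<lambda>k. y k - x" "\<lambda>k. m k *\<^sub>R w"] less_imp_le[OF y(1)] by metis
  define F where "F r = f (x + c r)" for r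
  have F: "smooth F" unfolding F_def
    by (rule curve_smoothD[OF f]) (intro smooth_add smooth_const c)
  have "compact ((deriv ^^ n) F ` {0..1})"
    by (intro compact_continuous_image compact_Icc
        continuous_on_subset[OF smooth_imp_continuous[OF smooth_higher_deriv[OF F]]]) auto
  then obtain B where B: "\<And>x. x \<in> {0..1} \<Longrightarrow> \<bar>(deriv ^^ n) F x\<bar> \<le> B"
    using compact_imp_bounded bounded_iff by (metis imageI real_norm_def)
  have "real k < B" for k
  proof -
    define p where "p t = f (y k + t *\<^sub>R w)" for t
    define rk where "rk = (1/2 :: real) ^ k"
    have rk: "0 < rk" "rk \<le> 1" by (auto simp: rk_def power_le_one)
    have p: "smooth p" unfolding p_def by (rule curve_smooth_line[OF f])
    have "\<forall>\<^sub>F r in nhds rk. \<bar>r - rk\<bar> < rk / 8"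
      using eventually_nhds_in_open[of "ball rk (rk / 8)" rk] rk
      by (auto elim!: eventually_mono simp: dist_real_def abs_minus_commute)
    then have ev: "\<forall>\<^sub>F r in nhds rk. F r = p (- rk * m k + m k * r)"
    proof eventually_elim
      fix r assume "\<bar>r - rk\<bar> < rk / 8"
      then have "c r = (y k - x) + (r - rk) *\<^sub>R (m k *\<^sub>R w)"
        using c(2)[of r k] by (simp add: rk_def)
      then have "x + c r = y k + (- rk * m k + m k * r) *\<^sub>R w"
        by (simp add: algebra_simps)
      then show "F r = p (- rk * m k + m k * r)"
        by (simp only: F_def p_def)
    qed
    have "(deriv ^^ n) F rk = m k ^ n * (deriv ^^ n) p (- rk * m k + m k * rk)"
      using higher_deriv_cong_eventually[OF ev, of n] unfolding higher_deriv_affine[OF p] .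
    also have "(deriv ^^ n) p (- rk * m k + m k * rk) = D (y k)"
      by (simp add: D_def p_def[abs_def])
    finally have "(deriv ^^ n) F rk = m k ^ n * D (y k)" .
    then have "\<bar>(deriv ^^ n) F rk\<bar> = m k ^ n * \<bar>D (y k)\<bar>"
      by (simp add: abs_mult m_def)
    also have "\<dots> > m k ^ n * (real k * (2 ^ (k * k)) ^ n)"
      using y(2)[of k] by (intro mult_strict_left_mono) (auto simp: m_def)
    also have "m k ^ n * (real k * (2 ^ (k * k)) ^ n) = real k"
      by (simp add: m_def power_one_over)
    finally show ?thesis using B[of rk] rk by auto
  qed
  then show False using reals_Archimedean2[of B] less_asym by blast
qed

lemma compact_locally_bounded_imp_bounded:
  fixes g :: "'a::metric_space \<Rightarrow> real"
  assumes "compact K" and loc: "\<And>x. \<exists>\<delta>>0. \<exists>C. \<forall>y. dist y x < \<delta> \<longrightarrow> g y \<le> C"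
  shows "\<exists>C\<ge>0. \<forall>y\<in>K. g y \<le> C"
proof -
  obtain d C where dC: "\<And>x. d x > 0" "\<And>x y. dist y x < d x \<Longrightarrow> g y \<le> C x"
    using loc by metis
  have "K \<subseteq> (\<Union>x\<in>K. ball x (d x))" using dC(1) by force
  then obtain T where T: "finite T" "K \<subseteq> (\<Union>x\<in>T. ball x (d x))"
    using compactE_image[OF assms(1), of K "\<lambda>x. ball x (d x)"] by (metis open_ball)
  have "g y \<le> (\<Sum>x\<in>T. \<bar>C x\<bar>)" if y: "y \<in> K" for y
  proof -
    obtain x where x: "x \<in> T" "dist x y < d x" using T y by auto
    then have "g y \<le> \<bar>C x\<bar>" using dC(2)[of y x] by (simp add: dist_commute)
    also have "\<dots> \<le> (\<Sum>x\<in>T. \<bar>C x\<bar>)" using x(1) T(1) by (intro member_le_sum) auto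
    finally show ?thesis .
  qed
  then show ?thesis by (intro exI[of _ "\<Sum>x\<in>T. \<bar>C x\<bar>"]) (auto simp: sum_nonneg)
qed

text \<open>Weights and nodes of a finite-difference formula for the first derivative that is exact on
  polynomials of degree \<open>N\<close>, obtained by Richardson extrapolation.\<close>

lemma difference_formula:
  "\<exists>L :: (real \<times> real) list. (\<forall>(c, l) \<in> set L. 0 < l \<and> l \<le> 1) \<and>
     (\<forall>j. 1 \<le> j \<and> j \<le> Suc N \<longrightarrow> (\<Sum>(c, l)\<leftarrow>L. c * l ^ j) = (if j = 1 then 1 else 0))"
proof (induction N)
  case 0
  show ?case by (rule exI[of _ "[(1, 1)]"]) auto
next
  case (Suc N)
  then obtain L :: "(real \<times> real) list" where L: "\<And>c l. (c, l) \<in> set L \<Longrightarrow> 0 < l \<and> l \<le> 1"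
    "\<And>j. 1 \<le> j \<Longrightarrow> j \<le> Suc N \<Longrightarrow> (\<Sum>(c, l)\<leftarrow>L. c * l ^ j) = (if j = 1 then 1 else 0)"
    by auto
  \<comment> \<open>The two rescaled copies multiply the j-th moment by (2^(N + 2 - j) - 1) / Q.
    This is 1 for j = 1 and 0 for j = N + 2, so the old conditions persist and one more
    holds.\<close>
  define Q where "Q = (2 :: real) ^ Suc N - 1"
  have "(2 :: real) ^ Suc N > 1" by (rule one_less_power) auto
  then have Q: "Q > 0" by (simp add: Q_def)
  define L' where "L' = map (\<lambda>(c, l). (2 ^ (N + 2) / Q * c, 1/2 * l)) L @ map (\<lambda>(c, l). (- 1 / Q * c, 1 * l)) L"
  have sum: "(\<Sum>(c, l)\<leftarrow>L'. c * l ^ j) = (2 ^ (N + 2) / 2 ^ j - 1) / Q * (\<Sum>(c, l)\<leftarrow>L. c * l ^ j)" for j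
  proof -
    have 1: "(\<Sum>(c, l)\<leftarrow>map (\<lambda>(c, l). (a * c, b * l)) M. c * l ^ j) = a * b ^ j * (\<Sum>(c, l)\<leftarrow>M. c * l ^ j)"
      for a b :: real and M
      by (induction M) (auto simp: algebra_simps)
    show ?thesis
      unfolding L'_def map_append sum_list_append 1 by (simp add: power_one_over add_divide_distrib diff_divide_distrib algebra_simps)
  qed
  have "(\<Sum>(c, l)\<leftarrow>L'. c * l ^ j) = (if j = 1 then 1 else 0)" if "1 \<le> j" "j \<le> Suc (Suc N)" for j
  proof (cases "j = Suc (Suc N)")
    case True show ?thesis unfolding sum True by simp
  next
    case False
    then have "(\<Sum>(c, l)\<leftarrow>L. c * l ^ j) = (if j = 1 then 1 else 0)" using L(2) that by simp
    then show ?thesis unfolding sum using Q by (auto simp: Q_def)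
  qed
  moreover have "\<forall>(c, l) \<in> set L'. 0 < l \<and> l \<le> 1" using L(1) by (fastforce simp: L'_def)
  ultimately show ?case by blast
qed

text \<open>An inequality of Landau-Kolmogorov type with a free scale \<open>\<epsilon>\<close>: the
  difference formula at the nodes s + l \<epsilon> cancels the Taylor terms of degrees 2 to N + 1,
  and the remainder is of order N + 2. The constant depends on N alone.\<close>

lemma derivative_interpolation:
  "\<exists>K\<ge>0. \<forall>u s \<epsilon> A B. smooth (u :: real \<Rightarrow> real) \<longrightarrow> 0 < \<epsilon> \<longrightarrow> \<epsilon> \<le> 1 \<longrightarrow>
     (\<forall>x\<in>{s..s+1}. \<bar>u x\<bar> \<le> A) \<longrightarrow> (\<forall>x\<in>{s..s+1}. \<bar>(deriv ^^ Suc (Suc N)) u x\<bar> \<le> B) \<longrightarrow>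
     \<bar>deriv u s\<bar> \<le> K * (A / \<epsilon> + B * \<epsilon> ^ Suc N)"
proof -
  obtain L :: "(real \<times> real) list" where L: "\<And>c l. (c, l) \<in> set L \<Longrightarrow> 0 < l \<and> l \<le> 1"
    "\<And>j. 1 \<le> j \<Longrightarrow> j \<le> Suc N \<Longrightarrow> (\<Sum>(c, l)\<leftarrow>L. c * l ^ j) = (if j = 1 then 1 else 0)"
    using difference_formula[of N] by auto
  \<comment> \<open>The factor 2 comes from estimating each difference of two values of u by 2
    A.\<close>
  define K where "K = 2 * (\<Sum>(c, l)\<leftarrow>L. \<bar>c\<bar>)"
  have K0: "K \<ge> 0" unfolding K_def by (auto intro!: sum_list_nonneg)
  moreover have "\<bar>deriv u s\<bar> \<le> K * (A / \<epsilon> + B * \<epsilon> ^ Suc N)"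
    if u: "smooth u" and \<epsilon>: "0 < \<epsilon>" "\<epsilon> \<le> 1" and A: "\<And>x. x \<in> {s..s+1} \<Longrightarrow> \<bar>u x\<bar> \<le> A"
      and B: "\<And>x. x \<in> {s..s+1} \<Longrightarrow> \<bar>(deriv ^^ Suc (Suc N)) u x\<bar> \<le> B" for u s \<epsilon> A B
  proof -
    define a where "a j = (deriv ^^ j) u s / fact j * \<epsilon> ^ j" for j
    have AB0: "A \<ge> 0" "B \<ge> 0"
      using A[of s] B[of s] abs_ge_zero[of "u s"] abs_ge_zero[of "(deriv ^^ Suc (Suc N)) u s"] by auto
    define R where "R l = u (s + l * \<epsilon>) - u s - (\<Sum>j=1..Suc N. a j * l ^ j)" for l
    have R: "\<bar>R l\<bar> \<le> B * \<epsilon> ^ Suc (Suc N)" if l: "0 < l" "l \<le> 1" for l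
    proof -
      have le: "0 < l * \<epsilon>" "l * \<epsilon> \<le> \<epsilon>" "l * \<epsilon> \<le> 1" using l \<epsilon> by (auto simp: mult_le_one)
      obtain t where t: "s < t" "t < s + l * \<epsilon>" and eq:
        "u (s + l * \<epsilon>) = (\<Sum>m<Suc (Suc N). (deriv ^^ m) u s / fact m * (s + l * \<epsilon> - s) ^ m)
          + (deriv ^^ Suc (Suc N)) u t / fact (Suc (Suc N)) * (s + l * \<epsilon> - s) ^ Suc (Suc N)"
        using Taylor_up[of "Suc (Suc N)" "\<lambda>m. (deriv ^^ m) u" u s "s + l * \<epsilon>" s]
          higher_deriv_has_deriv[OF u] le by auto
      have "(\<Sum>m<Suc (Suc N). (deriv ^^ m) u s / fact m * (s + l * \<epsilon> - s) ^ m)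
          = u s + (\<Sum>j=1..Suc N. a j * l ^ j)"
        unfolding lessThan_Suc_atMost atMost_atLeast0
        by (subst sum.atLeast_Suc_atMost) (auto simp: a_def power_mult_distrib mult_ac simp del: funpow.simps intro!: sum.cong)
      with eq have "R l = (deriv ^^ Suc (Suc N)) u t / fact (Suc (Suc N)) * (l * \<epsilon>) ^ Suc (Suc N)"
        unfolding R_def by simp
      then have "\<bar>R l\<bar> = \<bar>(deriv ^^ Suc (Suc N)) u t\<bar> * (l * \<epsilon>) ^ Suc (Suc N) / fact (Suc (Suc N))"
        using le by (simp add: abs_mult abs_div power_abs[symmetric] del: funpow.simps fact_Suc power_Suc)
      also have "\<dots> \<le> \<bar>(deriv ^^ Suc (Suc N)) u t\<bar> * (l * \<epsilon>) ^ Suc (Suc N) / 1"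
        using le by (intro divide_left_mono) (auto simp: fact_ge_1 simp del: funpow.simps fact_Suc)
      also have "\<dots> \<le> B * \<epsilon> ^ Suc (Suc N)"
        unfolding div_by_1 using t le \<epsilon> AB0 by (intro mult_mono power_mono B) auto
      finally show ?thesis .
    qed
    have eq: "(\<Sum>(c, l)\<leftarrow>L. c * (u (s + l * \<epsilon>) - u s)) = \<epsilon> * deriv u s + (\<Sum>(c, l)\<leftarrow>L. c * R l)"
    proof -
      have "(\<Sum>(c, l)\<leftarrow>M. c * (u (s + l * \<epsilon>) - u s))
          = (\<Sum>j=1..Suc N. a j * (\<Sum>(c, l)\<leftarrow>M. c * l ^ j)) + (\<Sum>(c, l)\<leftarrow>M. c * R l)" for M
      proof (induction M)
        case (Cons cl M)
        obtain c l where cl: "cl = (c, l)" by force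
        have "c * (u (s + l * \<epsilon>) - u s) = (\<Sum>j=1..Suc N. a j * (c * l ^ j)) + c * R l"
          unfolding R_def by (simp add: sum_distrib_left algebra_simps del: sum.cl_ivl_Suc)
        with Cons show ?case
          by (simp add: cl distrib_left sum.distrib del: sum.cl_ivl_Suc)
      qed simp
      moreover have "(\<Sum>j=1..Suc N. a j * (\<Sum>(c, l)\<leftarrow>L. c * l ^ j)) = (\<Sum>j=1..Suc N. if j = 1 then a 1 else 0)"
        by (intro sum.cong) (auto simp: L(2))
      moreover have "(\<Sum>j=1..Suc N. if j = 1 then a 1 else 0) = a 1"
        by (subst sum.delta) auto
      ultimately show ?thesis by (simp add: a_def)
    qed
    have bd: "\<bar>\<Sum>(c, l)\<leftarrow>M. c * f l\<bar> \<le> (\<Sum>(c, l)\<leftarrow>M. \<bar>c\<bar>) * C"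
      if "\<And>c l. (c, l) \<in> set M \<Longrightarrow> \<bar>f l\<bar> \<le> C" for f :: "real \<Rightarrow> real" and C and M :: "(real \<times> real) list"
      using that
    proof (induction M)
      case (Cons cl M)
      obtain c l where cl: "cl = (c, l)" by force
      have "\<bar>\<Sum>(c, l)\<leftarrow>M. c * f l\<bar> \<le> (\<Sum>(c, l)\<leftarrow>M. \<bar>c\<bar>) * C" using Cons by auto
      moreover have "\<bar>c * f l\<bar> \<le> \<bar>c\<bar> * C"
        unfolding abs_mult using Cons.prems[of c l] cl by (intro mult_left_mono) auto
      ultimately show ?case by (simp add: cl distrib_right)
    qed simp
    have "\<bar>\<Sum>(c, l)\<leftarrow>L. c * (u (s + l * \<epsilon>) - u s)\<bar> \<le> (\<Sum>(c, l)\<leftarrow>L. \<bar>c\<bar>) * (2 * A)"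
    proof (rule bd)
      fix c l assume "(c, l) \<in> set L"
      then have "0 \<le> l * \<epsilon>" "l * \<epsilon> \<le> 1" using L(1)[of c l] \<epsilon> by (auto simp: mult_le_one)
      then show "\<bar>u (s + l * \<epsilon>) - u s\<bar> \<le> 2 * A"
        using A[of s] A[of "s + l * \<epsilon>"] by auto
    qed
    moreover have "\<bar>\<Sum>(c, l)\<leftarrow>L. c * R l\<bar> \<le> (\<Sum>(c, l)\<leftarrow>L. \<bar>c\<bar>) * (B * \<epsilon> ^ Suc (Suc N))"
      by (rule bd) (use R L(1) in blast)
    moreover have "K * A = (\<Sum>(c, l)\<leftarrow>L. \<bar>c\<bar>) * (2 * A)" by (simp add: K_def)
    moreover have "(\<Sum>(c, l)\<leftarrow>L. \<bar>c\<bar>) * (B * \<epsilon> ^ Suc (Suc N)) \<le> K * (B * \<epsilon> ^ Suc (Suc N))"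
      using K0 AB0 \<epsilon> by (intro mult_right_mono) (auto simp: K_def)
    ultimately have "\<bar>\<epsilon> * deriv u s\<bar> \<le> K * A + K * (B * \<epsilon> ^ Suc (Suc N))"
      using eq by linarith
    also have "\<dots> = \<epsilon> * (K * (A / \<epsilon> + B * \<epsilon> ^ Suc N))"
      using \<epsilon> by (simp add: field_simps)
    finally show ?thesis using \<epsilon> by (simp add: abs_mult)
  qed
  ultimately show ?thesis by blast
qed


text \<open>The difference quotients of \<open>G\<close> in the second variable converge geometrically, while their
  derivatives in the first variable grow at most geometrically. Interpolation therefore makes all
  these derivatives converge geometrically, so the limit is smooth.\<close>

lemma geometric_decay_deriv:
  fixes u :: "nat \<Rightarrow> real \<Rightarrow> real"
  assumes u: "\<And>k. smooth (u k)" and \<rho>: "0 < \<rho>" "\<rho> < 1"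
    and decay: "\<And>R. \<exists>C. \<forall>k s. \<bar>s\<bar> \<le> R \<longrightarrow> \<bar>u k s\<bar> \<le> C * \<rho> ^ k"
    and growth: "\<And>j R. \<exists>C. \<forall>k s. \<bar>s\<bar> \<le> R \<longrightarrow> \<bar>(deriv ^^ j) (u k) s\<bar> \<le> C * 2 ^ k"
  shows "\<exists>C. \<forall>k s. \<bar>s\<bar> \<le> R \<longrightarrow> \<bar>deriv (u k) s\<bar> \<le> C * sqrt \<rho> ^ k"
proof -
  define \<sigma> where "\<sigma> = sqrt \<rho>"
  have \<sigma>: "0 < \<sigma>" "\<sigma> < 1" "\<sigma> * \<sigma> = \<rho>" using \<rho> by (auto simp: \<sigma>_def)
  \<comment> \<open>At the scale \<open>\<sigma> ^ k\<close> the first term of the interpolation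
    bound becomes C \<open>\<sigma> ^ k\<close>. The second becomes C' (2
    \<open>\<sigma> ^ N\<close>)^k \<open>\<sigma> ^ k\<close>, and this N makes the growth factor
    2^k harmless.\<close>
  obtain N where N: "\<sigma> ^ N < 1 / 2" using real_arch_pow_inv[of "1/2" \<sigma>] \<sigma> by auto
  obtain K where K: "K \<ge> 0" "\<And>u s \<epsilon> A B. smooth (u :: real \<Rightarrow> real) \<Longrightarrow> 0 < \<epsilon> \<Longrightarrow> \<epsilon> \<le> 1 \<Longrightarrow>
     (\<And>x. x\<in>{s..s+1} \<Longrightarrow> \<bar>u x\<bar> \<le> A) \<Longrightarrow> (\<And>x. x\<in>{s..s+1} \<Longrightarrow> \<bar>(deriv ^^ Suc (Suc N)) u x\<bar> \<le> B) \<Longrightarrow>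
     \<bar>deriv u s\<bar> \<le> K * (A / \<epsilon> + B * \<epsilon> ^ Suc N)"
    using derivative_interpolation[of N] by meson
  obtain C where C: "\<And>k s. \<bar>s\<bar> \<le> R + 1 \<Longrightarrow> \<bar>u k s\<bar> \<le> C * \<rho> ^ k"
    using decay[of "R + 1"] by blast
  obtain C' where C': "\<And>k s. \<bar>s\<bar> \<le> R + 1 \<Longrightarrow> \<bar>(deriv ^^ Suc (Suc N)) (u k) s\<bar> \<le> C' * 2 ^ k"
    using growth[of "R + 1" "Suc (Suc N)"] by blast
  have "\<bar>deriv (u k) s\<bar> \<le> K * (C + \<bar>C'\<bar>) * \<sigma> ^ k" if s: "\<bar>s\<bar> \<le> R" for k s
  proof -
    have "\<bar>deriv (u k) s\<bar> \<le> K * (C * \<rho> ^ k / \<sigma> ^ k + C' * 2 ^ k * (\<sigma> ^ k) ^ Suc N)"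
      by (rule K(2)) (use u \<sigma> s C C' in \<open>auto simp: power_le_one simp del: funpow.simps\<close>)
    also have "\<dots> \<le> K * ((C + \<bar>C'\<bar>) * \<sigma> ^ k)"
    proof (intro mult_left_mono K(1))
      have 1: "C * \<rho> ^ k / \<sigma> ^ k = C * \<sigma> ^ k"
        using \<sigma> by (simp add: \<sigma>(3)[symmetric] power_mult_distrib)
      have "C' * 2 ^ k * (\<sigma> ^ k) ^ Suc N = C' * ((2 * \<sigma> ^ N) ^ k * \<sigma> ^ k)"
        by (simp add: power_mult_distrib power_mult[symmetric] mult.commute)
      also have "\<dots> \<le> \<bar>C'\<bar> * (1 * \<sigma> ^ k)"
        using N \<sigma> by (intro mult_mono power_le_one) auto
      finally show "C * \<rho> ^ k / \<sigma> ^ k + C' * 2 ^ k * (\<sigma> ^ k) ^ Suc N \<le> (C + \<bar>C'\<bar>) * \<sigma> ^ k"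
        using 1 by (simp add: distrib_right)
    qed
    finally show ?thesis by (simp add: mult.assoc)
  qed
  then show ?thesis unfolding \<sigma>_def by blast
qed

text \<open>Each differentiation replaces the rate by its square root, still below 1. The growth
  hypothesis covers all orders, so it passes to the derivatives and the previous lemma can be
  iterated.\<close>

lemma geometric_decay_higher_deriv:
  fixes u :: "nat \<Rightarrow> real \<Rightarrow> real"
  assumes u: "\<And>k. smooth (u k)" and \<rho>: "0 < \<rho>" "\<rho> < 1"
    and decay: "\<And>R. \<exists>C. \<forall>k s. \<bar>s\<bar> \<le> R \<longrightarrow> \<bar>u k s\<bar> \<le> C * \<rho> ^ k"
    and growth: "\<And>j R. \<exists>C. \<forall>k s. \<bar>s\<bar> \<le> R \<longrightarrow> \<bar>(deriv ^^ j) (u k) s\<bar> \<le> C * 2 ^ k"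
  shows "\<exists>\<rho>. 0 < \<rho> \<and> \<rho> < 1 \<and>
    (\<forall>R. \<exists>C. \<forall>k s. \<bar>s\<bar> \<le> R \<longrightarrow> \<bar>(deriv ^^ m) (u k) s\<bar> \<le> C * \<rho> ^ k)"
proof (induction m)
  case 0
  show ?case using \<rho> decay by (intro exI[of _ \<rho>]) auto
next
  case (Suc m)
  then obtain \<rho>' where \<rho>': "0 < \<rho>'" "\<rho>' < 1"
    "\<And>R. \<exists>C. \<forall>k s. \<bar>s\<bar> \<le> R \<longrightarrow> \<bar>(deriv ^^ m) (u k) s\<bar> \<le> C * \<rho>' ^ k"
    by blast
  have "\<exists>C. \<forall>k s. \<bar>s\<bar> \<le> R \<longrightarrow> \<bar>deriv ((deriv ^^ m) (u k)) s\<bar> \<le> C * sqrt \<rho>' ^ k" for R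
  proof (rule geometric_decay_deriv[OF smooth_higher_deriv[OF u] \<rho>'])
    fix j R
    show "\<exists>C. \<forall>k s. \<bar>s\<bar> \<le> R \<longrightarrow> \<bar>(deriv ^^ j) ((deriv ^^ m) (u k)) s\<bar> \<le> C * 2 ^ k"
      using growth[of R "j + m"] by (simp add: funpow_add)
  qed
  then show ?case using \<rho>' by (intro exI[of _ "sqrt \<rho>'"]) auto
qed

lemma curve_smooth_partial_deriv:
  fixes G :: "real \<times> real \<Rightarrow> real"
  assumes G: "curve_smooth G"
  shows "smooth (\<lambda>s. deriv (\<lambda>t. G (s, t)) 0)"
proof -
  have sm1: "smooth (\<lambda>r. G (r, t))" and sm2: "smooth (\<lambda>r. G (s, r))" for s t
    by (rule curve_smoothD[OF G]; intro smooth_Pair smooth_const smooth_ident)+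
  have bound: "\<exists>C\<ge>0. \<forall>y\<in>cbox (-R, -1) (R, 1). \<bar>(deriv ^^ n) (\<lambda>t. G (y + t *\<^sub>R w)) 0\<bar> \<le> C"
    if "norm w \<le> 1" for R n w
    using compact_locally_bounded_imp_bounded[OF compact_cbox
        curve_smooth_dir_locally_bounded[OF G that]] .
  have b1: "\<exists>C\<ge>0. \<forall>s t. \<bar>s\<bar> \<le> R \<longrightarrow> \<bar>t\<bar> \<le> 1 \<longrightarrow> \<bar>(deriv ^^ n) (\<lambda>r. G (r, t)) s\<bar> \<le> C" for R n
  proof -
    have "(deriv ^^ n) (\<lambda>r. G ((s, t) + r *\<^sub>R (1, 0))) 0 = (deriv ^^ n) (\<lambda>r. G (r, t)) s" for s t
      using higher_deriv_affine[OF sm1[of t], of n s 1] by (simp add: fun_eq_iff)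
    with bound[of "(1, 0)" R n] show ?thesis by (force simp: cbox_Pair_eq)
  qed
  have b2: "\<exists>C\<ge>0. \<forall>s t. \<bar>s\<bar> \<le> R \<longrightarrow> \<bar>t\<bar> \<le> 1 \<longrightarrow> \<bar>(deriv ^^ n) (\<lambda>r. G (s, r)) t\<bar> \<le> C" for R n
  proof -
    have "(deriv ^^ n) (\<lambda>r. G ((s, t) + r *\<^sub>R (0, 1))) 0 = (deriv ^^ n) (\<lambda>r. G (s, r)) t" for s t
      using higher_deriv_affine[OF sm2[of s], of n t 1] by (simp add: fun_eq_iff)
    with bound[of "(0, 1)" R n] show ?thesis by (force simp: cbox_Pair_eq)
  qed
  define h where "h s = deriv (\<lambda>t. G (s, t)) 0" for s
  \<comment> \<open>With steps 2^-k the error of \<open>q k\<close> is of order 2^-k, while division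
    by the step inflates derivatives in s by at most a factor of order 2^k: the two rates that the
    interpolation balances.\<close>
  define q where "q k s = 2 ^ k * (G (s, (1/2) ^ k) - G (s, 0))" for k s
  define u where "u k s = q (Suc k) s - q k s" for k s
  have smq: "smooth (q k)" for k
    unfolding q_def by (intro smooth_mult smooth_diff smooth_const sm1)
  then have smu: "smooth (u k)" for k unfolding u_def by (intro smooth_diff)
  have q_h: "\<exists>C. \<forall>k s. \<bar>s\<bar> \<le> R \<longrightarrow> \<bar>q k s - h s\<bar> \<le> C * (1/2) ^ k" for R
  proof -
    obtain C where C: "C \<ge> 0" "\<And>s t. \<bar>s\<bar> \<le> R \<Longrightarrow> \<bar>t\<bar> \<le> 1 \<Longrightarrow> \<bar>(deriv ^^ 2) (\<lambda>r. G (s, r)) t\<bar> \<le> C"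
      using b2[of R 2] by blast
    have "\<bar>q k s - h s\<bar> \<le> C * (1/2) ^ k" if s: "\<bar>s\<bar> \<le> R" for k s
    proof -
      define \<tau> where "\<tau> = (1/2 :: real) ^ k"
      have \<tau>: "0 < \<tau>" "\<tau> \<le> 1" "2 ^ k * \<tau> = 1" by (auto simp: \<tau>_def power_le_one power_one_over)
      obtain t where t: "0 < t" "t < \<tau>" and "G (s, \<tau>) = (\<Sum>m<2. (deriv ^^ m) (\<lambda>r. G (s, r)) 0 / fact m * (\<tau> - 0) ^ m)
          + (deriv ^^ 2) (\<lambda>r. G (s, r)) t / fact 2 * (\<tau> - 0) ^ 2"
        using Taylor_up[of 2 "\<lambda>m. (deriv ^^ m) (\<lambda>r. G (s, r))" "\<lambda>r. G (s, r)" 0 \<tau> 0]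
          higher_deriv_has_deriv[OF sm2] \<tau> by auto
      then have "G (s, \<tau>) - G (s, 0) = h s * \<tau> + (deriv ^^ 2) (\<lambda>r. G (s, r)) t / 2 * (\<tau> * \<tau>)"
        by (simp add: h_def numeral_2_eq_2 lessThan_Suc)
      then have "q k s = 2 ^ k * (h s * \<tau> + (deriv ^^ 2) (\<lambda>r. G (s, r)) t / 2 * (\<tau> * \<tau>))"
        by (simp add: q_def \<tau>_def)
      also have "\<dots> = h s * (2 ^ k * \<tau>) + (deriv ^^ 2) (\<lambda>r. G (s, r)) t / 2 * (\<tau> * (2 ^ k * \<tau>))"
        by (simp add: algebra_simps)
      finally have "q k s - h s = (deriv ^^ 2) (\<lambda>r. G (s, r)) t / 2 * \<tau>" using \<tau>(3) by simp
      then have "\<bar>q k s - h s\<bar> = \<bar>(deriv ^^ 2) (\<lambda>r. G (s, r)) t\<bar> / 2 * \<tau>"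
        by (simp only: abs_mult abs_div abs_numeral abs_of_pos[OF \<tau>(1)])
      also have "\<dots> \<le> C * \<tau>"
        using C(2)[OF s, of t] t \<tau> C(1) by (intro mult_right_mono) auto
      finally show ?thesis by (simp add: \<tau>_def)
    qed
    then show ?thesis by blast
  qed
  have decay: "\<exists>C. \<forall>k s. \<bar>s\<bar> \<le> R \<longrightarrow> \<bar>u k s\<bar> \<le> C * (1/2) ^ k" for R
  proof -
    obtain C where C: "\<And>k s. \<bar>s\<bar> \<le> R \<Longrightarrow> \<bar>q k s - h s\<bar> \<le> C * (1/2) ^ k" using q_h by blast
    have "\<bar>u k s\<bar> \<le> (2 * C) * (1/2) ^ k" if s: "\<bar>s\<bar> \<le> R" for k s
    proof -
      have "C * (1/2) ^ Suc k = C * (1/2) ^ k / 2" by simp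
      then show ?thesis
        using C[OF s, of k] C[OF s, of "Suc k"] unfolding u_def mult.assoc by linarith
    qed
    then show ?thesis by blast
  qed
  have growth: "\<exists>C. \<forall>k s. \<bar>s\<bar> \<le> R \<longrightarrow> \<bar>(deriv ^^ j) (u k) s\<bar> \<le> C * 2 ^ k" for j R
  proof -
    obtain C where C: "C \<ge> 0" "\<And>s t. \<bar>s\<bar> \<le> R \<Longrightarrow> \<bar>t\<bar> \<le> 1 \<Longrightarrow> \<bar>(deriv ^^ j) (\<lambda>r. G (r, t)) s\<bar> \<le> C"
      using b1[of R j] by blast
    have Q: "\<bar>(deriv ^^ j) (q k) s\<bar> \<le> 2 ^ k * (2 * C)" if s: "\<bar>s\<bar> \<le> R" for k s
    proof -
      have "(deriv ^^ j) (q k) s = 2 ^ k * ((deriv ^^ j) (\<lambda>r. G (r, (1/2) ^ k)) s - (deriv ^^ j) (\<lambda>r. G (r, 0)) s)"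
        unfolding q_def higher_deriv_cmult[OF smooth_diff[OF sm1 sm1]] higher_deriv_diff[OF sm1 sm1] ..
      moreover have "\<bar>(deriv ^^ j) (\<lambda>r. G (r, (1/2) ^ k)) s - (deriv ^^ j) (\<lambda>r. G (r, 0)) s\<bar> \<le> 2 * C"
        using C(2)[OF s, of "(1/2)^k"] C(2)[OF s, of 0] by (auto simp: power_le_one)
      ultimately show ?thesis by (simp add: abs_mult mult_left_mono)
    qed
    have "\<bar>(deriv ^^ j) (u k) s\<bar> \<le> (6 * C) * 2 ^ k" if s: "\<bar>s\<bar> \<le> R" for k s
    proof -
      have "2 ^ Suc k * (2 * C) = 4 * (C * 2 ^ k)" "2 ^ k * (2 * C) = 2 * (C * 2 ^ k)" by simp_all
      then show ?thesis
        using Q[OF s, of k] Q[OF s, of "Suc k"]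
        unfolding u_def higher_deriv_diff[OF smq smq] mult.assoc by linarith
    qed
    then show ?thesis by blast
  qed
  have "smooth (\<lambda>s. \<Sum>k. u k s)"
  proof (rule smooth_series[OF smu])
    fix j R
    obtain \<rho> where \<rho>: "0 < \<rho>" "\<rho> < 1"
      "\<And>R. \<exists>C. \<forall>k s. \<bar>s\<bar> \<le> R \<longrightarrow> \<bar>(deriv ^^ j) (u k) s\<bar> \<le> C * \<rho> ^ k"
      using geometric_decay_higher_deriv[of u "1/2" j, OF smu _ _ decay growth] by auto
    moreover obtain C where "\<forall>k s. \<bar>s\<bar> \<le> R \<longrightarrow> \<bar>(deriv ^^ j) (u k) s\<bar> \<le> C * \<rho> ^ k"
      using \<rho>(3)[of R] by (elim exE)
    ultimately show "\<exists>M. summable M \<and> (\<forall>k x. \<bar>x\<bar> \<le> R \<longrightarrow> \<bar>(deriv ^^ j) (u k) x\<bar> \<le> M k)"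
      by (intro exI[of _ "\<lambda>k. C * \<rho> ^ k"]) (auto intro!: summable_mult summable_geometric)
  qed
  moreover have "(\<Sum>k. u k s) = h s - q 0 s" for s
  proof -
    obtain C where C: "\<And>k. \<bar>q k s - h s\<bar> \<le> C * (1/2) ^ k" using q_h[of "\<bar>s\<bar>"] by auto
    have "(\<lambda>k. C * (1/2) ^ k) \<longlonglongrightarrow> C * 0"
      by (intro tendsto_mult_left LIMSEQ_power_zero) simp
    then have lim0: "(\<lambda>k. C * (1/2) ^ k) \<longlonglongrightarrow> 0" by simp
    have "(\<lambda>k. q k s - h s) \<longlonglongrightarrow> 0"
      by (rule Lim_null_comparison[OF _ lim0]) (simp add: C)
    then have "(\<lambda>k. q k s) \<longlonglongrightarrow> h s" by (simp add: LIM_zero_iff)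
    from telescope_sums[OF this] show ?thesis unfolding u_def by (simp add: sums_iff)
  qed
  ultimately have "smooth (\<lambda>s. (h s - q 0 s) + q 0 s)"
    by (intro smooth_add smq) simp
  then show ?thesis by (simp add: h_def)
qed

text \<open>A curve c turns the question into one about the plane function (s, t) |-> f (c s + t w),
  which is smooth along plane curves because f is smooth along their images.\<close>

lemma curve_smooth_dir_deriv:
  assumes f: "curve_smooth f"
  shows "curve_smooth (\<lambda>x. deriv (\<lambda>t. f (x + t *\<^sub>R w)) 0)"
  unfolding curve_smooth_def
proof (intro allI impI)
  fix c :: "real \<Rightarrow> 'a" assume c: "smooth c"
  have "curve_smooth (\<lambda>(s, t). f (c s + t *\<^sub>R w))"
    unfolding curve_smooth_def
  proof (intro allI impI)
    fix d :: "real \<Rightarrow> real \<times> real" assume d: "smooth d"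
    have "smooth (\<lambda>r. f (c (fst (d r)) + snd (d r) *\<^sub>R w))"
      by (rule curve_smoothD[OF f])
        (intro smooth_add smooth_scaleR smooth_compose[OF c] smooth_fst smooth_snd d smooth_const)
    then show "smooth (\<lambda>r. case d r of (s, t) \<Rightarrow> f (c s + t *\<^sub>R w))" by (simp add: case_prod_beta)
  qed
  from curve_smooth_partial_deriv[OF this]
  show "smooth (\<lambda>r. deriv (\<lambda>t. f (c r + t *\<^sub>R w)) 0)" by simp
qed

text \<open>All partial derivatives exist and, being smooth along curves themselves, are continuous.
  The linear approximation is then built up one basis direction at a time by the mean value
  inequality.\<close>

lemma curve_smooth_has_derivative:
  fixes f :: "'a::euclidean_space \<Rightarrow> real"
  assumes f: "curve_smooth f"
  shows "(f has_derivative (\<lambda>v. \<Sum>b\<in>Basis. (v \<bullet> b) *\<^sub>R deriv (\<lambda>t. f (x + t *\<^sub>R b)) 0)) (at x)"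
proof -
  define D where "D b y = deriv (\<lambda>t. f (y + t *\<^sub>R b)) 0" for b y
  define pr where "pr S h = (\<Sum>b\<in>S. (h \<bullet> b) *\<^sub>R b)" for S and h :: 'a
  have main: "\<exists>d>0. \<forall>h. norm h < d \<longrightarrow> \<bar>f (x + pr S h) - f x - (\<Sum>b\<in>S. (h \<bullet> b) * D b x)\<bar> \<le> e * norm h"
    if "finite S" "S \<subseteq> Basis" "e > 0" for S e
    using that
  proof (induction S arbitrary: e rule: finite_induct)
    case empty
    show ?case using empty by (intro exI[of _ 1]) (auto simp: pr_def)
  next
    case (insert b S)
    have b: "b \<in> Basis" using insert.prems by auto
    have norm_pr: "norm (pr S h) \<le> real (card S) * norm h" for h
    proof -
      have "norm (pr S h) \<le> (\<Sum>b\<in>S. norm ((h \<bullet> b) *\<^sub>R b))" unfolding pr_def by (rule norm_sum)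
      also have "\<dots> \<le> (\<Sum>b\<in>S. norm h)"
        using insert.prems by (intro sum_mono) (auto simp: Basis_le_norm)
      finally show ?thesis by simp
    qed
    obtain d1 where d1: "d1 > 0" "\<And>h. norm h < d1 \<Longrightarrow>
        \<bar>f (x + pr S h) - f x - (\<Sum>b\<in>S. (h \<bullet> b) * D b x)\<bar> \<le> e / 2 * norm h"
      using insert.IH[of "e / 2"] insert.prems by auto
    have "isCont (D b) x"
      unfolding D_def by (intro curve_smooth_isCont curve_smooth_dir_deriv f)
    then obtain d2 where d2: "d2 > 0" "\<And>y. norm (y - x) < d2 \<Longrightarrow> \<bar>D b y - D b x\<bar> < e / 2"
      unfolding continuous_at_eps_delta dist_norm real_norm_def
      using insert.prems by (metis half_gt_zero)
    \<comment> \<open>The intermediate points reached from x by \<open>pr S h\<close> and a further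
      t b with |t| \<le> |h| are within (card S + 1) |h| of x.\<close>
    define d where "d = min d1 (d2 / (real (card S) + 1))"
    have "d > 0" using d1 d2 by (simp add: d_def)
    moreover have "\<bar>f (x + pr (insert b S) h) - f x - (\<Sum>b\<in>insert b S. (h \<bullet> b) * D b x)\<bar> \<le> e * norm h"
      if h: "norm h < d" for h
    proof -
      define z where "z = x + pr S h"
      define p where "p t = f (z + t *\<^sub>R b) - t * D b x" for t
      have dp: "(p has_real_derivative D b (z + t *\<^sub>R b) - D b x) (at t)" for t
      proof -
        have sm: "smooth (\<lambda>r. f (z + r *\<^sub>R b))" by (rule curve_smooth_line[OF f])
        have "deriv (\<lambda>r. f (z + r *\<^sub>R b)) t = D b (z + t *\<^sub>R b)"
          using deriv_affine[OF sm, of t 1] by (simp add: D_def fun_eq_iff algebra_simps)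
        then show ?thesis using smooth_has_deriv[OF sm, of t]
          unfolding p_def by (auto intro!: derivative_eq_intros)
      qed
      have "norm (p (h \<bullet> b) - p 0) \<le> e / 2 * norm (h \<bullet> b - 0)"
      proof (rule field_differentiable_bound[where S="cball 0 (norm h)", OF _ has_field_derivative_at_within[OF dp]])
        fix t :: real assume "t \<in> cball 0 (norm h)"
        then have t: "\<bar>t\<bar> \<le> norm h" by simp
        have "norm (z + t *\<^sub>R b - x) \<le> norm (pr S h) + norm (t *\<^sub>R b)"
          unfolding z_def using norm_triangle_ineq[of "pr S h" "t *\<^sub>R b"] by (simp add: algebra_simps)
        also have "\<dots> \<le> real (card S) * norm h + norm h"
          using norm_pr[of h] t b by simp
        also have "\<dots> = (real (card S) + 1) * norm h" by (simp add: algebra_simps)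
        also have "\<dots> < d2" using h by (simp add: d_def field_simps)
        finally show "norm (D b (z + t *\<^sub>R b) - D b x) \<le> e / 2"
          using d2(2) by (simp add: less_imp_le)
      qed (use b in \<open>auto simp: Basis_le_norm\<close>)
      also have "\<dots> \<le> e / 2 * norm h"
        using b insert.prems by (intro mult_left_mono) (auto simp: Basis_le_norm)
      finally have "\<bar>f (z + (h \<bullet> b) *\<^sub>R b) - f z - (h \<bullet> b) * D b x\<bar> \<le> e / 2 * norm h"
        by (simp add: p_def algebra_simps)
      moreover have "\<bar>f z - f x - (\<Sum>b\<in>S. (h \<bullet> b) * D b x)\<bar> \<le> e / 2 * norm h"
        using d1(2)[of h] h by (simp add: d_def z_def)
      moreover have "x + pr (insert b S) h = z + (h \<bullet> b) *\<^sub>R b"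
        using insert.hyps by (simp add: z_def pr_def algebra_simps)
      moreover have "e * norm h = e / 2 * norm h + e / 2 * norm h" by simp
      ultimately show ?thesis using insert.hyps by (simp del: times_divide_eq_left)
    qed
    ultimately show ?case by blast
  qed
  have pr: "pr Basis h = h" for h by (simp add: pr_def euclidean_representation)
  have bl: "bounded_linear (\<lambda>v. \<Sum>b\<in>Basis. (v \<bullet> b) *\<^sub>R D b x)"
    by (intro bounded_linear_sum bounded_linear_scaleR_const bounded_linear_inner_left)
  show ?thesis
    unfolding D_def[symmetric] has_derivative_at_alt
  proof (intro conjI bl allI impI)
    fix e :: real assume "e > 0"
    then obtain d where d: "d > 0" "\<And>h. norm h < d \<Longrightarrow>
        \<bar>f (x + pr Basis h) - f x - (\<Sum>b\<in>Basis. (h \<bullet> b) * D b x)\<bar> \<le> e * norm h"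
      using main[of Basis e] by auto
    show "\<exists>d>0. \<forall>y. norm (y - x) < d \<longrightarrow>
        norm (f y - f x - (\<Sum>b\<in>Basis. ((y - x) \<bullet> b) *\<^sub>R D b x)) \<le> e * norm (y - x)"
    proof (intro exI[of _ d] conjI d(1) allI impI)
      fix y assume "norm (y - x) < d"
      from d(2)[OF this] show "norm (f y - f x - (\<Sum>b\<in>Basis. ((y - x) \<bullet> b) *\<^sub>R D b x)) \<le> e * norm (y - x)"
        by (simp add: pr)
    qed
  qed
qed

text \<open>Boman's theorem. Being smooth along curves is inherited by directional derivatives, so
  the induction on the order of differentiability closes.\<close>

theorem smooth_iff_curve_smooth: "smooth f \<longleftrightarrow> curve_smooth f"
proof
  assume "smooth f"
  then show "curve_smooth f" by (simp add: curve_smooth_def smooth_compose)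
next
  assume "curve_smooth f"
  then have "Ck k f" for k
  proof (induction k arbitrary: f)
    case 0 then show ?case
      by (simp add: continuous_on_eq_continuous_at curve_smooth_isCont)
  next
    case (Suc k)
    show ?case
      by (rule Ck_SucI[OF curve_smooth_has_derivative[OF Suc.prems]])
        (intro Ck_sum Ck_scaleR Ck_const Suc.IH curve_smooth_dir_deriv Suc.prems)
  qed
  then show "smooth f" by (simp add: smooth_def)
qed

corollary smooth_alongI:
  fixes f :: "'a::euclidean_space \<Rightarrow> 'b::euclidean_space"
  assumes "\<And>c :: real \<Rightarrow> 'a. smooth c \<Longrightarrow> smooth (\<lambda>r. f (c r))"
  shows "smooth f"
proof -
  have "curve_smooth (\<lambda>x. f x \<bullet> b)" for b
    unfolding curve_smooth_def using smooth_inner[OF assms] by simp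
  then show ?thesis
    using smooth_componentwise[of f] smooth_iff_curve_smooth by blast
qed

lemma smooth_dir_deriv:
  fixes f :: "'a::euclidean_space \<Rightarrow> real"
  assumes "smooth f"
  shows "smooth (\<lambda>x. deriv (\<lambda>t. f (x + t *\<^sub>R w)) 0)"
  using assms curve_smooth_dir_deriv unfolding smooth_iff_curve_smooth by blast

subsection \<open>Hadamard's lemma with parameters\<close>

lemma smooth_partial:
  fixes f :: "'a::euclidean_space \<times> real \<Rightarrow> real"
  assumes "smooth f"
  shows "smooth (\<lambda>p. deriv (\<lambda>t. f (fst p, t)) (snd p))"
proof -
  have eq: "deriv (\<lambda>t. f (v, t)) s = deriv (\<lambda>t. f ((v, s) + t *\<^sub>R (0, 1))) 0" for v s
  proof -
    have "smooth (\<lambda>t. f (v, t))"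
      by (rule smooth_compose[OF assms]) (intro smooth_intros)
    from deriv_affine[OF this, of s 1] show ?thesis by (simp add: fun_eq_iff)
  qed
  show ?thesis
    using smooth_dir_deriv[OF assms, of "(0, 1)"] unfolding eq prod.collapse .
qed

lemma smooth_partial_fst:
  fixes f :: "real \<times> 'a::euclidean_space \<Rightarrow> real"
  assumes "smooth f"
  shows "smooth (\<lambda>p. deriv (\<lambda>t. f (t, snd p)) (fst p))"
proof -
  have "smooth (\<lambda>p :: 'a \<times> real. f (snd p, fst p))"
    by (rule smooth_compose[OF assms]) (intro smooth_intros)
  from smooth_partial[OF this] have "smooth (\<lambda>p :: 'a \<times> real. deriv (\<lambda>t. f (t, fst p)) (snd p))" by simp
  then have "smooth (\<lambda>q :: real \<times> 'a. (\<lambda>p :: 'a \<times> real. deriv (\<lambda>t. f (t, fst p)) (snd p)) (snd q, fst q))"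
    by (rule smooth_compose) (intro smooth_intros)
  then show ?thesis by simp
qed

lemma smooth_section:
  fixes f :: "'a::euclidean_space \<times> 'b::euclidean_space \<Rightarrow> 'c::euclidean_space"
  assumes "smooth f"
  shows smooth_section_fst: "smooth (\<lambda>t. f (t, y))" and smooth_section_snd: "smooth (\<lambda>t. f (x, t))"
  by (rule smooth_compose[OF assms]; intro smooth_intros)+

text \<open>The Leibniz rule keeps the class of such integrals closed under differentiation. One
  real parameter suffices: by Boman's theorem, more parameters are handled by restriction to a
  curve.\<close>

lemma smooth_parametric_integral:
  fixes \<phi> :: "real \<times> real \<Rightarrow> real"
  assumes "smooth \<phi>"
  shows "smooth (\<lambda>r. integral {0..1} (\<lambda>\<tau>. \<phi> (r, \<tau>)))"
proof (rule smooth_real_coinduct[where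
      P="\<lambda>g. \<exists>\<phi> :: real \<times> real \<Rightarrow> real. smooth \<phi> \<and> g = (\<lambda>r. integral {0..1} (\<lambda>\<tau>. \<phi> (r, \<tau>)))"])
  show "\<exists>\<phi>' :: real \<times> real \<Rightarrow> real. smooth \<phi>' \<and>
      (\<lambda>r. integral {0..1} (\<lambda>\<tau>. \<phi> (r, \<tau>))) = (\<lambda>r. integral {0..1} (\<lambda>\<tau>. \<phi>' (r, \<tau>)))"
    using assms by blast
next
  fix g :: "real \<Rightarrow> real"
  assume "\<exists>\<phi> :: real \<times> real \<Rightarrow> real. smooth \<phi> \<and> g = (\<lambda>r. integral {0..1} (\<lambda>\<tau>. \<phi> (r, \<tau>)))"
  then obtain \<phi> :: "real \<times> real \<Rightarrow> real" where \<phi>: "smooth \<phi>" and g: "g = (\<lambda>r. integral {0..1} (\<lambda>\<tau>. \<phi> (r, \<tau>)))"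
    by blast
  define \<psi> where "\<psi> p = deriv (\<lambda>t. \<phi> (t, snd p)) (fst p)" for p
  have \<psi>: "smooth \<psi>" unfolding \<psi>_def[abs_def] by (rule smooth_partial_fst[OF \<phi>])
  have "(g has_real_derivative integral {0..1} (\<lambda>\<tau>. \<psi> (r, \<tau>))) (at r)" for r
    unfolding g cbox_interval[symmetric]
  proof (rule leibniz_rule_field_derivative[where U=UNIV])
    show "((\<lambda>x. \<phi> (x, t)) has_real_derivative \<psi> (x, t)) (at x)" for x t
      unfolding \<psi>_def using smooth_has_deriv[OF smooth_section_fst[OF \<phi>]] by simp
    show "(\<lambda>\<tau>. \<phi> (x, \<tau>)) integrable_on cbox 0 1" for x
      by (intro integrable_continuous continuous_on_subset[OF smooth_imp_continuous[OF smooth_section_snd[OF \<phi>]]]) auto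
    show "continuous_on (UNIV \<times> cbox 0 1) (\<lambda>(x, t). \<psi> (x, t))"
      using continuous_on_subset[OF smooth_imp_continuous[OF \<psi>]] by (simp add: case_prod_unfold)
  qed auto
  then show "\<exists>f'. (\<exists>\<phi> :: real \<times> real \<Rightarrow> real. smooth \<phi> \<and> f' = (\<lambda>r. integral {0..1} (\<lambda>\<tau>. \<phi> (r, \<tau>)))) \<and>
      (\<forall>x. (g has_real_derivative f' x) (at x))"
    using \<psi> by blast
qed

text \<open>The quotient is the integral of the partial derivative along the segment from s' to s.
  Both ends stay variable, since later they are two coordinate functions whose difference lies in an
  ideal.\<close>

lemma Hadamard:
  fixes f :: "'a::euclidean_space \<times> real \<Rightarrow> real"
  assumes f: "smooth f"
  obtains K :: "'a \<times> real \<times> real \<Rightarrow> real" where "smooth K"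
    "\<And>v s s'. f (v, s) - f (v, s') = (s - s') * K (v, s, s')"
proof
  define \<psi> where "\<psi> p = deriv (\<lambda>t. f (fst p, t)) (snd p)" for p
  have \<psi>: "smooth \<psi>" unfolding \<psi>_def[abs_def] by (rule smooth_partial[OF f])
  define K where "K p = integral {0..1} (\<lambda>\<tau>. \<psi> (fst p, snd (snd p) + \<tau> * (fst (snd p) - snd (snd p))))" for p
  show "smooth K"
  proof (rule smooth_alongI)
    fix c :: "real \<Rightarrow> 'a \<times> real \<times> real" assume c: "smooth c"
    have "smooth (\<lambda>q :: real \<times> real. \<psi> (fst (c (fst q)),
        snd (snd (c (fst q))) + snd q * (fst (snd (c (fst q))) - snd (snd (c (fst q))))))"
      by (rule smooth_compose[OF \<psi>]) (intro smooth_intros smooth_compose[OF c])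
    from smooth_parametric_integral[OF this] show "smooth (\<lambda>r. K (c r))" by (simp add: K_def)
  qed
  fix v s s'
  have df: "((\<lambda>t. f (v, t)) has_real_derivative \<psi> (v, t)) (at t)" for t
    unfolding \<psi>_def using smooth_has_deriv[OF smooth_section_snd[OF f]] by simp
  have "((\<lambda>\<tau>. \<psi> (v, s' + \<tau> * (s - s')) * (s - s')) has_integral
      f (v, s' + 1 * (s - s')) - f (v, s' + 0 * (s - s'))) {0..1}"
  proof (rule fundamental_theorem_of_calculus)
    fix \<tau> :: real
    have "((\<lambda>\<tau>. f (v, s' + \<tau> * (s - s'))) has_real_derivative \<psi> (v, s' + \<tau> * (s - s')) * (s - s')) (at \<tau>)"
      by (rule DERIV_chain2[OF df]) (auto intro!: derivative_eq_intros)
    then show "((\<lambda>\<tau>. f (v, s' + \<tau> * (s - s'))) has_vector_derivative \<psi> (v, s' + \<tau> * (s - s')) * (s - s')) (at \<tau> within {0..1})"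
      by (simp add: has_real_derivative_iff_has_vector_derivative has_vector_derivative_at_within)
  qed simp
  from integral_unique[OF this] show "f (v, s) - f (v, s') = (s - s') * K (v, s, s')"
    unfolding K_def by (simp add: mult.commute)
qed

lemma Hadamard_zero:
  fixes f :: "'a::euclidean_space \<times> real \<Rightarrow> real"
  assumes f: "smooth f"
  obtains g :: "'a \<times> real \<Rightarrow> real" where "smooth g"
    "\<And>v s. f (v, s) = f (v, 0) + s * g (v, s)" "\<And>v. g (v, 0) = deriv (\<lambda>s. f (v, s)) 0"
proof -
  obtain K where K: "smooth K" "\<And>v s s'. f (v, s) - f (v, s') = (s - s') * K (v, s, s')"
    using Hadamard[OF f] by blast
  define g where "g p = K (fst p, snd p, 0)" for p
  have g: "smooth g" unfolding g_def[abs_def] by (rule smooth_compose[OF K(1)]) (intro smooth_intros)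
  have eq: "f (v, s) = f (v, 0) + s * g (v, s)" for v s
    using K(2)[of v s 0] by (simp add: g_def)
  have "deriv (\<lambda>s. f (v, s)) 0 = g (v, 0)" for v
  proof (rule DERIV_imp_deriv)
    have "((\<lambda>s. f (v, 0) + s * g (v, s)) has_real_derivative g (v, 0)) (at 0)"
      using smooth_has_deriv[OF smooth_section_snd[OF g]] by (auto intro!: derivative_eq_intros)
    then show "((\<lambda>s. f (v, s)) has_real_derivative g (v, 0)) (at 0)" by (simp add: eq[symmetric])
  qed
  with g eq that show ?thesis by metis
qed

lemma Hadamard_real:
  fixes f :: "real \<Rightarrow> real"
  assumes f: "smooth f" "f 0 = 0"
  obtains g :: "real \<Rightarrow> real" where "smooth g" "\<And>s. f s = s * g s" "g 0 = deriv f 0"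
proof -
  have "smooth (\<lambda>p :: real \<times> real. f (snd p))"
    by (rule smooth_compose[OF f(1)]) (intro smooth_intros)
  from Hadamard_zero[OF this] obtain g :: "real \<times> real \<Rightarrow> real" where g: "smooth g"
    "\<And>v s. f s = f 0 + s * g (v, s)" "\<And>v. g (v, 0) = deriv f 0"
    by auto
  show ?thesis
    by (rule that[of "\<lambda>s. g (0, s)"]) (use g f(2) smooth_section_snd[OF g(1)] in auto)
qed


subsection \<open>The ideals defining infinitesimal objects\<close>

text \<open>Vanishing at 0 is what makes the base point of a class independent of the
  representative.\<close>

definition weil_ideal :: "'k::euclidean_space ideal \<Rightarrow> bool" where
  "weil_ideal I \<longleftrightarrow> (\<forall>f\<in>I. smooth f \<and> f 0 = 0) \<and> (\<lambda>_. 0) \<in> I \<and>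
     (\<forall>f\<in>I. \<forall>g\<in>I. (\<lambda>v. f v + g v) \<in> I) \<and> (\<forall>a f. smooth a \<longrightarrow> f \<in> I \<longrightarrow> (\<lambda>v. a v * f v) \<in> I)"

lemma weil_idealD:
  assumes "weil_ideal I"
  shows weil_ideal_smooth: "f \<in> I \<Longrightarrow> smooth f"
    and weil_ideal_vanishes: "f \<in> I \<Longrightarrow> f 0 = 0"
    and weil_ideal_zero: "(\<lambda>_. 0) \<in> I"
    and weil_ideal_add: "f \<in> I \<Longrightarrow> g \<in> I \<Longrightarrow> (\<lambda>v. f v + g v) \<in> I"
    and weil_ideal_mult: "smooth a \<Longrightarrow> f \<in> I \<Longrightarrow> (\<lambda>v. a v * f v) \<in> I"
  using assms by (auto simp: weil_ideal_def)

lemma weil_ideal_uminus: "weil_ideal I \<Longrightarrow> f \<in> I \<Longrightarrow> (\<lambda>v. - f v) \<in> I"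
  using weil_ideal_mult[of I "\<lambda>_. -1" f] by simp

lemma weil_ideal_diff_commute:
  "weil_ideal I \<Longrightarrow> (\<lambda>v. f v - g v) \<in> I \<Longrightarrow> (\<lambda>v. g v - f v) \<in> I"
  using weil_ideal_uminus[of I "\<lambda>v. f v - g v"] by simp

lemma weil_ideal_diff_trans:
  "weil_ideal I \<Longrightarrow> (\<lambda>v. f v - g v) \<in> I \<Longrightarrow> (\<lambda>v. g v - h v) \<in> I \<Longrightarrow> (\<lambda>v. f v - h v) \<in> I"
  using weil_ideal_add[of I "\<lambda>v. f v - g v" "\<lambda>v. g v - h v"] by simp

lemma gen_ideal_zero: "(\<lambda>_. 0) \<in> gen_ideal S"
  unfolding gen_ideal_def by (rule CollectI, rule exI[of _ "{}"]) auto

lemma gen_ideal_generator: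
  assumes "smooth a" "s \<in> S" shows "(\<lambda>v. a v * s v) \<in> gen_ideal S"
  unfolding gen_ideal_def using assms
  by (intro CollectI exI[of _ "{s}"] exI[of _ "\<lambda>_. a"]) auto

text \<open>An element of the ideal is built by adding one multiple of a generator at a time. Its
  smoothness is carried along because the differentiation rules in the inductive steps ask for
  it.\<close>

lemma gen_ideal_induct [consumes 1, case_names zero add]:
  assumes "f \<in> gen_ideal S" and "P (\<lambda>_. 0)"
    and "\<And>f a s. P f \<Longrightarrow> smooth f \<Longrightarrow> smooth a \<Longrightarrow> s \<in> S \<Longrightarrow> smooth s \<Longrightarrow> P (\<lambda>v. f v + a v * s v)"
    and "\<And>s. s \<in> S \<Longrightarrow> smooth s"
  shows "P f \<and> smooth f"
proof -
  obtain F a where F: "finite F" "F \<subseteq> S" "\<And>s. s \<in> F \<Longrightarrow> smooth (a s)" "f = (\<lambda>v. \<Sum>s\<in>F. a s v * s v)"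
    using assms(1) by (auto simp: gen_ideal_def)
  have "P (\<lambda>v. \<Sum>s\<in>F. a s v * s v) \<and> smooth (\<lambda>v. \<Sum>s\<in>F. a s v * s v)"
    using F(1-3)
  proof (induction F rule: finite_induct)
    case (insert s F)
    then have "P (\<lambda>v. (\<Sum>s\<in>F. a s v * s v) + a s v * s v)"
      by (intro assms(3)[OF _ _ _ _ assms(4)]) auto
    moreover have "smooth (\<lambda>v. (\<Sum>s\<in>F. a s v * s v) + a s v * s v)"
      by (rule smooth_add[OF _ smooth_mult[OF _ assms(4)]]) (use insert in auto)
    ultimately show ?case using insert.hyps by (simp add: add.commute)
  qed (simp add: assms(2))
  then show ?thesis by (simp add: F(4))
qed

lemma weil_ideal_gen_ideal:
  assumes S: "\<And>s. s \<in> S \<Longrightarrow> smooth s \<and> s 0 = 0"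
  shows "weil_ideal (gen_ideal S)"
proof -
  have gadd: "(\<lambda>v. f v + a v * s v) \<in> gen_ideal S" if f: "f \<in> gen_ideal S" and "smooth a" "s \<in> S" for f a s
  proof -
    obtain F b where F: "finite F" "F \<subseteq> S" "\<And>s. s \<in> F \<Longrightarrow> smooth (b s)" "f = (\<lambda>v. \<Sum>s\<in>F. b s v * s v)"
      using f by (auto simp: gen_ideal_def)
    \<comment> \<open>A generator has a single coefficient in the sum, so if s already occurs in F
      the new coefficient is added to the old one.\<close>
    define b' where "b' t v = (if t \<in> F then b t v else 0) + (if t = s then a v else 0)" for t v
    have "(\<lambda>v. f v + a v * s v) = (\<lambda>v. \<Sum>t\<in>insert s F. b' t v * t v)"
    proof
      fix v
      have "(\<Sum>t\<in>insert s F. b' t v * t v) = (\<Sum>t\<in>insert s F. (if t \<in> F then b t v * t v else 0)) +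
          (\<Sum>t\<in>insert s F. (if t = s then a v * s v else 0))"
        by (simp only: sum.distrib[symmetric]) (intro sum.cong, auto simp: b'_def distrib_right)
      also have "(\<Sum>t\<in>insert s F. (if t \<in> F then b t v * t v else 0)) = (\<Sum>t\<in>F. b t v * t v)"
        using F(1) by (simp add: sum.If_cases insert_absorb Int_insert_left)
      also have "(\<Sum>t\<in>insert s F. (if t = s then a v * s v else 0)) = a v * s v"
        using F(1) by (simp add: sum.delta)
      finally show "f v + a v * s v = (\<Sum>t\<in>insert s F. b' t v * t v)" by (simp add: F(4))
    qed
    moreover have "smooth (b' t)" if "t \<in> insert s F" for t
      unfolding b'_def[abs_def] using F(3) \<open>smooth a\<close> by (cases "t \<in> F"; cases "t = s") (auto intro: smooth_add)
    ultimately show ?thesis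
      unfolding gen_ideal_def using F(1,2) that(3)
      by (intro CollectI exI[of _ "insert s F"] exI[of _ b']) auto
  qed
  have "(\<lambda>v. f v + g v) \<in> gen_ideal S" if f: "f \<in> gen_ideal S" and g: "g \<in> gen_ideal S" for f g
  proof -
    have "(\<lambda>v. f v + g v) \<in> gen_ideal S \<and> smooth g"
      using g
    proof (induction rule: gen_ideal_induct)
      case zero show ?case using f by simp
    next
      case (add g a s)
      from gadd[OF add(1,3,4)] show ?case by (simp add: add.assoc)
    qed (use S in auto)
    then show ?thesis by simp
  qed
  moreover have "(\<lambda>v. c v * f v) \<in> gen_ideal S" if f: "f \<in> gen_ideal S" and "smooth c" for f c
  proof -
    have "(\<lambda>v. c v * f v) \<in> gen_ideal S \<and> smooth f"
      using f
    proof (induction rule: gen_ideal_induct)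
      case zero show ?case by (simp add: gen_ideal_zero)
    next
      case (add f a s)
      from gadd[OF add(1) smooth_mult[OF \<open>smooth c\<close> add(3)] add(4)]
      show ?case by (simp add: algebra_simps)
    qed (use S in auto)
    then show ?thesis by simp
  qed
  moreover have "f 0 = 0 \<and> smooth f" if "f \<in> gen_ideal S" for f
    using that by (induction rule: gen_ideal_induct) (use S in auto)
  ultimately show ?thesis
    unfolding weil_ideal_def using gen_ideal_zero by blast
qed

lemma smooth_case_prod:
  fixes f :: "real \<Rightarrow> real \<Rightarrow> real"
  assumes "smooth (\<lambda>p. f (fst p) (snd p))" shows "smooth (\<lambda>(x, y). f x y)"
  using assms by (simp add: case_prod_unfold)

lemma weil_ideal_D: "weil_ideal ideal_D"
  unfolding ideal_D_def by (rule weil_ideal_gen_ideal) (auto intro!: smooth_intros)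

lemma weil_ideal_Dm: "weil_ideal (ideal_Dm m)"
  unfolding ideal_Dm_def by (rule weil_ideal_gen_ideal) (auto intro!: smooth_mult smooth_power smooth_ident)

lemma weil_ideal_DD: "weil_ideal ideal_DD"
  unfolding ideal_DD_def
  by (rule weil_ideal_gen_ideal) (auto intro!: smooth_case_prod smooth_intros simp: zero_prod_def)

lemma weil_ideal_DDm: "weil_ideal (ideal_DDm m)"
  unfolding ideal_DDm_def
  by (rule weil_ideal_gen_ideal) (auto intro!: smooth_case_prod smooth_mult smooth_power smooth_fst smooth_snd smooth_ident simp: zero_prod_def)

lemma deriv_add_smooth:
  "smooth f \<Longrightarrow> smooth g \<Longrightarrow> deriv (\<lambda>x. f x + g x) x = deriv f x + deriv g (x :: real)" for f g :: "real \<Rightarrow> real"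
  by (intro DERIV_imp_deriv DERIV_add smooth_has_deriv)

lemma deriv_mult_smooth:
  "smooth f \<Longrightarrow> smooth g \<Longrightarrow> deriv (\<lambda>x. f x * g x) x = f x * deriv g x + deriv f x * g (x :: real)" for f g :: "real \<Rightarrow> real"
  by (intro DERIV_imp_deriv DERIV_mult' smooth_has_deriv)

lemma deriv_power_at_0 [simp]: "deriv (\<lambda>x :: real. x ^ Suc (Suc m)) 0 = 0"
  by (rule DERIV_imp_deriv) (auto intro!: derivative_eq_intros)

text \<open>Two applications of Hadamard's lemma divide f by s^2. A class over D is thus a value
  together with a first derivative.\<close>

lemma ideal_D_iff: "f \<in> ideal_D \<longleftrightarrow> smooth f \<and> f 0 = 0 \<and> deriv f 0 = 0"
proof
  assume "f \<in> ideal_D"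
  then have "(f 0 = 0 \<and> deriv f 0 = 0) \<and> smooth f"
    unfolding ideal_D_def
  proof (induction rule: gen_ideal_induct)
    case (add f a s)
    then show ?case using deriv_power_at_0[of 0]
      by (auto simp: deriv_add_smooth deriv_mult_smooth smooth_mult numeral_2_eq_2 simp del: deriv_power_at_0 power_Suc)
  qed (auto intro!: smooth_intros)
  then show "smooth f \<and> f 0 = 0 \<and> deriv f 0 = 0" by blast
next
  assume f: "smooth f \<and> f 0 = 0 \<and> deriv f 0 = 0"
  then obtain g where g: "smooth g" "\<And>s. f s = s * g s" "g 0 = 0"
    using Hadamard_real[of f] by auto
  then obtain k where k: "smooth k" "\<And>s. g s = s * k s"
    using Hadamard_real[OF g(1,3)] by blast
  have "f = (\<lambda>s. k s * s ^ 2)"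
    by (simp add: g(2) k(2) power2_eq_square fun_eq_iff)
  then show "f \<in> ideal_D"
    unfolding ideal_D_def using gen_ideal_generator[OF k(1), of "\<lambda>d. d ^ 2" "{\<lambda>d. d ^ 2}"] by simp
qed

text \<open>Expanding f to second order in the inner variable d leaves a multiple of d^2; membership
  is decided by the two remaining coefficients as functions of e. This is the algebra behind
  splitting a class over D x D into a family of classes over D.\<close>

lemma ideal_DD_iff:
  assumes f: "smooth f"
  shows "f \<in> ideal_DD \<longleftrightarrow> (\<lambda>e. f (e, 0)) \<in> ideal_D \<and> (\<lambda>e. deriv (\<lambda>d. f (e, d)) 0) \<in> ideal_D"
proof
  assume "f \<in> ideal_DD"
  then have "((\<lambda>e. f (e, 0)) \<in> ideal_D \<and> (\<lambda>e. deriv (\<lambda>d. f (e, d)) 0) \<in> ideal_D) \<and> smooth f"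
    unfolding ideal_DD_def
  proof (induction rule: gen_ideal_induct)
    case zero then show ?case by (simp add: weil_ideal_zero[OF weil_ideal_D])
  next
    case (add f a s)
    have eq: "deriv (\<lambda>d. f (e, d) + a (e, d) * s (e, d)) 0
        = deriv (\<lambda>d. f (e, d)) 0 + (a (e, 0) * deriv (\<lambda>d. s (e, d)) 0 + deriv (\<lambda>d. a (e, d)) 0 * s (e, 0))" for e
      using add by (simp add: deriv_add_smooth deriv_mult_smooth smooth_mult smooth_section_snd)
    have a1: "smooth (\<lambda>e. deriv (\<lambda>d. a (e, d)) 0)"
      using smooth_section_fst[OF smooth_partial[OF add(3)], of 0] by simp
    have a0: "smooth (\<lambda>e. a (e, 0))" by (rule smooth_section_fst[OF add(3)])
    have sq: "(\<lambda>e :: real. e ^ 2) \<in> ideal_D"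
      using deriv_power_at_0[of 0]
      by (simp add: ideal_D_iff smooth_power numeral_2_eq_2 del: deriv_power_at_0 power_Suc)
    from add(4) show ?case
    proof (elim insertE emptyE)
      assume s: "s = (\<lambda>(d1, d2). d1 ^ 2)"
      show ?thesis
        unfolding eq using add(1) weil_ideal_mult[OF weil_ideal_D a0 sq] weil_ideal_mult[OF weil_ideal_D a1 sq]
        by (simp add: s weil_ideal_add[OF weil_ideal_D])
    next
      assume s: "s = (\<lambda>(d1, d2). d2 ^ 2)"
      show ?thesis unfolding eq using add(1) deriv_power_at_0[of 0]
        by (simp add: s numeral_2_eq_2 del: deriv_power_at_0)
    qed
  qed (auto intro!: smooth_case_prod smooth_intros)
  then show "(\<lambda>e. f (e, 0)) \<in> ideal_D \<and> (\<lambda>e. deriv (\<lambda>d. f (e, d)) 0) \<in> ideal_D" by blast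
next
  assume D: "(\<lambda>e. f (e, 0)) \<in> ideal_D \<and> (\<lambda>e. deriv (\<lambda>d. f (e, d)) 0) \<in> ideal_D"
  obtain g where g: "smooth g" "\<And>v s. f (v, s) = f (v, 0) + s * g (v, s)"
    "\<And>v. g (v, 0) = deriv (\<lambda>s. f (v, s)) 0"
    by (rule Hadamard_zero[OF f]) (rule that)
  obtain k where k: "smooth k" "\<And>v s. g (v, s) = g (v, 0) + s * k (v, s)"
    "\<And>v. k (v, 0) = deriv (\<lambda>s. g (v, s)) 0"
    by (rule Hadamard_zero[OF g(1)]) (rule that)
  have ext: "(\<lambda>p. c (fst p)) \<in> ideal_DD" if c: "c \<in> ideal_D" for c
  proof -
    have "(\<lambda>p. c (fst p)) \<in> ideal_DD \<and> smooth c"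
      using c unfolding ideal_D_def
    proof (induction rule: gen_ideal_induct)
      case zero show ?case by (simp add: weil_ideal_zero[OF weil_ideal_DD])
    next
      case (add c a s)
      have "(\<lambda>p. a (fst p) * (\<lambda>(d1, d2). d1 ^ 2) p) \<in> ideal_DD"
        unfolding ideal_DD_def
        by (rule gen_ideal_generator) (auto intro!: smooth_compose[OF add(3)] smooth_intros)
      from weil_ideal_add[OF weil_ideal_DD add(1) this] show ?case
        using add(4) by (simp add: case_prod_unfold)
    qed (auto intro!: smooth_intros)
    then show ?thesis by simp
  qed
  have 1: "(\<lambda>p. k p * (\<lambda>(d1, d2). d2 ^ 2) p) \<in> ideal_DD"
    unfolding ideal_DD_def by (rule gen_ideal_generator) (auto simp: k(1))
  have 2: "(\<lambda>p. snd p * g (fst p, 0)) \<in> ideal_DD"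
    by (rule weil_ideal_mult[OF weil_ideal_DD _ ext]) (use D in \<open>auto simp: g(3) intro!: smooth_intros\<close>)
  have "f = (\<lambda>p. f (fst p, 0) + (snd p * g (fst p, 0) + k p * (\<lambda>(d1, d2). d2 ^ 2) p))"
  proof
    fix p :: "real \<times> real"
    obtain x y where p: "p = (x, y)" by force
    show "f p = f (fst p, 0) + (snd p * g (fst p, 0) + k p * (\<lambda>(d1, d2). d2 ^ 2) p)"
      using g(2)[of x y] k(2)[of x y] by (simp add: p power2_eq_square algebra_simps)
  qed
  also have "\<dots> \<in> ideal_DD"
    by (intro weil_ideal_add[OF weil_ideal_DD] 1 2 ext) (use D in auto)
  finally show "f \<in> ideal_DD" .
qed

text \<open>Here the inner variable d comes first. Passing to its coefficients of degree 0 and 1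
  respects the ideals, so splitting off d does not depend on the representative.\<close>

lemma ideal_DDm_imp:
  assumes "f \<in> ideal_DDm m"
  shows "(\<lambda>e. f (0, e)) \<in> ideal_Dm m" "(\<lambda>e. deriv (\<lambda>d. f (d, e)) 0) \<in> ideal_Dm m"
proof -
  have "((\<lambda>e. f (0, e)) \<in> ideal_Dm m \<and> (\<lambda>e. deriv (\<lambda>d. f (d, e)) 0) \<in> ideal_Dm m) \<and> smooth f"
    using assms unfolding ideal_DDm_def
  proof (induction rule: gen_ideal_induct)
    case zero then show ?case by (simp add: weil_ideal_zero[OF weil_ideal_Dm])
  next
    case (add f a s)
    have eq: "deriv (\<lambda>d. f (d, e) + a (d, e) * s (d, e)) 0
        = deriv (\<lambda>d. f (d, e)) 0 + (a (0, e) * deriv (\<lambda>d. s (d, e)) 0 + deriv (\<lambda>d. a (d, e)) 0 * s (0, e))" for e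
      using add by (simp add: deriv_add_smooth deriv_mult_smooth smooth_mult smooth_section_fst)
    have a1: "smooth (\<lambda>e. deriv (\<lambda>d. a (d, e)) 0)"
      using smooth_section_snd[OF smooth_partial_fst[OF add(3)], of 0] by simp
    have a0: "smooth (\<lambda>e. a (0, e))" by (rule smooth_section_snd[OF add(3)])
    have sq: "(\<lambda>e. b e * e ^ (m + 1)) \<in> ideal_Dm m" if "smooth b" for b
      unfolding ideal_Dm_def by (rule gen_ideal_generator[OF that]) simp
    from add(4) show ?case
    proof (elim insertE emptyE)
      assume s: "s = (\<lambda>(d, e). d ^ 2)"
      show ?thesis unfolding eq using add(1) deriv_power_at_0[of 0]
        by (simp add: s numeral_2_eq_2 del: deriv_power_at_0)
    next
      assume s: "s = (\<lambda>(d, e). e ^ (m + 1))"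
      show ?thesis
        unfolding eq using add(1) sq[OF a0] sq[OF a1]
        by (simp add: s weil_ideal_add[OF weil_ideal_Dm])
    qed
  qed (auto intro!: smooth_case_prod smooth_mult smooth_power smooth_fst smooth_snd smooth_ident)
  then show "(\<lambda>e. f (0, e)) \<in> ideal_Dm m" "(\<lambda>e. deriv (\<lambda>d. f (d, e)) 0) \<in> ideal_Dm m" by auto
qed

subsection \<open>Froelicher spaces with global coordinates\<close>

lemma tcls_eqI:
  assumes I: "weil_ideal I" and fg: "\<And>h. h \<in> smooth_functions X \<Longrightarrow> (\<lambda>v. h (f v) - h (g v)) \<in> I"
  shows "tcls X I f = tcls X I g"
proof -
  have "(\<lambda>v. h (f v) - h (x v)) \<in> I \<longleftrightarrow> (\<lambda>v. h (g v) - h (x v)) \<in> I" if "h \<in> smooth_functions X" for h x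
    using weil_ideal_diff_trans[OF I fg[OF that], of "\<lambda>v. h (x v)"]
      weil_ideal_diff_trans[OF I weil_ideal_diff_commute[OF I fg[OF that]], of "\<lambda>v. h (x v)"] by blast
  then show ?thesis unfolding tcls_def by blast
qed

text \<open>The index set is a set rather than a type because it depends on the order of the jets.\<close>

locale charted =
  fixes X :: "'a fspace" and B :: "'i set" and \<kappa> :: "'a \<Rightarrow> 'i \<Rightarrow> real"
  assumes finite_coords: "finite B"
    and coords_ex1: "\<exists>!x. x \<in> pts X \<and> (\<forall>i\<in>B. \<kappa> x i = a i)"
    and curves_iff: "c \<in> curves X \<longleftrightarrow> range c \<subseteq> pts X \<and> (\<forall>i\<in>B. smooth (\<lambda>r. \<kappa> (c r) i))"
begin

definition pt :: "('i \<Rightarrow> real) \<Rightarrow> 'a" where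
  "pt a = (THE x. x \<in> pts X \<and> (\<forall>i\<in>B. \<kappa> x i = a i))"

lemma pt_in [simp]: "pt a \<in> pts X" and coord_pt [simp]: "i \<in> B \<Longrightarrow> \<kappa> (pt a) i = a i"
  using theI'[OF coords_ex1[of a]] by (auto simp: pt_def)

lemma coords_eqI: "x \<in> pts X \<Longrightarrow> y \<in> pts X \<Longrightarrow> (\<And>i. i \<in> B \<Longrightarrow> \<kappa> x i = \<kappa> y i) \<Longrightarrow> x = y"
  using coords_ex1[of "\<kappa> y"] by blast

text \<open>Boman's theorem enters here: a morphism is tested along curves, yet its coordinates come
  out jointly smooth.\<close>

lemma mor_euclid_iff:
  fixes f :: "'k::euclidean_space \<Rightarrow> 'a"
  shows "f \<in> mor euclid X \<longleftrightarrow> (\<forall>v. f v \<in> pts X) \<and> (\<forall>i\<in>B. smooth (\<lambda>v. \<kappa> (f v) i))"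
proof
  assume f: "f \<in> mor euclid X"
  have "smooth (\<lambda>v. \<kappa> (f v) i)" if i: "i \<in> B" for i
  proof (rule smooth_alongI)
    fix c :: "real \<Rightarrow> 'k" assume "smooth c"
    with f have "f \<circ> c \<in> curves X" by (simp add: mor_def euclid_def)
    with i show "smooth (\<lambda>r. \<kappa> (f (c r)) i)" by (simp add: curves_iff)
  qed
  with f show "(\<forall>v. f v \<in> pts X) \<and> (\<forall>i\<in>B. smooth (\<lambda>v. \<kappa> (f v) i))"
    by (auto simp: mor_def euclid_def)
next
  assume f: "(\<forall>v. f v \<in> pts X) \<and> (\<forall>i\<in>B. smooth (\<lambda>v. \<kappa> (f v) i))"
  have "f \<circ> c \<in> curves X" if "smooth c" for c :: "real \<Rightarrow> 'k"
    using f smooth_compose[OF _ that] by (auto simp: curves_iff)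
  with f show "f \<in> mor euclid X" by (auto simp: mor_def euclid_def)
qed

lemma mor_euclid_real: "f \<in> mor (euclid :: real fspace) X \<longleftrightarrow> f \<in> curves X"
  by (auto simp: mor_euclid_iff curves_iff)

lemma coord_smooth_function:
  "i \<in> B \<Longrightarrow> restrict (\<lambda>x. \<kappa> x i) (pts X) \<in> smooth_functions X"
  using curves_iff by (auto simp: mor_def euclid_def smooth_restrict_comp) (auto simp: o_def)

text \<open>The coordinates of \<open>f\<close> are replaced by those of \<open>g\<close> one at a time, so that only the
  one-variable version of Hadamard's lemma is needed.\<close>

lemma smooth_function_diff_in_ideal:
  fixes f g :: "'k::euclidean_space \<Rightarrow> 'a"
  assumes h: "h \<in> smooth_functions X" and I: "weil_ideal I"
    and f: "f \<in> mor euclid X" and g: "g \<in> mor euclid X"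
    and fg: "\<And>i. i \<in> B \<Longrightarrow> (\<lambda>v. \<kappa> (f v) i - \<kappa> (g v) i) \<in> I"
  shows "(\<lambda>v. h (f v) - h (g v)) \<in> I"
proof -
  have f': "\<And>v. f v \<in> pts X" "\<And>i. i \<in> B \<Longrightarrow> smooth (\<lambda>v. \<kappa> (f v) i)"
    and g': "\<And>v. g v \<in> pts X" "\<And>i. i \<in> B \<Longrightarrow> smooth (\<lambda>v. \<kappa> (g v) i)"
    using f g by (auto simp: mor_euclid_iff)
  define mix where "mix S v = pt (\<lambda>i. if i \<in> S then \<kappa> (g v) i else \<kappa> (f v) i)" for S v
  have main: "(\<lambda>v. h (f v) - h (mix S v)) \<in> I" if "finite S" "S \<subseteq> B" for S
    using that
  proof (induction S rule: finite_induct)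
    case empty
    have "mix {} v = f v" for v
      unfolding mix_def by (rule coords_eqI) (auto simp: f')
    then show ?case by (simp add: weil_ideal_zero[OF I])
  next
    case (insert i S)
    \<comment> \<open>\<open>q v\<close> runs along the i-th coordinate line through
      \<open>mix S v\<close>; the parameter values given by the i-th coordinates of f and g yield
      two consecutive mixtures.\<close>
    define q where "q v s = pt (\<lambda>j. if j = i then s else \<kappa> (mix S v) j)" for v s
    define H where "H p = h (q (fst p) (snd p))" for p
    have q: "(\<lambda>p. q (fst p) (snd p)) \<in> mor (euclid :: ('k \<times> real) fspace) X"
      unfolding mor_euclid_iff
    proof (intro conjI allI ballI)
      fix j assume j: "j \<in> B"
      show "smooth (\<lambda>p :: 'k \<times> real. \<kappa> (q (fst p) (snd p)) j)"
        using j by (cases "j = i"; cases "j \<in> S")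
          (auto simp: q_def mix_def intro!: smooth_intros smooth_compose[OF f'(2)] smooth_compose[OF g'(2)])
    qed (simp add: q_def)
    have "smooth H"
    proof (rule smooth_alongI)
      fix c :: "real \<Rightarrow> 'k \<times> real" assume "smooth c"
      with q have "(\<lambda>p. q (fst p) (snd p)) \<circ> c \<in> curves X"
        by (auto simp: mor_def euclid_def)
      with h show "smooth (\<lambda>r. H (c r))"
        by (auto simp: mor_def euclid_def o_def H_def)
    qed
    then obtain K where K: "smooth K" "\<And>v s s'. H (v, s) - H (v, s') = (s - s') * K (v, s, s')"
      by (rule Hadamard) (rule that)
    have i: "i \<in> B" using insert.prems by simp
    have 1: "q v (\<kappa> (f v) i) = mix S v" "q v (\<kappa> (g v) i) = mix (insert i S) v" for v
      using insert by (auto simp: q_def mix_def intro!: coords_eqI)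
    have "h (mix S v) - h (mix (insert i S) v)
        = K (v, \<kappa> (f v) i, \<kappa> (g v) i) * (\<kappa> (f v) i - \<kappa> (g v) i)" for v
      using K(2)[of v "\<kappa> (f v) i" "\<kappa> (g v) i"] by (simp add: H_def 1 mult.commute)
    moreover have "smooth (\<lambda>v. K (v, \<kappa> (f v) i, \<kappa> (g v) i))"
      using f'(2)[OF i] g'(2)[OF i] by (intro smooth_compose[OF K(1)] smooth_Pair smooth_ident)
    ultimately have "(\<lambda>v. h (mix S v) - h (mix (insert i S) v)) \<in> I"
      using weil_ideal_mult[OF I _ fg[OF i]] by simp
    with insert show ?case by (intro weil_ideal_diff_trans[OF I insert.IH]) auto
  qed
  have "mix B v = g v" for v
    unfolding mix_def by (rule coords_eqI) (auto simp: g')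
  with main[OF finite_coords] show ?thesis by simp
qed

text \<open>Coordinates are themselves smooth functions, and conversely the difference of any smooth
  function at f and g lies in the ideal as soon as the coordinate differences do. So congruence may
  be checked on coordinates.\<close>

lemma mem_tcls_iff:
  assumes I: "weil_ideal I" and f: "f \<in> mor (euclid :: 'k::euclidean_space fspace) X"
  shows "g \<in> tcls X I f \<longleftrightarrow> g \<in> mor euclid X \<and> (\<forall>i\<in>B. (\<lambda>v. \<kappa> (f v) i - \<kappa> (g v) i) \<in> I)"
proof
  assume g: "g \<in> tcls X I f"
  have "(\<lambda>v. \<kappa> (f v) i - \<kappa> (g v) i) \<in> I" if i: "i \<in> B" for i
  proof -
    have "(\<lambda>v. restrict (\<lambda>x. \<kappa> x i) (pts X) (f v) - restrict (\<lambda>x. \<kappa> x i) (pts X) (g v)) \<in> I"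
      using g coord_smooth_function[OF i] unfolding tcls_def by blast
    with f g show ?thesis by (simp add: tcls_def mor_euclid_iff)
  qed
  with g show "g \<in> mor euclid X \<and> (\<forall>i\<in>B. (\<lambda>v. \<kappa> (f v) i - \<kappa> (g v) i) \<in> I)" by (simp add: tcls_def)
next
  assume "g \<in> mor euclid X \<and> (\<forall>i\<in>B. (\<lambda>v. \<kappa> (f v) i - \<kappa> (g v) i) \<in> I)"
  with smooth_function_diff_in_ideal[OF _ I f] show "g \<in> tcls X I f" by (simp add: tcls_def)
qed

lemma self_mem_tcls: "weil_ideal I \<Longrightarrow> f \<in> mor euclid X \<Longrightarrow> f \<in> tcls X I f"
  by (simp add: tcls_def weil_ideal_zero)

lemma tcls_eq_iff:
  assumes I: "weil_ideal I" and f: "f \<in> mor (euclid :: 'k::euclidean_space fspace) X" and g: "g \<in> mor euclid X"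
  shows "tcls X I f = tcls X I g \<longleftrightarrow> (\<forall>i\<in>B. (\<lambda>v. \<kappa> (f v) i - \<kappa> (g v) i) \<in> I)"
proof
  assume "tcls X I f = tcls X I g"
  with self_mem_tcls[OF I g] have "g \<in> tcls X I f" by simp
  then show "\<forall>i\<in>B. (\<lambda>v. \<kappa> (f v) i - \<kappa> (g v) i) \<in> I" by (simp add: mem_tcls_iff[OF I f])
next
  assume fg: "\<forall>i\<in>B. (\<lambda>v. \<kappa> (f v) i - \<kappa> (g v) i) \<in> I"
  then show "tcls X I f = tcls X I g"
    using smooth_function_diff_in_ideal[OF _ I f g] by (intro tcls_eqI[OF I]) auto
qed

end

section \<open>Chosen representatives and induced maps\<close>

lemma pts_tensor: "pts (tensor X I) = tcls X I ` mor euclid X"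
  by (simp add: tensor_def Let_def)

lemma trep_tensor:
  assumes I: "weil_ideal I" and t: "t \<in> pts (tensor X I)"
  shows trep_mor: "trep t \<in> mor euclid X" and tcls_trep: "tcls X I (trep t) = t"
proof -
  obtain f where f: "f \<in> mor euclid X" "t = tcls X I f" using t by (auto simp: pts_tensor)
  then have "f \<in> t" by (simp add: tcls_def weil_ideal_zero[OF I])
  then have "trep t \<in> tcls X I f" unfolding trep_def f(2)[symmetric] by (rule someI[of "\<lambda>f. f \<in> t"])
  then show "trep t \<in> mor euclid X" "tcls X I (trep t) = t"
    unfolding f(2) using tcls_eqI[OF I, of X f "trep (tcls X I f)"] by (auto simp: tcls_def[of X I f] f(2))
qed

lemma trep_tcls_diff:
  assumes I: "weil_ideal I" and f: "f \<in> mor euclid X" and h: "h \<in> smooth_functions X"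
  shows "(\<lambda>v. h (f v) - h (trep (tcls X I f) v)) \<in> I"
proof -
  have "f \<in> tcls X I f" using f by (simp add: tcls_def weil_ideal_zero[OF I])
  then have "trep (tcls X I f) \<in> tcls X I f" unfolding trep_def by (rule someI[of "\<lambda>g. g \<in> tcls X I f"])
  with h show ?thesis by (simp add: tcls_def)
qed

text \<open>The extensionality of \<open>mor\<close> is dropped, so that unrestricted maps such as
  \<open>fst\<close>, \<open>lower\<close> and the inclusion of a fibre qualify.\<close>

definition smooth_map :: "'a fspace \<Rightarrow> 'b fspace \<Rightarrow> ('a \<Rightarrow> 'b) \<Rightarrow> bool" where
  "smooth_map X Y \<phi> \<longleftrightarrow> (\<forall>x\<in>pts X. \<phi> x \<in> pts Y) \<and> (\<forall>c\<in>curves X. \<phi> \<circ> c \<in> curves Y)"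

lemma mor_imp_smooth_map: "\<phi> \<in> mor X Y \<Longrightarrow> smooth_map X Y \<phi>"
  by (auto simp: mor_def smooth_map_def)

lemma smooth_map_comp_mor:
  "smooth_map X Y \<phi> \<Longrightarrow> f \<in> mor (euclid :: 'k::euclidean_space fspace) X \<Longrightarrow> \<phi> \<circ> f \<in> mor euclid Y"
  by (auto simp: mor_def smooth_map_def euclid_def comp_assoc)

lemma smooth_function_comp:
  assumes "froelicher X" and \<phi>: "smooth_map X Y \<phi>" and h: "h \<in> smooth_functions Y"
  shows "restrict (h \<circ> \<phi>) (pts X) \<in> smooth_functions X"
proof -
  have "smooth (restrict (h \<circ> \<phi>) (pts X) \<circ> c)" if c: "c \<in> curves X" for c
  proof -
    have "range c \<subseteq> pts X" using c froelicherD[OF assms(1)] by blast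
    then have "restrict (h \<circ> \<phi>) (pts X) \<circ> c = h \<circ> (\<phi> \<circ> c)"
      by (simp add: smooth_restrict_comp comp_assoc)
    with \<phi> h c show ?thesis by (auto simp: smooth_map_def mor_def euclid_def)
  qed
  then show ?thesis by (auto simp: mor_def euclid_def)
qed

text \<open>Composition with \<open>\<phi>\<close> turns test functions on Y into test functions on
  X, so the class does not depend on the representative picked by \<open>trep\<close>.\<close>

lemma tmap_tcls:
  assumes I: "weil_ideal I" and X: "froelicher X" and \<phi>: "smooth_map X Y \<phi>"
    and f: "f \<in> mor euclid X"
  shows "tmap Y I \<phi> (tcls X I f) = tcls Y I (\<phi> \<circ> f)"
  unfolding tmap_def
proof (rule tcls_eqI[OF I])
  fix h assume "h \<in> smooth_functions Y"
  from trep_tcls_diff[OF I f smooth_function_comp[OF X \<phi> this]]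
  have "(\<lambda>v. restrict (h \<circ> \<phi>) (pts X) (trep (tcls X I f) v) - restrict (h \<circ> \<phi>) (pts X) (f v)) \<in> I"
    by (rule weil_ideal_diff_commute[OF I])
  moreover have "trep (tcls X I f) \<in> mor euclid X"
    by (rule trep_mor[OF I]) (simp add: pts_tensor f)
  ultimately show "(\<lambda>v. h ((\<phi> \<circ> trep (tcls X I f)) v) - h ((\<phi> \<circ> f) v)) \<in> I"
    using f by (auto simp: mor_def euclid_def PiE_iff)
qed

lemma tpull_tcls:
  assumes I: "weil_ideal I" and J: "weil_ideal J" and f: "\<And>u. u \<in> I \<Longrightarrow> (\<lambda>v. u (f v)) \<in> J"
    and g: "g \<in> mor euclid X"
  shows "tpull X J f (tcls X I g) = tcls X J (g \<circ> f)"
  unfolding tpull_def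
proof (rule tcls_eqI[OF J])
  fix h assume "h \<in> smooth_functions X"
  from f[OF weil_ideal_diff_commute[OF I trep_tcls_diff[OF I g this]]]
  show "(\<lambda>v. h ((trep (tcls X I g) \<circ> f) v) - h ((g \<circ> f) v)) \<in> J" by simp
qed

context charted begin

lemma range_curve: "c \<in> curves X \<Longrightarrow> c r \<in> pts X"
  using curves_iff[of c] by blast

lemma froelicher: "froelicher X"
proof (rule froelicherI)
  fix c :: "real \<Rightarrow> 'a"
  assume c: "range c \<subseteq> pts X" "\<forall>h\<in>smooth_functions X. smooth (h \<circ> c)"
  have "smooth (\<lambda>r. \<kappa> (c r) i)" if i: "i \<in> B" for i
  proof -
    have "smooth (restrict (\<lambda>x. \<kappa> x i) (pts X) \<circ> c)"
      using c(2) coord_smooth_function[OF i] by (rule bspec)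
    moreover have "restrict (\<lambda>x. \<kappa> x i) (pts X) \<circ> c = (\<lambda>r. \<kappa> (c r) i)"
      unfolding smooth_restrict_comp[OF c(1)] by (simp add: o_def)
    ultimately show ?thesis by simp
  qed
  with c(1) show "c \<in> curves X" by (simp add: curves_iff)
qed (use curves_iff in blast)

lemma coord_trep_tcls:
  assumes I: "weil_ideal I" and f: "f \<in> mor (euclid :: 'k::euclidean_space fspace) X" and i: "i \<in> B"
  shows "(\<lambda>v. \<kappa> (f v) i - \<kappa> (trep (tcls X I f) v) i) \<in> I"
proof -
  have "trep (tcls X I f) \<in> mor euclid X"
    by (rule trep_mor[OF I]) (simp add: pts_tensor f)
  with trep_tcls_diff[OF I f coord_smooth_function[OF i]] f show ?thesis
    by (simp add: mor_euclid_iff)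
qed

lemma tbase_tcls:
  assumes I: "weil_ideal I" and f: "f \<in> mor (euclid :: 'k::euclidean_space fspace) X"
  shows "tbase (tcls X I f) = f 0"
proof -
  have "trep (tcls X I f) \<in> mor euclid X"
    by (rule trep_mor[OF I]) (simp add: pts_tensor f)
  moreover have "\<kappa> (f 0) i = \<kappa> (trep (tcls X I f) 0) i" if "i \<in> B" for i
    using weil_ideal_vanishes[OF I coord_trep_tcls[OF I f that]] by simp
  ultimately show ?thesis
    using f unfolding tbase_def by (intro coords_eqI) (auto simp: mor_euclid_iff)
qed

section \<open>Tangent vectors in coordinates\<close>

text \<open>The Boolean selects the velocity instead of the base point. Tangent coordinates are thus
  again indexed by a set, and the construction can be repeated on the tangent space.\<close>

definition tan_coord :: "(real, 'a) wclass \<Rightarrow> 'i \<times> bool \<Rightarrow> real" where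
  "tan_coord t = (\<lambda>(i, b). if b then deriv (\<lambda>d. \<kappa> (trep t d) i) 0 else \<kappa> (trep t 0) i)"

lemma tan_coord_tcls:
  assumes f: "f \<in> mor (euclid :: real fspace) X" and i: "i \<in> B"
  shows "tan_coord (tcls X ideal_D f) (i, False) = \<kappa> (f 0) i"
    and "tan_coord (tcls X ideal_D f) (i, True) = deriv (\<lambda>d. \<kappa> (f d) i) 0"
proof -
  define g where "g = trep (tcls X ideal_D f)"
  have g: "g \<in> mor euclid X" unfolding g_def
    by (rule trep_mor[OF weil_ideal_D]) (simp add: pts_tensor f)
  have "(\<lambda>v. \<kappa> (f v) i - \<kappa> (g v) i) \<in> ideal_D"
    unfolding g_def by (rule coord_trep_tcls[OF weil_ideal_D f i])
  moreover have "deriv (\<lambda>v. \<kappa> (f v) i - \<kappa> (g v) i) 0 = deriv (\<lambda>v. \<kappa> (f v) i) 0 - deriv (\<lambda>v. \<kappa> (g v) i) 0"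
    using f g i by (intro DERIV_imp_deriv DERIV_diff smooth_has_deriv) (auto simp: mor_euclid_iff)
  ultimately show "tan_coord (tcls X ideal_D f) (i, False) = \<kappa> (f 0) i"
    "tan_coord (tcls X ideal_D f) (i, True) = deriv (\<lambda>d. \<kappa> (f d) i) 0"
    by (auto simp: tan_coord_def ideal_D_iff g_def)
qed

lemma tcls_D_eq_iff:
  assumes f: "f \<in> mor (euclid :: real fspace) X" and g: "g \<in> mor euclid X"
  shows "tcls X ideal_D f = tcls X ideal_D g \<longleftrightarrow>
    (\<forall>i\<in>B. \<kappa> (f 0) i = \<kappa> (g 0) i \<and> deriv (\<lambda>d. \<kappa> (f d) i) 0 = deriv (\<lambda>d. \<kappa> (g d) i) 0)"
proof -
  have "(\<lambda>v. \<kappa> (f v) i - \<kappa> (g v) i) \<in> ideal_D \<longleftrightarrow>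
      \<kappa> (f 0) i = \<kappa> (g 0) i \<and> deriv (\<lambda>d. \<kappa> (f d) i) 0 = deriv (\<lambda>d. \<kappa> (g d) i) 0" if "i \<in> B" for i
  proof -
    have sm: "smooth (\<lambda>v. \<kappa> (f v) i)" "smooth (\<lambda>v. \<kappa> (g v) i)"
      using f g that by (auto simp: mor_euclid_iff)
    then have "deriv (\<lambda>v. \<kappa> (f v) i - \<kappa> (g v) i) 0 = deriv (\<lambda>v. \<kappa> (f v) i) 0 - deriv (\<lambda>v. \<kappa> (g v) i) 0"
      by (intro DERIV_imp_deriv DERIV_diff smooth_has_deriv)
    with sm show ?thesis by (auto simp: ideal_D_iff smooth_diff)
  qed
  then show ?thesis by (simp add: tcls_eq_iff[OF weil_ideal_D f g])
qed

definition affine_curve :: "('i \<Rightarrow> real) \<Rightarrow> ('i \<Rightarrow> real) \<Rightarrow> real \<Rightarrow> 'a" where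
  "affine_curve a w = (\<lambda>d. pt (\<lambda>i. a i + d * w i))"

definition tvec :: "('i \<Rightarrow> real) \<Rightarrow> ('i \<Rightarrow> real) \<Rightarrow> (real, 'a) wclass" where
  "tvec a w = tcls X ideal_D (affine_curve a w)"

lemma affine_curve_mor: "affine_curve a w \<in> mor euclid X"
  unfolding mor_euclid_iff affine_curve_def by (auto intro!: smooth_add smooth_mult)

lemma deriv_affine_real [simp]: "deriv (\<lambda>d. a + d * w) x = (w :: real)"
  by (rule DERIV_imp_deriv) (auto intro!: derivative_eq_intros)

lemma tvec_in [simp]: "tvec a w \<in> pts (tensor X ideal_D)"
  using affine_curve_mor by (simp add: tvec_def pts_tensor)

lemma tan_coord_tvec [simp]:
  "i \<in> B \<Longrightarrow> tan_coord (tvec a w) (i, False) = a i" "i \<in> B \<Longrightarrow> tan_coord (tvec a w) (i, True) = w i"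
  using tan_coord_tcls[OF affine_curve_mor, of i a w] by (auto simp: tvec_def affine_curve_def)

text \<open>Coordinates of classes are test functions for the quotient structure, so they are smooth
  along smooth curves. Conversely a curve with smooth coordinates is the image of a smooth
  two-parameter family of affine representatives.\<close>

lemma charted_tensor_D: "charted (tensor X ideal_D) (B \<times> UNIV) tan_coord"
proof
  show "finite (B \<times> (UNIV :: bool set))" using finite_coords by simp
  have inj: "t = t'" if t: "t \<in> pts (tensor X ideal_D)" "t' \<in> pts (tensor X ideal_D)"
    and eq: "\<And>j. j \<in> B \<times> UNIV \<Longrightarrow> tan_coord t j = tan_coord t' j" for t t'
  proof -
    note tr = trep_mor[OF weil_ideal_D t(1)] trep_mor[OF weil_ideal_D t(2)]
    have "tcls X ideal_D (trep t) = tcls X ideal_D (trep t')"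
      unfolding tcls_D_eq_iff[OF tr]
    proof
      fix i assume "i \<in> B"
      then show "\<kappa> (trep t 0) i = \<kappa> (trep t' 0) i \<and> deriv (\<lambda>d. \<kappa> (trep t d) i) 0 = deriv (\<lambda>d. \<kappa> (trep t' d) i) 0"
        using eq[of "(i, False)"] eq[of "(i, True)"] by (simp add: tan_coord_def)
    qed
    then show ?thesis using t by (simp add: tcls_trep[OF weil_ideal_D])
  qed
  have tv: "tan_coord (tvec (\<lambda>i. a (i, False)) (\<lambda>i. a (i, True))) j = a j" if "j \<in> B \<times> UNIV" for j a
    using that by (cases j; cases "snd j") auto
  show "\<exists>!t. t \<in> pts (tensor X ideal_D) \<and> (\<forall>j\<in>B \<times> UNIV. tan_coord t j = a j)" for a
    by (rule ex1I[of _ "tvec (\<lambda>i. a (i, False)) (\<lambda>i. a (i, True))"], use tv in force) (rule inj, use tv in auto)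
  fix c :: "real \<Rightarrow> (real, 'a) wclass"
  show "c \<in> curves (tensor X ideal_D) \<longleftrightarrow> range c \<subseteq> pts (tensor X ideal_D) \<and>
      (\<forall>j\<in>B \<times> UNIV. smooth (\<lambda>r. tan_coord (c r) j))"
  proof
    assume c: "c \<in> curves (tensor X ideal_D)"
    have "smooth ((\<lambda>t. tan_coord t j) \<circ> c)" if j: "j \<in> B \<times> UNIV" for j
    proof -
      obtain i b where ib: "j = (i, b)" "i \<in> B" using j by auto
      have "smooth (\<lambda>r. tan_coord (tcls X ideal_D (C r)) j)"
        if C: "case_prod C \<in> mor (euclid :: (real \<times> real) fspace) X" for C
      proof -
        have Cr: "C r \<in> mor euclid X" for r
          using C smooth_section_snd by (fastforce simp: mor_euclid_iff)
        have sm: "smooth (\<lambda>p :: real \<times> real. \<kappa> (case_prod C p) i)"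
          using C ib(2) by (auto simp: mor_euclid_iff)
        show ?thesis
          using smooth_section_fst[OF sm, of 0] smooth_section_fst[OF smooth_partial[OF sm], of 0]
          by (cases b) (simp_all add: ib tan_coord_tcls[OF Cr ib(2)])
      qed
      then show ?thesis using c by (simp add: tensor_def Let_def)
    qed
    with c show "range c \<subseteq> pts (tensor X ideal_D) \<and> (\<forall>j\<in>B \<times> UNIV. smooth (\<lambda>r. tan_coord (c r) j))"
      by (auto simp: tensor_def Let_def o_def)
  next
    assume c: "range c \<subseteq> pts (tensor X ideal_D) \<and> (\<forall>j\<in>B \<times> UNIV. smooth (\<lambda>r. tan_coord (c r) j))"
    define C where "C r = affine_curve (\<lambda>i. tan_coord (c r) (i, False)) (\<lambda>i. tan_coord (c r) (i, True))" for r
    have C: "case_prod C \<in> mor (euclid :: (real \<times> real) fspace) X"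
      unfolding mor_euclid_iff
    proof (intro conjI allI ballI)
      fix i assume i: "i \<in> B"
      then have s: "smooth (\<lambda>r. tan_coord (c r) (i, b))" for b using c by auto
      have "smooth (\<lambda>p :: real \<times> real. tan_coord (c (fst p)) (i, False) + snd p * tan_coord (c (fst p)) (i, True))"
        by (intro smooth_add smooth_mult smooth_compose[OF s] smooth_fst smooth_snd smooth_ident)
      then show "smooth (\<lambda>p :: real \<times> real. \<kappa> (case_prod C p) i)"
        using i by (simp add: C_def affine_curve_def case_prod_unfold)
    qed (auto simp: C_def affine_curve_def)
    have cC: "c = (\<lambda>r. tcls X ideal_D (C r))"
    proof
      fix r
      show "c r = tcls X ideal_D (C r)"
        unfolding C_def tvec_def[symmetric]
        by (rule inj[OF _ tvec_in tv[symmetric]]) (use c in auto)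
    qed
    show "c \<in> curves (tensor X ideal_D)"
    proof -
      have "smooth (h \<circ> c)" if "\<forall>C. case_prod C \<in> mor (euclid :: (real \<times> real) fspace) X \<longrightarrow> smooth (\<lambda>r. h (tcls X ideal_D (C r)))"
        for h :: "(real, 'a) wclass \<Rightarrow> real"
        using that C by (subst cC) (simp add: o_def)
      with c show ?thesis by (simp add: tensor_def Let_def)
    qed
  qed
qed

lemma tvec_eqI:
  assumes "t \<in> pts (tensor X ideal_D)" "\<And>i. i \<in> B \<Longrightarrow> tan_coord t (i, False) = a i"
    "\<And>i. i \<in> B \<Longrightarrow> tan_coord t (i, True) = w i"
  shows "t = tvec a w"
proof (rule charted.coords_eqI[OF charted_tensor_D assms(1) tvec_in])
  fix j assume "j \<in> B \<times> (UNIV :: bool set)"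
  then show "tan_coord t j = tan_coord (tvec a w) j"
    using assms(2,3) by (cases j; cases "snd j") auto
qed

lemma tbase_tvec: "x \<in> pts X \<Longrightarrow> tbase (tvec (\<kappa> x) w) = x"
  unfolding tvec_def tbase_tcls[OF weil_ideal_D affine_curve_mor]
  by (rule coords_eqI) (auto simp: affine_curve_def)

lemma tbase_in: "weil_ideal I \<Longrightarrow> t \<in> pts (tensor X I) \<Longrightarrow> tbase t \<in> pts X"
  using trep_mor[of I t X] by (auto simp: tbase_def mor_euclid_iff)

lemma tan_coord_False: "tan_coord t (i, False) = \<kappa> (tbase t) i"
  by (simp add: tan_coord_def tbase_def)

text \<open>A is a graph: on it the coordinates outside B' are smooth functions \<open>e\<close> of
  those in B'. Fibres, with constant base coordinates, and fibre products over the base are of this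
  kind.\<close>

lemma charted_subspace:
  assumes "B' \<subseteq> B"
    and A: "\<And>x. x \<in> pts X \<Longrightarrow> x \<in> A \<longleftrightarrow> (\<forall>i\<in>B - B'. \<kappa> x i = e i (\<kappa> x))"
    and e_cong: "\<And>i a a'. i \<in> B - B' \<Longrightarrow> (\<And>j. j \<in> B' \<Longrightarrow> a j = a' j) \<Longrightarrow> e i a = e i a'"
    and e_smooth: "\<And>i (a :: real \<Rightarrow> 'i \<Rightarrow> real). i \<in> B - B' \<Longrightarrow> (\<And>j. j \<in> B' \<Longrightarrow> smooth (\<lambda>r. a r j)) \<Longrightarrow> smooth (\<lambda>r. e i (a r))"
  shows "charted (subspace_on X A) B' \<kappa>"
proof
  show "finite B'" using assms(1) finite_coords finite_subset by blast
  show "\<exists>!x. x \<in> pts (subspace_on X A) \<and> (\<forall>i\<in>B'. \<kappa> x i = a i)" for a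
  proof (rule ex1I)
    define x where "x = pt (\<lambda>i. if i \<in> B' then a i else e i a)"
    have x: "\<kappa> x i = a i" if "i \<in> B'" for i using that assms(1) by (auto simp: x_def)
    have "\<kappa> x i = e i (\<kappa> x)" if "i \<in> B - B'" for i
      using that e_cong[OF that, of "\<kappa> x" a] x by (simp add: x_def)
    then show "x \<in> pts (subspace_on X A) \<and> (\<forall>i\<in>B'. \<kappa> x i = a i)"
      using x A[of x] by (simp add: subspace_on_def x_def)
    fix y assume y: "y \<in> pts (subspace_on X A) \<and> (\<forall>i\<in>B'. \<kappa> y i = a i)"
    then have y': "y \<in> pts X" "\<And>i. i \<in> B - B' \<Longrightarrow> \<kappa> y i = e i (\<kappa> y)"
      using A by (auto simp: subspace_on_def)
    have "\<kappa> y i = e i a" if "i \<in> B - B'" for i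
      using y'(2)[OF that] e_cong[OF that, of "\<kappa> y" a] y by simp
    with y y'(1) show "y = x" by (intro coords_eqI) (auto simp: x_def)
  qed
  fix c :: "real \<Rightarrow> 'a"
  show "c \<in> curves (subspace_on X A) \<longleftrightarrow>
      range c \<subseteq> pts (subspace_on X A) \<and> (\<forall>i\<in>B'. smooth (\<lambda>r. \<kappa> (c r) i))"
  proof
    assume "c \<in> curves (subspace_on X A)"
    then show "range c \<subseteq> pts (subspace_on X A) \<and> (\<forall>i\<in>B'. smooth (\<lambda>r. \<kappa> (c r) i))"
      using assms(1) by (auto simp: subspace_on_def curves_iff)
  next
    assume c: "range c \<subseteq> pts (subspace_on X A) \<and> (\<forall>i\<in>B'. smooth (\<lambda>r. \<kappa> (c r) i))"
    have "smooth (\<lambda>r. \<kappa> (c r) i)" if i: "i \<in> B" for i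
    proof (cases "i \<in> B'")
      case False
      then have i': "i \<in> B - B'" using i by simp
      have "\<kappa> (c r) i = e i (\<kappa> (c r))" for r
        using A[of "c r"] c i' by (auto simp: subspace_on_def)
      with e_smooth[OF i', of "\<lambda>r. \<kappa> (c r)"] c show ?thesis by simp
    qed (use c in simp)
    with c show "c \<in> curves (subspace_on X A)" by (auto simp: subspace_on_def curves_iff)
  qed
qed

end

lemma charted_prod:
  fixes X :: "'a fspace" and Y :: "'c fspace"
  assumes "charted X B \<kappa>" "charted Y C \<kappa>'"
  shows "charted (prod_space X Y :: ('a \<times> 'c) fspace) (B <+> C) (\<lambda>(x, y). case_sum (\<kappa> x) (\<kappa>' y))"
proof -
  interpret X: charted X B \<kappa> by fact
  interpret Y: charted Y C \<kappa>' by fact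
  show ?thesis
  proof
    show "finite (B <+> C)" using X.finite_coords Y.finite_coords by simp
    show "\<exists>!z. z \<in> pts (prod_space X Y) \<and> (\<forall>i\<in>B <+> C. (case z of (x, y) \<Rightarrow> case_sum (\<kappa> x) (\<kappa>' y)) i = a i)" for a
    proof (rule ex1I[of _ "(X.pt (a \<circ> Inl), Y.pt (a \<circ> Inr))"])
      fix z assume z: "z \<in> pts (prod_space X Y) \<and> (\<forall>i\<in>B <+> C. (case z of (x, y) \<Rightarrow> case_sum (\<kappa> x) (\<kappa>' y)) i = a i)"
      obtain x y where xy: "z = (x, y)" by force
      have "\<kappa> x i = a (Inl i)" if "i \<in> B" for i
        using z that by (auto simp: xy dest: bspec[of _ _ "Inl i"])
      moreover have "\<kappa>' y i = a (Inr i)" if "i \<in> C" for i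
        using z that by (auto simp: xy dest: bspec[of _ _ "Inr i"])
      ultimately show "z = (X.pt (a \<circ> Inl), Y.pt (a \<circ> Inr))"
        using z by (auto simp: xy prod_space_def intro!: X.coords_eqI Y.coords_eqI)
    qed (auto simp: prod_space_def)
    fix c :: "real \<Rightarrow> 'a \<times> 'c"
    have 1: "(\<forall>i\<in>B <+> C. smooth (\<lambda>r. (case c r of (x, y) \<Rightarrow> case_sum (\<kappa> x) (\<kappa>' y)) i)) \<longleftrightarrow>
        (\<forall>i\<in>B. smooth (\<lambda>r. \<kappa> ((fst \<circ> c) r) i)) \<and> (\<forall>i\<in>C. smooth (\<lambda>r. \<kappa>' ((snd \<circ> c) r) i))"
      by (simp add: Plus_def ball_Un case_prod_unfold)
    have 2: "range c \<subseteq> pts (prod_space X Y) \<longleftrightarrow> range (fst \<circ> c) \<subseteq> pts X \<and> range (snd \<circ> c) \<subseteq> pts Y"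
      by (auto simp: prod_space_def image_subset_iff mem_Times_iff)
    have 3: "c \<in> curves (prod_space X Y) \<longleftrightarrow> fst \<circ> c \<in> curves X \<and> snd \<circ> c \<in> curves Y"
      by (simp add: prod_space_def)
    show "c \<in> curves (prod_space X Y) \<longleftrightarrow> range c \<subseteq> pts (prod_space X Y) \<and>
        (\<forall>i\<in>B <+> C. smooth (\<lambda>r. (case c r of (x, y) \<Rightarrow> case_sum (\<kappa> x) (\<kappa>' y)) i))"
      unfolding 1 2 3 X.curves_iff Y.curves_iff by blast
  qed
qed

lemma charted_euclid_vec: "charted (euclid :: (real ^ 'p::finite) fspace) UNIV (\<lambda>x i. x $ i)"
proof
  show "\<exists>!x. x \<in> pts (euclid :: (real ^ 'p) fspace) \<and> (\<forall>i\<in>UNIV. x $ i = a i)" for a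
    by (rule ex1I[of _ "\<chi> i. a i"]) (simp_all add: euclid_def vec_eq_iff)
  show "c \<in> curves (euclid :: (real ^ 'p) fspace) \<longleftrightarrow>
      range c \<subseteq> pts (euclid :: (real ^ 'p) fspace) \<and> (\<forall>i\<in>UNIV. smooth (\<lambda>r. c r $ i))" for c
    unfolding euclid_def by simp (rule smooth_vec_iff)
qed simp

subsection \<open>Tangent vectors of Euclidean space\<close>

interpretation vec: charted "euclid :: (real ^ 'p::finite) fspace" UNIV "\<lambda>x i. x $ i"
  by (rule charted_euclid_vec)

lemma pts_euclid [simp]: "pts euclid = UNIV"
  and curves_euclid [simp]: "curves euclid = {c. smooth c}"
  by (simp_all add: euclid_def)

definition vtan :: "real ^ 'p::finite \<Rightarrow> real ^ 'p \<Rightarrow> (real, real ^ 'p) wclass" where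
  "vtan x v = tcls euclid ideal_D (\<lambda>\<delta>. x + \<delta> *\<^sub>R v)"

lemma line_mor: "(\<lambda>\<delta>. x + \<delta> *\<^sub>R v) \<in> mor (euclid :: real fspace) (euclid :: (real ^ 'p::finite) fspace)"
  unfolding vec.mor_euclid_iff by (auto intro!: smooth_add smooth_mult)

lemma vtan_eq_tvec: "vtan x v = vec.tvec (($) x) (($) v)"
proof -
  have "vec.affine_curve (($) x) (($) v) = (\<lambda>\<delta>. x + \<delta> *\<^sub>R v)"
    unfolding vec.affine_curve_def
    by (rule ext, rule vec.coords_eqI) simp_all
  then show ?thesis by (simp add: vtan_def vec.tvec_def)
qed

lemma tan_coord_vtan [simp]:
  "vec.tan_coord (vtan x v) (i, False) = x $ i" "vec.tan_coord (vtan x v) (i, True) = v $ i"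
  by (simp_all add: vtan_eq_tvec)

lemma vtan_in_tensor [simp]: "vtan x v \<in> pts (tensor euclid ideal_D)"
  by (simp add: vtan_eq_tvec)

lemma tbase_vtan [simp]: "tbase (vtan x v) = x"
  unfolding vtan_def vec.tbase_tcls[OF weil_ideal_D line_mor] by simp

lemma vtan_inject: "vtan x v = vtan x' v' \<longleftrightarrow> x = x' \<and> v = v'"
  by (metis tan_coord_vtan vec_eq_iff)

lemma velocity_vtan [simp]: "velocity (vtan x v) = v"
  unfolding velocity_def tbase_vtan vtan_def[symmetric]
  by (rule the_equality) (auto simp: vtan_inject)

lemma vtan_cases:
  assumes "t \<in> pts (tensor euclid ideal_D)"
  shows "t = vtan (tbase t) (velocity t)"
proof -
  define v where "v = (\<chi> i. vec.tan_coord t (i, True))"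
  have "t = vtan (tbase t) v"
    unfolding vtan_eq_tvec by (rule vec.tvec_eqI[OF assms]) (auto simp: v_def vec.tan_coord_False)
  then show ?thesis using velocity_vtan by metis
qed

lemma pts_fibre: "t \<in> pts (fibre X I x) \<longleftrightarrow> t \<in> pts (tensor X I) \<and> tbase t = x"
  by (simp add: fibre_def subspace_on_def)

lemma curves_fibre: "c \<in> curves (fibre X I x) \<longleftrightarrow> c \<in> curves (tensor X I) \<and> (\<forall>r. tbase (c r) = x)"
  by (auto simp: fibre_def subspace_on_def)

lemma vtan_in_fibre [simp]: "vtan x v \<in> pts (fibre euclid ideal_D x)"
  by (simp add: pts_fibre)

lemma vtan_fibre_cases: "t \<in> pts (fibre euclid ideal_D x) \<Longrightarrow> t = vtan x (velocity t)"
  using vtan_cases[of t] by (simp add: pts_fibre)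

lemma curves_tensor_vec_iff:
  "c \<in> curves (tensor (euclid :: (real ^ 'p::finite) fspace) ideal_D) \<longleftrightarrow>
     range c \<subseteq> pts (tensor euclid ideal_D) \<and> smooth (\<lambda>r. tbase (c r)) \<and> smooth (\<lambda>r. velocity (c r))"
proof -
  interpret T: charted "tensor (euclid :: (real ^ 'p) fspace) ideal_D" "UNIV \<times> UNIV" vec.tan_coord
    by (rule vec.charted_tensor_D)
  have "(\<forall>j\<in>UNIV \<times> UNIV. smooth (\<lambda>r. vec.tan_coord (c r) j)) \<longleftrightarrow>
      smooth (\<lambda>r. tbase (c r)) \<and> smooth (\<lambda>r. velocity (c r))" if "range c \<subseteq> pts (tensor euclid ideal_D)"
  proof -
    have c: "c r = vtan (tbase (c r)) (velocity (c r))" for r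
      using that by (intro vtan_cases) auto
    have 1: "vec.tan_coord (c r) (i, False) = tbase (c r) $ i" "vec.tan_coord (c r) (i, True) = velocity (c r) $ i" for r i
      by (subst c, simp)+
    show ?thesis
      unfolding smooth_vec_iff[of "\<lambda>r. tbase (c r)"] smooth_vec_iff[of "\<lambda>r. velocity (c r)"] 1[symmetric]
      by (auto simp: all_bool_eq) 
  qed
  then show ?thesis unfolding T.curves_iff by blast
qed

lemma vtan_curve:
  "smooth x \<Longrightarrow> smooth v \<Longrightarrow> (\<lambda>r. vtan (x r) (v r)) \<in> curves (tensor euclid ideal_D)"
  unfolding curves_tensor_vec_iff by auto

text \<open>Differentiating f (t v) = t f v at t = 0 identifies f with its own derivative at
  0.\<close>

lemma homogeneous_smooth_imp_linear:
  fixes f :: "'a::euclidean_space \<Rightarrow> real"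
  assumes "smooth f" and hom: "\<And>\<alpha> v. f (\<alpha> *\<^sub>R v) = \<alpha> * f v"
  shows "linear f"
proof -
  have f0: "f 0 = 0" using hom[of 0 0] by simp
  obtain f' where f': "(f has_derivative f') (at 0)"
    using assms(1) Ck_SucD(1)[of 0 f 0] unfolding smooth_def by blast
  have "f' v = f v" for v
  proof -
    have "((\<lambda>t. f (t *\<^sub>R v)) has_derivative (\<lambda>t. f' (t *\<^sub>R v))) (at (0::real))"
      by (rule has_derivative_compose[of "\<lambda>t. t *\<^sub>R v"]) (use f' in \<open>auto intro!: derivative_eq_intros\<close>)
    moreover have "((\<lambda>t. f (t *\<^sub>R v)) has_derivative (\<lambda>t. t * f v)) (at (0::real))"
      unfolding hom by (auto intro!: derivative_eq_intros)
    ultimately have "(\<lambda>t. f' (t *\<^sub>R v)) = (\<lambda>t. t * f v)" by (rule has_derivative_unique)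
    from fun_cong[OF this, of 1] show ?thesis by simp
  qed
  then have "f' = f" by blast
  with has_derivative_linear[OF f'] show ?thesis by simp
qed


subsection \<open>Families of curves and the iterated tensor products\<close>

context charted begin

lemma mor_curry:
  assumes "(\<lambda>p. H (fst p) (snd p)) \<in> mor (euclid :: (real \<times> real) fspace) X"
  shows "H e \<in> mor euclid X"
  unfolding mor_euclid_iff
proof (intro conjI allI ballI)
  have H: "\<And>p. H (fst p) (snd p) \<in> pts X" "\<And>i. i \<in> B \<Longrightarrow> smooth (\<lambda>p :: real \<times> real. \<kappa> (H (fst p) (snd p)) i)"
    using assms by (auto simp: mor_euclid_iff)
  show "H e d \<in> pts X" for d using H(1)[of "(e, d)"] by simp
  show "smooth (\<lambda>d. \<kappa> (H e d) i)" if "i \<in> B" for i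
    using smooth_section_snd[OF H(2)[OF that], of e] by simp
qed

lemma mor_tcls_family:
  assumes H: "(\<lambda>p. H (fst p) (snd p)) \<in> mor (euclid :: (real \<times> real) fspace) X"
  shows "(\<lambda>e. tcls X ideal_D (H e)) \<in> mor (euclid :: real fspace) (tensor X ideal_D)"
proof -
  interpret T: charted "tensor X ideal_D" "B \<times> UNIV" tan_coord by (rule charted_tensor_D)
  show ?thesis
    unfolding T.mor_euclid_iff
  proof (intro conjI allI ballI)
    show "tcls X ideal_D (H e) \<in> pts (tensor X ideal_D)" for e
      using mor_curry[OF H] by (simp add: pts_tensor)
    fix j assume "j \<in> B \<times> (UNIV :: bool set)"
    then obtain i b where j: "j = (i, b)" "i \<in> B" by auto
    then have sm: "smooth (\<lambda>p :: real \<times> real. \<kappa> (H (fst p) (snd p)) i)" using H by (simp add: mor_euclid_iff)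
    show "smooth (\<lambda>e. tan_coord (tcls X ideal_D (H e)) j)"
      using smooth_section_fst[OF sm, of 0] smooth_section_fst[OF smooth_partial[OF sm], of 0]
      by (cases b) (simp_all add: j tan_coord_tcls[OF mor_curry[OF H]])
  qed
qed

text \<open>The inner classes are determined by value and first derivative, and by the chart of the
  tangent space the outer congruence is tested on these coordinates separately.\<close>

lemma tcls_family_eq_iff:
  assumes I: "weil_ideal I"
    and H: "(\<lambda>p. H (fst p) (snd p)) \<in> mor (euclid :: (real \<times> real) fspace) X"
    and H': "(\<lambda>p. H' (fst p) (snd p)) \<in> mor (euclid :: (real \<times> real) fspace) X"
  shows "tcls (tensor X ideal_D) I (\<lambda>e. tcls X ideal_D (H e)) = tcls (tensor X ideal_D) I (\<lambda>e. tcls X ideal_D (H' e))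
    \<longleftrightarrow> (\<forall>i\<in>B. (\<lambda>e. \<kappa> (H e 0) i - \<kappa> (H' e 0) i) \<in> I \<and>
          (\<lambda>e. deriv (\<lambda>d. \<kappa> (H e d) i - \<kappa> (H' e d) i) 0) \<in> I)"
proof -
  interpret T: charted "tensor X ideal_D" "B \<times> UNIV" tan_coord by (rule charted_tensor_D)
  have "(\<forall>b. (\<lambda>e. tan_coord (tcls X ideal_D (H e)) (i, b) - tan_coord (tcls X ideal_D (H' e)) (i, b)) \<in> I) \<longleftrightarrow>
      (\<lambda>e. \<kappa> (H e 0) i - \<kappa> (H' e 0) i) \<in> I \<and> (\<lambda>e. deriv (\<lambda>d. \<kappa> (H e d) i - \<kappa> (H' e d) i) 0) \<in> I"
    if i: "i \<in> B" for i
  proof -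
    have "deriv (\<lambda>d. \<kappa> (H e d) i - \<kappa> (H' e d) i) 0 = deriv (\<lambda>d. \<kappa> (H e d) i) 0 - deriv (\<lambda>d. \<kappa> (H' e d) i) 0" for e
      using mor_curry[OF H, of e] mor_curry[OF H', of e] i
      by (intro DERIV_imp_deriv DERIV_diff smooth_has_deriv) (auto simp: mor_euclid_iff)
    then show ?thesis
      by (simp add: all_bool_eq tan_coord_tcls[OF mor_curry[OF H] i] tan_coord_tcls[OF mor_curry[OF H'] i] conj_commute)
  qed
  then show ?thesis
    unfolding T.tcls_eq_iff[OF I mor_tcls_family[OF H] mor_tcls_family[OF H']] by auto
qed

lemma mor_reparametrize:
  fixes f :: "'k::euclidean_space \<Rightarrow> 'a" and g :: "'l::euclidean_space \<Rightarrow> 'k"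
  assumes f: "f \<in> mor euclid X" and g: "smooth g"
  shows "(\<lambda>p. f (g p)) \<in> mor euclid X"
  unfolding mor_euclid_iff
proof (intro conjI allI ballI)
  show "f (g p) \<in> pts X" for p using f by (simp add: mor_euclid_iff)
  show "smooth (\<lambda>p. \<kappa> (f (g p)) i)" if "i \<in> B" for i
    using f that smooth_compose[OF _ g, of "\<lambda>v. \<kappa> (f v) i"] by (simp add: mor_euclid_iff)
qed

lemma scale_curve_mor:
  assumes "t \<in> pts (tensor X ideal_D)"
  shows "(\<lambda>p :: real \<times> real. trep t (fst p * snd p)) \<in> mor euclid X"
  by (rule mor_reparametrize[OF trep_mor[OF weil_ideal_D assms]])
    (intro smooth_mult smooth_fst smooth_snd smooth_ident)

text \<open>Both sides come from (d, e) |-> t (e d), read as a family in e whose member at e is t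
  scaled by e. The left side uses an arbitrary representative, and \<open>ideal_DDm_imp\<close>
  absorbs the difference.\<close>

lemma outer2_tpull_mu:
  assumes t: "t \<in> pts (tensor X ideal_D)"
  shows "outer2 X (ideal_Dm m) ideal_D (tpull X (ideal_DDm m) mu t)
    = tcls (tensor X ideal_D) (ideal_Dm m) (\<lambda>e. scale X e t)"
proof -
  define G where "G = trep (tpull X (ideal_DDm m) mu t)"
  have g: "(\<lambda>p :: real \<times> real. trep t (fst p * snd p)) \<in> mor euclid X" by (rule scale_curve_mor[OF t])
  have gmu: "trep t \<circ> mu \<in> mor euclid X"
    using g by (simp add: mu_def o_def case_prod_unfold mult.commute)
  have G: "G \<in> mor euclid X"
    unfolding G_def tpull_def by (rule trep_mor[OF weil_ideal_DDm[of m]]) (simp add: pts_tensor gmu)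
  have G': "(\<lambda>p. G (snd p, fst p)) \<in> mor euclid X"
    by (rule mor_reparametrize[OF G]) (intro smooth_Pair smooth_fst smooth_snd smooth_ident)
  have "tcls (tensor X ideal_D) (ideal_Dm m) (\<lambda>e. tcls X ideal_D (\<lambda>d. trep t (e * d)))
      = tcls (tensor X ideal_D) (ideal_Dm m) (\<lambda>e. tcls X ideal_D (\<lambda>d. G (d, e)))"
    unfolding tcls_family_eq_iff[OF weil_ideal_Dm g G']
  proof
    fix i assume i: "i \<in> B"
    have "(\<lambda>p. \<kappa> ((trep t \<circ> mu) p) i - \<kappa> (G p) i) \<in> ideal_DDm m"
      unfolding G_def tpull_def by (rule coord_trep_tcls[OF weil_ideal_DDm gmu i])
    from ideal_DDm_imp[OF this]
    show "(\<lambda>e. \<kappa> (trep t (e * 0)) i - \<kappa> (G (0, e)) i) \<in> ideal_Dm m \<and>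
        (\<lambda>e. deriv (\<lambda>d. \<kappa> (trep t (e * d)) i - \<kappa> (G (d, e)) i) 0) \<in> ideal_Dm m"
      by (simp add: mu_def)
  qed
  then show ?thesis
    by (simp add: outer2_def G_def scale_def tpull_def o_def)
qed

lemma tvec_cong: "(\<And>i. i \<in> B \<Longrightarrow> w i = w' i) \<Longrightarrow> tvec a w = tvec a w'"
  by (rule tvec_eqI) simp_all

lemma scale_tvec: "scale X \<alpha> (tvec a w) = tvec a (\<lambda>i. \<alpha> * w i)"
proof -
  have D: "(\<lambda>v. u (\<alpha> * v)) \<in> ideal_D" if "u \<in> ideal_D" for u
    using that deriv_affine[of u 0 \<alpha>] smooth_compose[of u "\<lambda>v. \<alpha> * v"]
    by (simp add: ideal_D_iff smooth_mult)
  have "scale X \<alpha> (tvec a w) = tcls X ideal_D (affine_curve a w \<circ> (\<lambda>d. \<alpha> * d))"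
    unfolding scale_def tvec_def by (rule tpull_tcls[OF weil_ideal_D weil_ideal_D D affine_curve_mor])
  also have "affine_curve a w \<circ> (\<lambda>d. \<alpha> * d) = affine_curve a (\<lambda>i. \<alpha> * w i)"
    by (simp add: affine_curve_def fun_eq_iff mult_ac)
  finally show ?thesis by (simp add: tvec_def)
qed

lemma charted_fibre:
  assumes "x \<in> pts X"
  shows "charted (fibre X ideal_D x) (B \<times> {True}) tan_coord"
proof -
  interpret T: charted "tensor X ideal_D" "B \<times> UNIV" tan_coord by (rule charted_tensor_D)
  show ?thesis
    unfolding fibre_def
  proof (rule T.charted_subspace[where e="\<lambda>j a. \<kappa> x (fst j)"])
    fix t assume t: "t \<in> pts (tensor X ideal_D)"
    have "tbase t = x \<longleftrightarrow> (\<forall>i\<in>B. \<kappa> (tbase t) i = \<kappa> x i)"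
      using coords_eqI[OF tbase_in[OF weil_ideal_D t] assms] by blast
    moreover have "B \<times> UNIV - B \<times> {True} = (\<lambda>i. (i, False)) ` B" by (auto simp: UNIV_bool)
    ultimately show "t \<in> {t. tbase t = x} \<longleftrightarrow> (\<forall>j\<in>B \<times> UNIV - B \<times> {True}. tan_coord t j = \<kappa> x (fst j))"
      by (simp add: tan_coord_False)
  qed auto
qed

text \<open>Scaling does not move the base point, so the family of scaled vectors lives in the
  fibre. It is the only candidate for the \<open>THE\<close>, since the coordinates of the fibre are
  among those of the tangent space.\<close>

lemma mu_fibre_eq:
  assumes t: "t \<in> pts (fibre X ideal_D x)"
  shows "mu_fibre X x m t = tcls (fibre X ideal_D x) (ideal_Dm m) (\<lambda>e. scale X e t)"
    and "(\<lambda>e. scale X e t) \<in> mor euclid (fibre X ideal_D x)"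
proof -
  have t': "t \<in> pts (tensor X ideal_D)" "tbase t = x" using t by (auto simp: pts_fibre)
  have x: "x \<in> pts X" using tbase_in[OF weil_ideal_D t'(1)] t'(2) by simp
  interpret T: charted "tensor X ideal_D" "B \<times> UNIV" tan_coord by (rule charted_tensor_D)
  interpret Fx: charted "fibre X ideal_D x" "B \<times> {True}" tan_coord by (rule charted_fibre[OF x])
  have sc: "(\<lambda>e. scale X e t) \<in> mor euclid (tensor X ideal_D)"
    using mor_tcls_family[OF scale_curve_mor[OF t'(1)]] by (simp add: scale_def tpull_def o_def)
  have tv: "t = tvec (\<kappa> x) (\<lambda>i. tan_coord t (i, True))"
    by (rule tvec_eqI[OF t'(1)]) (auto simp: tan_coord_False t'(2))
  have "tbase (scale X e t) = x" for e
    by (subst tv) (simp only: scale_tvec tbase_tvec[OF x])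
  with sc show sc': "(\<lambda>e. scale X e t) \<in> mor euclid (fibre X ideal_D x)"
    unfolding Fx.mor_euclid_iff T.mor_euclid_iff by (auto simp: pts_fibre)
  have idm: "smooth_map (fibre X ideal_D x) (tensor X ideal_D) (\<lambda>s. s)"
    by (auto simp: smooth_map_def pts_fibre curves_fibre o_def)
  show "mu_fibre X x m t = tcls (fibre X ideal_D x) (ideal_Dm m) (\<lambda>e. scale X e t)"
    unfolding mu_fibre_def outer2_tpull_mu[OF t'(1)]
  proof (rule the_equality)
    show "tcls (fibre X ideal_D x) (ideal_Dm m) (\<lambda>e. scale X e t) \<in> pts (tensor (fibre X ideal_D x) (ideal_Dm m)) \<and>
        tmap (tensor X ideal_D) (ideal_Dm m) (\<lambda>s. s) (tcls (fibre X ideal_D x) (ideal_Dm m) (\<lambda>e. scale X e t)) =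
        tcls (tensor X ideal_D) (ideal_Dm m) (\<lambda>e. scale X e t)"
      using sc' by (simp add: pts_tensor tmap_tcls[OF weil_ideal_Dm Fx.froelicher idm sc'] o_def)
    fix z assume z: "z \<in> pts (tensor (fibre X ideal_D x) (ideal_Dm m)) \<and>
        tmap (tensor X ideal_D) (ideal_Dm m) (\<lambda>s. s) z = tcls (tensor X ideal_D) (ideal_Dm m) (\<lambda>e. scale X e t)"
    have tz: "trep z \<in> mor euclid (fibre X ideal_D x)" and zz: "tcls (fibre X ideal_D x) (ideal_Dm m) (trep z) = z"
      by (rule trep_mor[OF weil_ideal_Dm conjunct1[OF z]], rule tcls_trep[OF weil_ideal_Dm conjunct1[OF z]])
    have tz': "trep z \<in> mor euclid (tensor X ideal_D)"
      using smooth_map_comp_mor[OF idm tz] by (simp add: o_def)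
    have "tcls (tensor X ideal_D) (ideal_Dm m) (trep z) = tcls (tensor X ideal_D) (ideal_Dm m) (\<lambda>e. scale X e t)"
      using z by (simp add: tmap_def o_def)
    then have "tcls (fibre X ideal_D x) (ideal_Dm m) (trep z) = tcls (fibre X ideal_D x) (ideal_Dm m) (\<lambda>e. scale X e t)"
      unfolding T.tcls_eq_iff[OF weil_ideal_Dm tz' sc] Fx.tcls_eq_iff[OF weil_ideal_Dm tz sc'] by auto
    with zz show "z = tcls (fibre X ideal_D x) (ideal_Dm m) (\<lambda>e. scale X e t)" by simp
  qed
qed

end


subsection \<open>One-jets are linear maps\<close>

locale fibred = charted Y B \<kappa>
  for Y :: "'y fspace" and B :: "'b set" and \<kappa> :: "'y \<Rightarrow> 'b \<Rightarrow> real" +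
  fixes \<rho> :: "'y \<Rightarrow> real ^ 'p::finite" and \<iota> :: "'p \<Rightarrow> 'b"
  assumes \<iota>_in [simp]: "\<iota> i \<in> B"
    and \<rho>_coord: "y \<in> pts Y \<Longrightarrow> \<rho> y $ i = \<kappa> y (\<iota> i)"
begin

text \<open>The section condition on a jet in terms of its matrix: the rows of the base coordinates
  form the identity.\<close>

definition admissible :: "('b \<Rightarrow> 'p \<Rightarrow> real) \<Rightarrow> bool" where
  "admissible A \<longleftrightarrow> (\<forall>i j. A (\<iota> i) j = (if i = j then 1 else 0))"

definition jet_of :: "'y \<Rightarrow> ('b \<Rightarrow> 'p \<Rightarrow> real) \<Rightarrow> (real, real ^ 'p) wclass \<Rightarrow> (real, 'y) wclass" where
  "jet_of y A = (\<lambda>t \<in> pts (fibre euclid ideal_D (\<rho> y)). tvec (\<kappa> y) (\<lambda>b. \<Sum>i\<in>UNIV. A b i * velocity t $ i))"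

lemma jet_of_vtan [simp]:
  "jet_of y A (vtan (\<rho> y) v) = tvec (\<kappa> y) (\<lambda>b. \<Sum>i\<in>UNIV. A b i * v $ i)"
  by (simp add: jet_of_def)

lemma \<rho>_smooth_map: "smooth_map Y euclid \<rho>"
  unfolding smooth_map_def
proof (intro conjI ballI)
  fix c assume c: "c \<in> curves Y"
  have "smooth (\<lambda>r. \<rho> (c r) $ i)" for i
    using c range_curve[OF c] curves_iff[of c] by (simp add: \<rho>_coord)
  then have "smooth (\<rho> \<circ> c)" unfolding smooth_vec_iff[of "\<rho> \<circ> c"] by simp
  then show "\<rho> \<circ> c \<in> curves euclid" by simp
qed simp

lemma tmap_\<rho>_tvec:
  assumes y: "y \<in> pts Y"
  shows "tmap euclid ideal_D \<rho> (tvec (\<kappa> y) w) = vtan (\<rho> y) (\<chi> i. w (\<iota> i))"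
proof -
  have "\<rho> \<circ> affine_curve (\<kappa> y) w = (\<lambda>\<delta>. \<rho> y + \<delta> *\<^sub>R (\<chi> i. w (\<iota> i)))"
    by (simp add: fun_eq_iff vec_eq_iff affine_curve_def \<rho>_coord y)
  then show ?thesis
    by (simp add: tvec_def vtan_def tmap_tcls[OF weil_ideal_D froelicher \<rho>_smooth_map affine_curve_mor])
qed

lemma scale_vtan: "scale euclid \<alpha> (vtan x v) = vtan x (\<alpha> *\<^sub>R v)"
proof -
  have "($) (\<alpha> *\<^sub>R v) = (\<lambda>i. \<alpha> * v $ i)" by auto
  then show ?thesis by (simp add: vtan_eq_tvec vec.scale_tvec)
qed

lemma jet_of_in_fibre:
  assumes y: "y \<in> pts Y"
  shows "jet_of y A \<in> mor (fibre euclid ideal_D (\<rho> y)) (fibre Y ideal_D y)"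
proof -
  interpret T: charted "tensor Y ideal_D" "B \<times> UNIV" tan_coord by (rule charted_tensor_D)
  have "jet_of y A \<circ> c \<in> curves (fibre Y ideal_D y)" if c: "c \<in> curves (fibre euclid ideal_D (\<rho> y))" for c
  proof -
    have c': "c \<in> curves (tensor euclid ideal_D)" "\<And>r. tbase (c r) = \<rho> y" using c by (auto simp: curves_fibre)
    then have v: "smooth (\<lambda>r. velocity (c r))" and r: "range c \<subseteq> pts (tensor euclid ideal_D)"
      by (auto simp: curves_tensor_vec_iff)
    have "c r \<in> pts (fibre euclid ideal_D (\<rho> y))" for r
      using r c'(2) by (auto simp: pts_fibre)
    then have eq: "jet_of y A \<circ> c = (\<lambda>r. tvec (\<kappa> y) (\<lambda>b. \<Sum>i\<in>UNIV. A b i * velocity (c r) $ i))"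
      by (auto simp: jet_of_def)
    have "smooth (\<lambda>r. tan_coord (tvec (\<kappa> y) (\<lambda>b. \<Sum>i\<in>UNIV. A b i * velocity (c r) $ i)) j)"
      if "j \<in> B \<times> UNIV" for j
      using that by (cases j; cases "snd j")
        (auto intro!: smooth_sum smooth_mult smooth_const smooth_vec_nth v)
    then show ?thesis
      unfolding eq curves_fibre T.curves_iff by (auto simp: tbase_tvec y)
  qed
  then show ?thesis
    by (auto simp: mor_def jet_of_def pts_fibre tbase_tvec y)
qed

text \<open>The condition on \<open>D\<^sub>m\<close> in the definition of a 1-jet is a consequence of homogeneity.\<close>

lemma jet_of_in_jets1_at:
  assumes y: "y \<in> pts Y" and A: "admissible A"
  shows "jet_of y A \<in> jets1_at euclid Y \<rho> y"
  unfolding jets1_at_def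
proof (intro CollectI conjI ballI allI)
  show m: "jet_of y A \<in> mor (fibre euclid ideal_D (\<rho> y)) (fibre Y ideal_D y)"
    by (rule jet_of_in_fibre[OF y])
  fix t assume t: "t \<in> pts (fibre euclid ideal_D (\<rho> y))"
  define v where "v = velocity t"
  have tv: "t = vtan (\<rho> y) v" unfolding v_def by (rule vtan_fibre_cases[OF t])
  have "(\<chi> i. \<Sum>j\<in>UNIV. A (\<iota> i) j * v $ j) = v"
    using A by (simp add: vec_eq_iff admissible_def if_distrib[of "\<lambda>x. x * _"] cong: if_cong)
  then show "tmap euclid ideal_D \<rho> (jet_of y A t) = t"
    by (simp add: tv tmap_\<rho>_tvec y)
  show scale: "jet_of y A (scale euclid \<alpha> t) = scale Y \<alpha> (jet_of y A t)" for \<alpha>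
    by (simp add: tv scale_vtan scale_tvec sum_distrib_left mult_ac)
  fix m
  interpret Fx: charted "fibre (euclid :: (real ^ 'p) fspace) ideal_D (\<rho> y)" "UNIV \<times> {True}" vec.tan_coord
    by (rule vec.charted_fibre) simp
  have sm: "smooth_map (fibre euclid ideal_D (\<rho> y)) (tensor Y ideal_D) (jet_of y A)"
    using mor_imp_smooth_map[OF m] by (auto simp: smooth_map_def curves_fibre pts_fibre)
  have "tmap (tensor Y ideal_D) (ideal_Dm m) (jet_of y A) (mu_fibre euclid (\<rho> y) m t)
      = tcls (tensor Y ideal_D) (ideal_Dm m) (\<lambda>e. scale Y e (jet_of y A t))"
    unfolding vec.mu_fibre_eq(1)[OF t] tmap_tcls[OF weil_ideal_Dm Fx.froelicher sm vec.mu_fibre_eq(2)[OF t]]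
    by (simp add: o_def scale)
  also have "\<dots> = outer2 Y (ideal_Dm m) ideal_D (tpull Y (ideal_DDm m) mu (jet_of y A t))"
    by (rule outer2_tpull_mu[symmetric]) (simp add: tv)
  finally show "tmap (tensor Y ideal_D) (ideal_Dm m) (jet_of y A) (mu_fibre euclid (\<rho> y) m t)
      = outer2 Y (ideal_Dm m) ideal_D (tpull Y (ideal_DDm m) mu (jet_of y A t))" .
qed

text \<open>Boman's theorem makes the velocity components of F smooth in the argument; with
  homogeneity they are linear. The section condition forces the base rows to be the
  identity.\<close>

lemma jets1_at_cases:
  assumes y: "y \<in> pts Y" and F: "F \<in> jets1_at euclid Y \<rho> y"
  obtains A where "admissible A" "F = jet_of y A"
proof -
  interpret T: charted "tensor Y ideal_D" "B \<times> UNIV" tan_coord by (rule charted_tensor_D)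
  have m: "F \<in> mor (fibre euclid ideal_D (\<rho> y)) (fibre Y ideal_D y)"
    and sect: "\<And>t. t \<in> pts (fibre euclid ideal_D (\<rho> y)) \<Longrightarrow> tmap euclid ideal_D \<rho> (F t) = t"
    and hom: "\<And>t \<alpha>. t \<in> pts (fibre euclid ideal_D (\<rho> y)) \<Longrightarrow> F (scale euclid \<alpha> t) = scale Y \<alpha> (F t)"
    using F unfolding jets1_at_def by blast+
  define \<phi> where "\<phi> b v = tan_coord (F (vtan (\<rho> y) v)) (b, True)" for b v
  have Fin: "F (vtan (\<rho> y) v) \<in> pts (fibre Y ideal_D y)" for v
    using m vtan_in_fibre[of "\<rho> y" v] by (auto simp: mor_def)
  have F\<phi>: "F (vtan (\<rho> y) v) = tvec (\<kappa> y) (\<lambda>b. \<phi> b v)" for v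
    using Fin[of v] by (intro tvec_eqI) (auto simp: \<phi>_def tan_coord_False pts_fibre)
  have "smooth (\<phi> b)" if b: "b \<in> B" for b
  proof (rule smooth_alongI)
    fix c :: "real \<Rightarrow> real ^ 'p" assume "smooth c"
    then have "(\<lambda>r. vtan (\<rho> y) (c r)) \<in> curves (fibre euclid ideal_D (\<rho> y))"
      by (simp add: curves_fibre vtan_curve)
    with m have "F \<circ> (\<lambda>r. vtan (\<rho> y) (c r)) \<in> curves (tensor Y ideal_D)"
      by (auto simp: mor_def curves_fibre)
    with b show "smooth (\<lambda>r. \<phi> b (c r))" by (simp add: T.curves_iff \<phi>_def)
  qed
  moreover have "\<phi> b (\<alpha> *\<^sub>R v) = \<alpha> * \<phi> b v" if b: "b \<in> B" for b \<alpha> v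
    using hom[OF vtan_in_fibre, of \<alpha> v] unfolding scale_vtan F\<phi> scale_tvec
    using tan_coord_tvec(2)[OF b] by metis
  ultimately have lin: "linear (\<phi> b)" if "b \<in> B" for b
    using homogeneous_smooth_imp_linear that by blast
  define A where "A b i = \<phi> b (axis i 1)" for b i
  have \<phi>A: "\<phi> b v = (\<Sum>i\<in>UNIV. A b i * v $ i)" if "b \<in> B" for b v
  proof -
    have "\<phi> b v = \<phi> b (\<Sum>i\<in>UNIV. v $ i *\<^sub>R axis i 1)" using basis_expansion[of v] by (simp add: scalar_mult_eq_scaleR)
    also have "\<dots> = (\<Sum>i\<in>UNIV. A b i * v $ i)"
      by (simp add: linear_sum[OF lin[OF that]] linear_scale[OF lin[OF that]] A_def mult.commute)
    finally show ?thesis .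
  qed
  have "admissible A"
    unfolding admissible_def
  proof (intro allI)
    fix i j
    have "vtan (\<rho> y) (axis j 1) = vtan (\<rho> y) (\<chi> i. \<phi> (\<iota> i) (axis j 1))"
      using sect[OF vtan_in_fibre, of "axis j 1"] by (simp add: F\<phi> tmap_\<rho>_tvec y)
    then have "axis j 1 = (\<chi> i. \<phi> (\<iota> i) (axis j 1))" by (simp add: vtan_inject)
    then have "axis j 1 $ i = \<phi> (\<iota> i) (axis j 1)" by (metis vec_lambda_beta)
    then show "A (\<iota> i) j = (if i = j then 1 else 0)" by (auto simp: A_def axis_def)
  qed
  moreover have "F = jet_of y A"
  proof
    fix t
    show "F t = jet_of y A t"
    proof (cases "t \<in> pts (fibre euclid ideal_D (\<rho> y))")
      case True
      then have "t = vtan (\<rho> y) (velocity t)" by (rule vtan_fibre_cases)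
      then obtain v where t: "t = vtan (\<rho> y) v" by blast
      show ?thesis unfolding t F\<phi> jet_of_vtan by (rule tvec_cong) (rule \<phi>A)
    next
      case False
      \<comment> \<open>Both mappings are extensional, so off the fibre they agree by having the
        value \<open>undefined\<close>.\<close>
      have "F \<in> pts (fibre euclid ideal_D (\<rho> y)) \<rightarrow>\<^sub>E pts (fibre Y ideal_D y)"
        using m unfolding mor_def by blast
      from PiE_arb[OF this False] False show ?thesis by (simp add: jet_of_def)
    qed
  qed
  ultimately show ?thesis using that by blast
qed

definition jet_coeff :: "'y \<times> ((real, real ^ 'p) wclass \<Rightarrow> (real, 'y) wclass) \<Rightarrow> 'b \<Rightarrow> 'p \<Rightarrow> real" where
  "jet_coeff = (\<lambda>(y, F) b i. tan_coord (F (vtan (\<rho> y) (axis i 1))) (b, True))"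

lemma jet_coeff_jet_of:
  assumes "b \<in> B"
  shows "jet_coeff (y, jet_of y A) b i = A b i"
  using assms by (simp add: jet_coeff_def axis_def if_distrib cong: if_cong)

text \<open>The value on a tangent vector combines the matrix entries with the components of the
  velocity, so smooth entries give smooth values. Conversely the entries are read off from the
  values on constant coordinate directions, tested with g the identity.\<close>

lemma curves_jets1_iff:
  "c \<in> curves (jets1 euclid Y \<rho>) \<longleftrightarrow> range c \<subseteq> pts (jets1 euclid Y \<rho>) \<and> fst \<circ> c \<in> curves Y \<and>
     (\<forall>b\<in>B. \<forall>i. smooth (\<lambda>r. jet_coeff (c r) b i))"
proof -
  interpret T: charted "tensor Y ideal_D" "B \<times> UNIV" tan_coord by (rule charted_tensor_D)
  have "(\<forall>g t. smooth (g :: real \<Rightarrow> real) \<and> t \<in> curves (tensor euclid ideal_D) \<and>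
        (\<forall>r. tbase (t r) = \<rho> (fst (c (g r)))) \<longrightarrow>
        (\<lambda>r. snd (c (g r)) (t r)) \<in> curves (tensor Y ideal_D)) \<longleftrightarrow>
      (\<forall>b\<in>B. \<forall>i. smooth (\<lambda>r. jet_coeff (c r) b i))" (is "?L \<longleftrightarrow> ?R")
    if c: "range c \<subseteq> Sigma (pts Y) (jets1_at euclid Y \<rho>)" "fst \<circ> c \<in> curves Y" for c
  proof
    assume L: ?L
    show ?R
    proof (intro ballI allI)
      fix b i assume b: "b \<in> B"
      have "smooth (\<lambda>r. \<rho> (fst (c r)))"
        using \<rho>_smooth_map c(2) by (fastforce simp: smooth_map_def o_def)
      then have "(\<lambda>r. vtan (\<rho> (fst (c r))) (axis i 1)) \<in> curves (tensor euclid ideal_D)"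
        by (intro vtan_curve smooth_const)
      with L[rule_format, of "\<lambda>r. r" "\<lambda>r. vtan (\<rho> (fst (c r))) (axis i 1)"]
      have "(\<lambda>r. snd (c r) (vtan (\<rho> (fst (c r))) (axis i 1))) \<in> curves (tensor Y ideal_D)" by simp
      with b show "smooth (\<lambda>r. jet_coeff (c r) b i)"
        by (simp add: T.curves_iff jet_coeff_def case_prod_unfold)
    qed
  next
    assume R: ?R
    show ?L
    proof (intro allI impI, elim conjE)
      fix g :: "real \<Rightarrow> real" and t
      assume g: "smooth g" and t: "t \<in> curves (tensor euclid ideal_D)"
        and base: "\<forall>r. tbase (t r) = \<rho> (fst (c (g r)))"
      have v: "smooth (\<lambda>r. velocity (t r))" and tr: "range t \<subseteq> pts (tensor euclid ideal_D)"
        using t by (auto simp: curves_tensor_vec_iff)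
      have val: "snd (c (g r)) (t r) = tvec (\<kappa> (fst (c (g r)))) (\<lambda>b. \<Sum>i\<in>UNIV. jet_coeff (c (g r)) b i * velocity (t r) $ i)" for r
      proof -
        obtain y F where yF: "c (g r) = (y, F)" by force
        have "(y, F) \<in> Sigma (pts Y) (jets1_at euclid Y \<rho>)" using c(1) rangeI[of c "g r"] yF by auto
        then have y: "y \<in> pts Y" and F: "F \<in> jets1_at euclid Y \<rho> y" by auto
        obtain A where A: "F = jet_of y A" using jets1_at_cases[OF y F] by blast
        have "t r = vtan (\<rho> y) (velocity (t r))"
          using vtan_cases[of "t r"] tr base yF by auto
        then obtain w where w: "t r = vtan (\<rho> y) w" by blast
        show ?thesis unfolding yF A fst_conv snd_conv w jet_of_vtan velocity_vtan
          by (rule tvec_cong) (simp add: jet_coeff_jet_of)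
      qed
      have "smooth (\<lambda>r. tan_coord (snd (c (g r)) (t r)) j)" if j': "j \<in> B \<times> UNIV" for j
      proof -
        obtain b e where j: "j = (b, e)" "b \<in> B" using j' by auto
        have 1: "smooth (\<lambda>r. \<kappa> (fst (c (g r))) b)"
        proof -
          have "smooth (\<lambda>r. \<kappa> (fst (c r)) b)" using c(2) j(2) by (simp add: curves_iff)
          then show ?thesis by (rule smooth_compose[OF _ g])
        qed
        have 2: "smooth (\<lambda>r. jet_coeff (c (g r)) b i)" for i
        proof -
          have "smooth (\<lambda>r. jet_coeff (c r) b i)" using R j(2) by blast
          then show ?thesis by (rule smooth_compose[OF _ g])
        qed
        show ?thesis
          unfolding val j(1) using j(2) 1
          by (cases e) (auto intro!: smooth_sum smooth_mult 2 smooth_vec_nth v)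
      qed
      then show "(\<lambda>r. snd (c (g r)) (t r)) \<in> curves (tensor Y ideal_D)"
        by (auto simp: T.curves_iff val)
    qed
  qed
  then show ?thesis unfolding jets1_def Let_def by simp blast
qed

end

subsection \<open>The second-order tangent space\<close>

lemma ideal_DD_swap: "u \<in> ideal_DD \<Longrightarrow> (\<lambda>p. u (prod.swap p)) \<in> ideal_DD"
proof -
  assume u: "u \<in> ideal_DD"
  have "(\<lambda>p. u (prod.swap p)) \<in> ideal_DD \<and> smooth u"
    using u unfolding ideal_DD_def
  proof (induction rule: gen_ideal_induct)
    case zero show ?case by (rule gen_ideal_zero)
  next
    case (add f a s)
    have "smooth (\<lambda>p. a (prod.swap p))"
      unfolding prod.swap_def by (rule smooth_compose[OF add(3)]) (intro smooth_Pair smooth_fst smooth_snd smooth_ident)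
    moreover have "(\<lambda>p. s (prod.swap p)) \<in> {\<lambda>(d1, d2). d1 ^ 2, \<lambda>(d1, d2). d2 ^ 2}"
      using add(4) by (auto simp: fun_eq_iff)
    ultimately have "(\<lambda>p. a (prod.swap p) * s (prod.swap p)) \<in> ideal_DD"
      unfolding ideal_DD_def by (rule gen_ideal_generator)
    from weil_ideal_add[OF weil_ideal_DD _ this] add(1) show ?case by (simp add: ideal_DD_def)
  qed (auto intro!: smooth_case_prod smooth_power smooth_fst smooth_snd smooth_ident)
  then show ?thesis by simp
qed

lemma ideal_DD_axis: "u \<in> ideal_DD \<Longrightarrow> (\<lambda>d. u (d, 0)) \<in> ideal_D"
  using ideal_DD_iff[OF weil_ideal_smooth[OF weil_ideal_DD]] by blast

context charted begin

text \<open>The normal form of a class over D x D, with coordinates a0 + d1 a1 + d2 a2 + d1 d2 a12.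
  It is arranged as a tangent vector in d2 whose data are affine in d1, which is how
  \<open>outer1\<close> splits it.\<close>

definition quad :: "('i \<Rightarrow> real) \<Rightarrow> ('i \<Rightarrow> real) \<Rightarrow> ('i \<Rightarrow> real) \<Rightarrow> ('i \<Rightarrow> real) \<Rightarrow> (real \<times> real, 'a) wclass" where
  "quad a0 a1 a2 a12 = tcls X ideal_DD
     (\<lambda>p. affine_curve (\<lambda>i. a0 i + fst p * a1 i) (\<lambda>i. a2 i + fst p * a12 i) (snd p))"

lemma quad_mor:
  "(\<lambda>p. affine_curve (\<lambda>i. a0 i + fst p * a1 i) (\<lambda>i. a2 i + fst p * a12 i) (snd p)) \<in> mor euclid X"
  unfolding mor_euclid_iff affine_curve_def
  by (auto intro!: smooth_add smooth_mult smooth_fst smooth_snd)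

lemma quad_in [simp]: "quad a0 a1 a2 a12 \<in> pts (tensor X ideal_DD)"
  using quad_mor by (simp add: quad_def pts_tensor)

lemma tbase_quad: "tbase (quad a0 a1 a2 a12) = pt a0"
  unfolding quad_def tbase_tcls[OF weil_ideal_DD quad_mor] by (simp add: affine_curve_def)

lemma tpull_quad_axis: "tpull X ideal_D (\<lambda>d. (d, 0)) (quad a0 a1 a2 a12) = tvec a0 a1"
proof -
  have "tpull X ideal_D (\<lambda>d. (d, 0)) (quad a0 a1 a2 a12) = tcls X ideal_D
      ((\<lambda>p. affine_curve (\<lambda>i. a0 i + fst p * a1 i) (\<lambda>i. a2 i + fst p * a12 i) (snd p)) \<circ> (\<lambda>d. (d, 0)))"
    unfolding quad_def by (rule tpull_tcls[OF weil_ideal_DD weil_ideal_D _ quad_mor]) (rule ideal_DD_axis)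
  then show ?thesis by (simp add: tvec_def affine_curve_def o_def)
qed

lemma transpose2_quad: "transpose2 X (quad a0 a1 a2 a12) = quad a0 a2 a1 a12"
proof -
  have "transpose2 X (quad a0 a1 a2 a12) = tcls X ideal_DD
      ((\<lambda>p. affine_curve (\<lambda>i. a0 i + fst p * a1 i) (\<lambda>i. a2 i + fst p * a12 i) (snd p)) \<circ> prod.swap)"
    unfolding quad_def transpose2_def
    by (rule tpull_tcls[OF weil_ideal_DD weil_ideal_DD _ quad_mor]) (rule ideal_DD_swap)
  then show ?thesis by (simp add: quad_def affine_curve_def o_def algebra_simps)
qed

lemma outer1_tcls:
  assumes G: "G \<in> mor euclid X"
  shows "outer1 X ideal_D ideal_D (tcls X ideal_DD G) = tcls (tensor X ideal_D) ideal_D (\<lambda>e. tcls X ideal_D (\<lambda>d. G (e, d)))"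
proof -
  define G' where "G' = trep (tcls X ideal_DD G)"
  have G': "G' \<in> mor euclid X" unfolding G'_def
    by (rule trep_mor[OF weil_ideal_DD]) (simp add: pts_tensor G)
  have "tcls (tensor X ideal_D) ideal_D (\<lambda>e. tcls X ideal_D (\<lambda>d. G (e, d)))
      = tcls (tensor X ideal_D) ideal_D (\<lambda>e. tcls X ideal_D (\<lambda>d. G' (e, d)))"
  proof (subst tcls_family_eq_iff[OF weil_ideal_D])
    show "\<forall>i\<in>B. (\<lambda>e. \<kappa> (G (e, 0)) i - \<kappa> (G' (e, 0)) i) \<in> ideal_D \<and>
        (\<lambda>e. deriv (\<lambda>d. \<kappa> (G (e, d)) i - \<kappa> (G' (e, d)) i) 0) \<in> ideal_D"
    proof
      fix i assume "i \<in> B"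
      then have DD: "(\<lambda>p. \<kappa> (G p) i - \<kappa> (G' p) i) \<in> ideal_DD"
        unfolding G'_def by (rule coord_trep_tcls[OF weil_ideal_DD G])
      with ideal_DD_iff[OF weil_ideal_smooth[OF weil_ideal_DD DD]]
      show "(\<lambda>e. \<kappa> (G (e, 0)) i - \<kappa> (G' (e, 0)) i) \<in> ideal_D \<and>
          (\<lambda>e. deriv (\<lambda>d. \<kappa> (G (e, d)) i - \<kappa> (G' (e, d)) i) 0) \<in> ideal_D" by blast
    qed
  qed (use G G' in simp_all)
  then show ?thesis by (simp add: outer1_def G'_def)
qed

text \<open>By \<open>ideal_DD_iff\<close>, equality after splitting is exactly congruence modulo
  \<open>ideal_DD\<close> in each coordinate.\<close>

lemma outer1_inject:
  assumes w: "w \<in> pts (tensor X ideal_DD)" "w' \<in> pts (tensor X ideal_DD)"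
    and eq: "outer1 X ideal_D ideal_D w = outer1 X ideal_D ideal_D w'"
  shows "w = w'"
proof -
  note G = trep_mor[OF weil_ideal_DD w(1)] and G' = trep_mor[OF weil_ideal_DD w(2)]
  have G2: "(\<lambda>p. trep w (fst p, snd p)) \<in> mor euclid X" "(\<lambda>p. trep w' (fst p, snd p)) \<in> mor euclid X"
    using G G' by simp_all
  have "tcls X ideal_DD (trep w) = tcls X ideal_DD (trep w')"
    unfolding tcls_eq_iff[OF weil_ideal_DD G G']
  proof
    fix i assume i: "i \<in> B"
    have sm: "smooth (\<lambda>p. \<kappa> (trep w p) i - \<kappa> (trep w' p) i)"
      using G G' i by (intro smooth_diff) (auto simp: mor_euclid_iff)
    show "(\<lambda>p. \<kappa> (trep w p) i - \<kappa> (trep w' p) i) \<in> ideal_DD"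
      using eq[unfolded outer1_def tcls_family_eq_iff[OF weil_ideal_D G2]] i
      unfolding ideal_DD_iff[OF sm] by blast
  qed
  then show ?thesis by (simp add: tcls_trep[OF weil_ideal_DD] w)
qed

end

text \<open>Pairs a chart with the chart of its tangent space, so that the operations on tangent
  vectors are also available, under the prefix \<open>T\<close>, for tangent vectors of the tangent
  space.\<close>

locale charted2 = charted X B \<kappa> + T: charted "tensor X ideal_D" "B \<times> UNIV" tan_coord
  for X :: "'a fspace" and B :: "'i set" and \<kappa> :: "'a \<Rightarrow> 'i \<Rightarrow> real"
begin

lemma outer1_quad:
  "outer1 X ideal_D ideal_D (quad a0 a1 a2 a12)
    = T.tvec (\<lambda>(i, b). if b then a2 i else a0 i) (\<lambda>(i, b). if b then a12 i else a1 i)"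
proof -
  have "(\<lambda>e. tcls X ideal_D (\<lambda>d. affine_curve (\<lambda>i. a0 i + e * a1 i) (\<lambda>i. a2 i + e * a12 i) d))
      = T.affine_curve (\<lambda>(i, b). if b then a2 i else a0 i) (\<lambda>(i, b). if b then a12 i else a1 i)"
    unfolding T.affine_curve_def tvec_def[symmetric]
  proof (rule ext, rule T.coords_eqI)
    fix e j assume "j \<in> B \<times> (UNIV :: bool set)"
    then show "tan_coord (tvec (\<lambda>i. a0 i + e * a1 i) (\<lambda>i. a2 i + e * a12 i)) j =
        tan_coord (T.pt (\<lambda>j. (case j of (i, b) \<Rightarrow> if b then a2 i else a0 i) + e * (case j of (i, b) \<Rightarrow> if b then a12 i else a1 i))) j"
      by (cases j; cases "snd j") auto
  qed simp_all
  then show ?thesis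
    unfolding quad_def outer1_tcls[OF quad_mor] by (simp add: T.tvec_def)
qed

lemma outer1_in:
  assumes "w \<in> pts (tensor X ideal_DD)"
  shows "outer1 X ideal_D ideal_D w \<in> pts (tensor (tensor X ideal_D) ideal_D)"
proof -
  have "(\<lambda>p. trep w (fst p, snd p)) \<in> mor euclid X"
    using trep_mor[OF weil_ideal_DD assms] by simp
  from mor_tcls_family[OF this] show ?thesis
    by (simp add: outer1_def pts_tensor[of "tensor X ideal_D"])
qed

text \<open>A double tangent vector has four groups of coordinates, which are exactly the four
  coefficients of \<open>quad\<close>. Together with injectivity this inverts
  \<open>outer1\<close>.\<close>

lemma tvec_tvec_cases:
  assumes "s \<in> pts (tensor (tensor X ideal_D) ideal_D)"
  obtains a0 a1 a2 a12 where "s = outer1 X ideal_D ideal_D (quad a0 a1 a2 a12)"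
proof
  let ?t = "T.tan_coord s"
  show "s = outer1 X ideal_D ideal_D (quad (\<lambda>i. ?t ((i, False), False)) (\<lambda>i. ?t ((i, False), True))
      (\<lambda>i. ?t ((i, True), False)) (\<lambda>i. ?t ((i, True), True)))"
    unfolding outer1_quad by (rule T.tvec_eqI[OF assms]) auto
qed

lemma quad_cases:
  assumes "w \<in> pts (tensor X ideal_DD)"
  obtains a0 a1 a2 a12 where "w = quad a0 a1 a2 a12"
  using tvec_tvec_cases[OF outer1_in[OF assms]] outer1_inject[OF assms quad_in] by metis

lemma the_outer1_quad:
  "(THE w. w \<in> pts (tensor X ideal_DD) \<and> outer1 X ideal_D ideal_D w = outer1 X ideal_D ideal_D (quad a0 a1 a2 a12))
    = quad a0 a1 a2 a12"
  by (rule the_equality) (simp, rule outer1_inject, simp_all)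

lemma quad_eq_iff:
  "quad a0 a1 a2 a12 = quad b0 b1 b2 b12 \<longleftrightarrow>
    (\<forall>i\<in>B. a0 i = b0 i \<and> a1 i = b1 i \<and> a2 i = b2 i \<and> a12 i = b12 i)"
proof
  assume "quad a0 a1 a2 a12 = quad b0 b1 b2 b12"
  then have eq: "T.tan_coord (outer1 X ideal_D ideal_D (quad a0 a1 a2 a12)) j = T.tan_coord (outer1 X ideal_D ideal_D (quad b0 b1 b2 b12)) j" for j
    by simp
  show "\<forall>i\<in>B. a0 i = b0 i \<and> a1 i = b1 i \<and> a2 i = b2 i \<and> a12 i = b12 i"
  proof
    fix i assume "i \<in> B"
    then show "a0 i = b0 i \<and> a1 i = b1 i \<and> a2 i = b2 i \<and> a12 i = b12 i"
      using eq[of "((i, False), False)"] eq[of "((i, False), True)"] eq[of "((i, True), False)"] eq[of "((i, True), True)"]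
      by (simp add: outer1_quad)
  qed
next
  assume eq: "\<forall>i\<in>B. a0 i = b0 i \<and> a1 i = b1 i \<and> a2 i = b2 i \<and> a12 i = b12 i"
  have "outer1 X ideal_D ideal_D (quad a0 a1 a2 a12) = outer1 X ideal_D ideal_D (quad b0 b1 b2 b12)"
    unfolding outer1_quad by (rule T.tvec_eqI) (use eq in auto)
  then show "quad a0 a1 a2 a12 = quad b0 b1 b2 b12" by (intro outer1_inject) auto
qed

end

lemma (in charted) charted2: "charted2 X B \<kappa>"
  by (intro charted2.intro charted_axioms charted_tensor_D)


subsection \<open>Coordinates on the tower of jet spaces\<close>

type_synonym ('p, 'q) jindex = "'p + 'q \<times> 'p multiset"

definition jindex :: "nat \<Rightarrow> ('p::finite, 'q::finite) jindex set" where
  "jindex n = range Inl \<union> Inr ` (UNIV \<times> {A. size A \<le> n})"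

lemma Inl_jindex [simp]: "Inl i \<in> jindex n"
  and Inr_jindex [simp]: "Inr (j, A) \<in> jindex n \<longleftrightarrow> size A \<le> n"
  by (auto simp: jindex_def)

lemma jindex_mono: "b \<in> jindex n \<Longrightarrow> b \<in> jindex (Suc n)"
  by (auto simp: jindex_def)

lemma jindex_top_cases:
  assumes "b \<in> jindex (Suc n)" "b \<notin> jindex n"
  obtains j i C where "b = Inr (j, add_mset i C)" "size C = n"
proof -
  from assms obtain j A where A: "b = Inr (j, A)" by (cases b) auto
  with assms have "size A = Suc n" by simp
  with A that show ?thesis by (cases A) auto
qed

lemma finite_multisets_size: "finite {A :: 'p::finite multiset. size A \<le> n}"
proof (induction n)
  case (Suc n)
  have "{A :: 'p multiset. size A \<le> Suc n} \<subseteq> insert {#} (\<Union>i. add_mset i ` {A. size A \<le> n})"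
  proof
    fix A :: "'p multiset" assume "A \<in> {A. size A \<le> Suc n}"
    then show "A \<in> insert {#} (\<Union>i. add_mset i ` {A. size A \<le> n})" by (cases A) auto
  qed
  then show ?case using Suc by (auto intro: finite_subset)
qed simp

lemma finite_jindex: "finite (jindex n)"
  unfolding jindex_def by (auto intro!: finite_imageI finite_cartesian_product finite_multisets_size)

definition jcoord :: "('p::finite, 'q::finite) jcoords \<Rightarrow> ('p, 'q) jindex \<Rightarrow> real" where
  "jcoord z = case_sum (\<lambda>i. fst z $ i) (\<lambda>(j, A). snd z A $ j)"

lemma jcoord_simps [simp]: "jcoord z (Inl i) = fst z $ i" "jcoord z (Inr (j, A)) = snd z A $ j"
  by (simp_all add: jcoord_def)

definition of_jcoord :: "nat \<Rightarrow> (('p::finite, 'q::finite) jindex \<Rightarrow> real) \<Rightarrow> ('p, 'q) jcoords" where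
  "of_jcoord n a = (\<chi> i. a (Inl i), \<lambda>A. if size A \<le> n then \<chi> j. a (Inr (j, A)) else 0)"

lemma of_jcoord_in [simp]: "of_jcoord n a \<in> jet_coords n"
  by (simp add: of_jcoord_def jet_coords_def)

lemma jcoord_of_jcoord [simp]: "b \<in> jindex n \<Longrightarrow> jcoord (of_jcoord n a) b = a b"
  by (auto simp: of_jcoord_def jindex_def)

lemma jcoord_eqI:
  assumes "z \<in> jet_coords n" "z' \<in> jet_coords n" "\<And>b. b \<in> jindex n \<Longrightarrow> jcoord z b = jcoord z' b"
  shows "z = z'"
proof -
  have "fst z $ i = fst z' $ i" for i using assms(3)[of "Inl i"] by simp
  moreover have "snd z A $ j = snd z' A $ j" for A j
    using assms(1,2) assms(3)[of "Inr (j, A)"] by (cases "size A \<le> n") (auto simp: jet_coords_def)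
  ultimately show ?thesis by (simp add: prod_eq_iff vec_eq_iff fun_eq_iff)
qed

lemma truncate_jet_in [simp]: "truncate_jet n z \<in> jet_coords n"
  by (simp add: truncate_jet_def jet_coords_def case_prod_unfold)

lemma jcoord_truncate_jet [simp]: "b \<in> jindex n \<Longrightarrow> jcoord (truncate_jet n z) b = jcoord z b"
  by (auto simp: truncate_jet_def jindex_def case_prod_unfold)

lemma fst_truncate_jet [simp]: "fst (truncate_jet n z) = fst z"
  by (simp add: truncate_jet_def case_prod_unfold)

text \<open>\<open>direction a\<close> is the matrix whose columns span the plane that the coordinates \<open>a\<close> prescribe.\<close>

definition direction :: "(('p::finite, 'q::finite) jindex \<Rightarrow> real) \<Rightarrow> ('p, 'q) jindex \<Rightarrow> 'p \<Rightarrow> real" where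
  "direction a b i = (case b of Inl k \<Rightarrow> if k = i then 1 else 0 | Inr (j, A) \<Rightarrow> a (Inr (j, add_mset i A)))"

lemma direction_simps [simp]:
  "direction a (Inl k) i = (if k = i then 1 else 0)"
  "direction a (Inr (j, A)) i = a (Inr (j, add_mset i A))"
  by (simp_all add: direction_def)

lemma line_in [simp]: "line n z y \<delta> \<in> jet_coords n"
  by (simp add: line_def case_prod_unfold)

lemma jcoord_line:
  "b \<in> jindex n \<Longrightarrow> jcoord (line n z y \<delta>) b = jcoord z b + \<delta> * (\<Sum>i\<in>UNIV. direction (jcoord z) b i * y $ i)"
  by (auto simp: jindex_def line_def case_prod_unfold mult.commute if_distrib cong: if_cong)

lemma foot_theta_coords [simp]: "foot (theta_coords n z) = fst z"
  by (induction n arbitrary: z) (simp_all add: encode_def)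

lemma lower_theta_coords [simp]: "lower (theta_coords (Suc n) z) = theta_coords n (truncate_jet n z)"
  by (simp add: encode_def)

definition tower_coord :: "nat \<Rightarrow> ('p::finite, 'q::finite) tower \<Rightarrow> ('p, 'q) jindex \<Rightarrow> real" where
  "tower_coord n w = jcoord (inv_into (jet_coords n) (theta_coords n) w)"

text \<open>The first argument only makes the types \<open>'p\<close> and \<open>'q\<close> determined by the parameters of the
  locale below.\<close>

definition tower_ok :: "('p::finite \<times> 'q::finite) itself \<Rightarrow> nat \<Rightarrow> bool" where
  "tower_ok _ n \<longleftrightarrow>
     bij_betw (theta_coords n :: _ \<Rightarrow> ('p, 'q) tower) (jet_coords n) (pts (jets n)) \<and>
     (\<forall>c. c \<in> curves (jets n :: ('p, 'q) tower fspace) \<longleftrightarrow>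
        range c \<subseteq> pts (jets n) \<and> (\<forall>b\<in>jindex n. smooth (\<lambda>r. tower_coord n (c r) b)))"

locale tower =
  fixes ty :: "('p::finite \<times> 'q::finite) itself" and n :: nat
  assumes ok: "tower_ok ty n"
begin

abbreviation Jn :: "('p, 'q) tower fspace" where "Jn \<equiv> jets n"

lemma theta_bij: "bij_betw (theta_coords n) (jet_coords n) (pts Jn)"
  using ok by (simp add: tower_ok_def)

lemma theta_in [simp]: "z \<in> jet_coords n \<Longrightarrow> theta_coords n z \<in> pts Jn"
  using theta_bij bij_betwE by blast

lemma tower_coord_theta [simp]: "z \<in> jet_coords n \<Longrightarrow> tower_coord n (theta_coords n z :: ('p, 'q) tower) = jcoord z"
  using theta_bij by (simp add: tower_coord_def bij_betw_inv_into_left)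

lemma theta_cases:
  assumes "y \<in> pts Jn" obtains z where "z \<in> jet_coords n" "y = theta_coords n z"
  using assms theta_bij that unfolding bij_betw_def by blast

lemma charted_jets: "charted Jn (jindex n) (tower_coord n)"
proof
  show "finite (jindex n :: ('p, 'q) jindex set)" by (rule finite_jindex)
  show "\<exists>!x. x \<in> pts Jn \<and> (\<forall>i\<in>jindex n. tower_coord n x i = a i)" for a
  proof (rule ex1I[of _ "theta_coords n (of_jcoord n a)"])
    fix x assume x: "x \<in> pts Jn \<and> (\<forall>i\<in>jindex n. tower_coord n x i = a i)"
    then obtain z where z: "z \<in> jet_coords n" "x = theta_coords n z" using theta_cases by blast
    with x have "z = of_jcoord n a" by (intro jcoord_eqI[of z n]) auto
    with z show "x = theta_coords n (of_jcoord n a)" by simp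
  qed simp
  show "c \<in> curves Jn \<longleftrightarrow> range c \<subseteq> pts Jn \<and> (\<forall>i\<in>jindex n. smooth (\<lambda>r. tower_coord n (c r) i))" for c
    using ok by (simp add: tower_ok_def)
qed

sublocale fibred Jn "jindex n" "tower_coord n" foot Inl
proof (intro fibred.intro charted_jets fibred_axioms.intro)
  show "foot y $ i = tower_coord n y (Inl i)" if "y \<in> pts Jn" for y i
    by (rule theta_cases[OF that]) simp
qed simp

lemma admissible_direction: "admissible (direction a)"
  by (simp add: admissible_def)

lemma jet_of_cong: "(\<And>b i. b \<in> jindex n \<Longrightarrow> A b i = A' b i) \<Longrightarrow> jet_of y A = jet_of y A'"
  unfolding jet_of_def by (intro restrict_ext tvec_cong) simp

text \<open>\<open>theta_coords n\<close> is the inverse of the chart, so the line of the comparison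
  map is an affine curve in the chart, and its class is a tangent vector in normal form. The next
  point is therefore the jet with matrix \<open>direction\<close>.\<close>

lemma theta_coords_Suc:
  "theta_coords (Suc n) z = encode (theta_coords n (truncate_jet n z),
     jet_of (theta_coords n (truncate_jet n z)) (direction (jcoord z)))"
proof -
  have "tcls Jn ideal_D (\<lambda>\<delta>. theta_coords n (line n z v \<delta>))
      = tvec (tower_coord n (theta_coords n (truncate_jet n z))) (\<lambda>b. \<Sum>i\<in>UNIV. direction (jcoord z) b i * v $ i)" for v
  proof -
    have "(\<lambda>\<delta>. theta_coords n (line n z v \<delta>)) = affine_curve (tower_coord n (theta_coords n (truncate_jet n z)))
        (\<lambda>b. \<Sum>i\<in>UNIV. direction (jcoord z) b i * v $ i)"
      unfolding affine_curve_def
      by (rule ext, rule coords_eqI) (simp_all add: jcoord_line)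
    then show ?thesis by (simp add: tvec_def)
  qed
  then show ?thesis unfolding jet_of_def by simp
qed

text \<open>On the fibre a class is recovered from its chosen representative; off the fibre jets are
  \<open>undefined\<close>. Hence storing representatives loses nothing.\<close>

lemma encode_inject:
  assumes "(y, F) \<in> pts (jets1 euclid Jn foot)" "(y', F') \<in> pts (jets1 euclid Jn foot)"
    and eq: "encode (y, F) = encode (y', F')"
  shows "y = y' \<and> F = F'"
proof -
  have y: "y \<in> pts Jn" "y' \<in> pts Jn" and F: "F \<in> jets1_at euclid Jn foot y" "F' \<in> jets1_at euclid Jn foot y'"
    using assms(1,2) by (auto simp: jets1_def Let_def)
  have yy: "y = y'" and tr: "\<And>t. trep (F t) = trep (F' t)"
    using eq by (auto simp: encode_def fun_eq_iff)
  obtain A A' where A: "F = jet_of y A" "F' = jet_of y A'"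
    using jets1_at_cases[OF y(1) F(1)] jets1_at_cases[OF y(2) F(2)] yy by metis
  have "F t = F' t" for t
  proof (cases "t \<in> pts (fibre euclid ideal_D (foot y))")
    case True
    then have "F t \<in> pts (tensor Jn ideal_D)" "F' t \<in> pts (tensor Jn ideal_D)"
      by (simp_all add: A jet_of_def)
    then show ?thesis using tr[of t] tcls_trep[OF weil_ideal_D] by metis
  qed (simp add: A jet_of_def)
  with yy show ?thesis by blast
qed

lemma jet_pair_in:
  assumes "y \<in> pts Jn" "admissible A"
  shows "(y, jet_of y A) \<in> pts (jets1 euclid Jn foot)"
  using assms jet_of_in_jets1_at by (simp add: jets1_def Let_def)

lemma jet_pair_cases:
  assumes "p \<in> pts (jets1 euclid Jn foot)"
  obtains z A where "z \<in> jet_coords n" "admissible A" "p = (theta_coords n z, jet_of (theta_coords n z) A)"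
proof -
  obtain y F where p: "p = (y, F)" "y \<in> pts Jn" "F \<in> jets1_at euclid Jn foot y"
    using assms by (auto simp: jets1_def Let_def)
  obtain z where "z \<in> jet_coords n" "y = theta_coords n z" using theta_cases[OF p(2)] by blast
  moreover obtain A where "admissible A" "F = jet_of y A" using jets1_at_cases[OF p(2,3)] by blast
  ultimately show ?thesis using that p(1) by blast
qed

text \<open>One inductive step for an arbitrary set H of jets, provided that the matrices allowed by
  H are exactly those which \<open>direction\<close> produces from coordinates of the next order. H
  is everything at order 1 and the set of holonomic jets above.\<close>

lemma tower_step:
  assumes Suc: "jets (Suc n) = image_space encode (subspace_on (jets1 euclid Jn foot) H)"
    and H: "\<And>z A. z \<in> jet_coords n \<Longrightarrow> admissible A \<Longrightarrow>
      (theta_coords n z, jet_of (theta_coords n z) A) \<in> H \<longleftrightarrow>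
      (\<exists>z'\<in>jet_coords (Suc n). truncate_jet n z' = z \<and> (\<forall>b\<in>jindex n. \<forall>i. A b i = direction (jcoord z') b i))"
  shows "tower_ok ty (Suc n)"
proof -
  define pr where "pr z = (theta_coords n (truncate_jet n z) :: ('p, 'q) tower,
     jet_of (theta_coords n (truncate_jet n z)) (direction (jcoord z)))" for z
  have th: "theta_coords (Suc n) z = encode (pr z)" for z unfolding pr_def by (rule theta_coords_Suc)
  have pr_in: "pr z \<in> pts (jets1 euclid Jn foot)" for z
    unfolding pr_def by (intro jet_pair_in theta_in truncate_jet_in admissible_direction)
  have pr_H: "pr z \<in> H" if "z \<in> jet_coords (Suc n)" for z
    unfolding pr_def using H[OF truncate_jet_in admissible_direction] that by blast
  have pr_cases: "\<exists>z\<in>jet_coords (Suc n). p = pr z" if p: "p \<in> pts (jets1 euclid Jn foot)" "p \<in> H" for p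
  proof -
    obtain z A where zA: "z \<in> jet_coords n" "admissible A" "p = (theta_coords n z, jet_of (theta_coords n z) A)"
      using jet_pair_cases[OF p(1)] .
    then obtain z' where z': "z' \<in> jet_coords (Suc n)" "truncate_jet n z' = z"
      "\<forall>b\<in>jindex n. \<forall>i. A b i = direction (jcoord z') b i"
      using H[OF zA(1,2)] p(2) by auto
    then have "p = pr z'"
      unfolding zA(3) pr_def z'(2) by (auto intro: jet_of_cong)
    with z'(1) show ?thesis by blast
  qed
  have pr_inj: "z = z'" if "z \<in> jet_coords (Suc n)" "z' \<in> jet_coords (Suc n)" "pr z = pr z'" for z z'
  proof (rule jcoord_eqI[OF that(1,2)])
    fix b :: "('p, 'q) jindex" assume b: "b \<in> jindex (Suc n)"
    have "theta_coords n (truncate_jet n z) = (theta_coords n (truncate_jet n z') :: ('p, 'q) tower)"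
      using that(3) by (simp add: pr_def)
    then have tr: "truncate_jet n z = truncate_jet n z'"
      using theta_bij by (auto simp: bij_betw_def dest: inj_onD)
    have low: "jcoord z b = jcoord z' b" if "b \<in> jindex n" for b
      using that jcoord_truncate_jet[OF that, of z] jcoord_truncate_jet[OF that, of z'] tr by simp
    have dir: "direction (jcoord z) b i = direction (jcoord z') b i" if "b \<in> jindex n" for b i
      using that(1) \<open>pr z = pr z'\<close> jet_coeff_jet_of[OF that] unfolding pr_def by metis
    show "jcoord z b = jcoord z' b"
    proof (cases "b \<in> jindex n")
      case False
      then obtain j i C where "b = Inr (j, add_mset i C)" "size C = n" using jindex_top_cases[OF b] by blast
      then show ?thesis using dir[of "Inr (j, C)" i] by simp
    qed (rule low)
  qed
  have pts: "pts (jets (Suc n) :: ('p, 'q) tower fspace) = theta_coords (Suc n) ` jet_coords (Suc n)"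
  proof
    show "pts (jets (Suc n)) \<subseteq> (theta_coords (Suc n) ` jet_coords (Suc n) :: ('p, 'q) tower set)"
    proof
      fix w :: "('p, 'q) tower" assume "w \<in> pts (jets (Suc n))"
      then obtain p where "p \<in> pts (jets1 euclid Jn foot)" "p \<in> H" "w = encode p"
        unfolding Suc by (auto simp: image_space_def subspace_on_def)
      with pr_cases obtain z where "z \<in> jet_coords (Suc n)" "w = theta_coords (Suc n) z"
        unfolding th by blast
      then show "w \<in> theta_coords (Suc n) ` jet_coords (Suc n)" by blast
    qed
    show "(theta_coords (Suc n) ` jet_coords (Suc n) :: ('p, 'q) tower set) \<subseteq> pts (jets (Suc n))"
      unfolding Suc th using pr_in pr_H by (auto simp: image_space_def subspace_on_def)
  qed
  have enc_inj: "p = p'" if "p \<in> pts (jets1 euclid Jn foot)" "p' \<in> pts (jets1 euclid Jn foot)" "encode p = encode p'" for p p'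
    using encode_inject[of "fst p" "snd p" "fst p'" "snd p'"] that by (simp add: prod_eq_iff)
  have inj: "inj_on (theta_coords (Suc n) :: _ \<Rightarrow> ('p, 'q) tower) (jet_coords (Suc n))"
    by (rule inj_onI) (use enc_inj pr_in pr_inj th in metis)
  have bij: "bij_betw (theta_coords (Suc n) :: _ \<Rightarrow> ('p, 'q) tower) (jet_coords (Suc n)) (pts (jets (Suc n)))"
    using inj pts by (simp add: bij_betw_def)
  have coord: "tower_coord (Suc n) (theta_coords (Suc n) z :: ('p, 'q) tower) = jcoord z" if "z \<in> jet_coords (Suc n)" for z
    using bij that by (simp add: tower_coord_def bij_betw_inv_into_left del: theta_coords.simps(2))
  have "c \<in> curves (jets (Suc n)) \<longleftrightarrow> (\<forall>b\<in>jindex (Suc n). smooth (\<lambda>r. tower_coord (Suc n) (c r) b))"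
    if c: "range c \<subseteq> pts (jets (Suc n))" for c :: "real \<Rightarrow> ('p, 'q) tower"
  proof -
    have "\<forall>r. \<exists>z. z \<in> jet_coords (Suc n) \<and> c r = theta_coords (Suc n) z" using c pts by blast
    then obtain \<zeta> where \<zeta>: "\<And>r. \<zeta> r \<in> jet_coords (Suc n)" "\<And>r. c r = theta_coords (Suc n) (\<zeta> r)" by metis
    define d where "d r = pr (\<zeta> r)" for r
    have c_d: "c = encode \<circ> d" by (rule ext) (simp only: d_def \<zeta>(2) th comp_apply)
    have d_in: "range d \<subseteq> pts (jets1 euclid Jn foot)" "range d \<subseteq> H"
      unfolding d_def image_subset_iff using pr_in pr_H[OF \<zeta>(1)] by blast+
    have curves_in: "range d' \<subseteq> pts (jets1 euclid Jn foot)" if "d' \<in> curves (jets1 euclid Jn foot)" for d'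
      using that curves_jets1_iff by blast
    have "c \<in> curves (jets (Suc n)) \<longleftrightarrow> d \<in> curves (jets1 euclid Jn foot)"
    proof
      assume "c \<in> curves (jets (Suc n))"
      then obtain d' where d': "d' \<in> curves (jets1 euclid Jn foot)" "c = encode \<circ> d'"
        unfolding Suc by (auto simp: image_space_def subspace_on_def)
      have "d r = d' r" for r
      proof (rule enc_inj)
        show "d r \<in> pts (jets1 euclid Jn foot)" "d' r \<in> pts (jets1 euclid Jn foot)"
          using d_in(1) curves_in[OF d'(1)] by auto
        show "encode (d r) = encode (d' r)" using c_d d'(2) by (metis comp_apply)
      qed
      with d'(1) show "d \<in> curves (jets1 euclid Jn foot)" by presburger
    next
      assume "d \<in> curves (jets1 euclid Jn foot)"
      with d_in(2) c_d show "c \<in> curves (jets (Suc n))"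
        unfolding Suc by (auto simp: image_space_def subspace_on_def)
    qed
    also have "\<dots> \<longleftrightarrow> (\<forall>b\<in>jindex n. smooth (\<lambda>r. jcoord (\<zeta> r) b)) \<and>
        (\<forall>b\<in>jindex n. \<forall>i. smooth (\<lambda>r. direction (jcoord (\<zeta> r)) b i))"
    proof -
      have "range (fst \<circ> d) \<subseteq> pts Jn" by (auto simp: d_def pr_def)
      moreover have "tower_coord n ((fst \<circ> d) r) b = jcoord (\<zeta> r) b" if "b \<in> jindex n" for r b
        using that by (simp add: d_def pr_def)
      moreover have "jet_coeff (d r) b i = direction (jcoord (\<zeta> r)) b i" if "b \<in> jindex n" for r b i
        unfolding d_def pr_def by (rule jet_coeff_jet_of[OF that])
      ultimately show ?thesis
        unfolding curves_jets1_iff curves_iff using d_in(1) by simp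
    qed
    \<comment> \<open>Entries of \<open>direction\<close> are constants or coordinates of one order
      more, and every coordinate of order n + 1 occurs among them.\<close>
    also have "\<dots> \<longleftrightarrow> (\<forall>b\<in>jindex (Suc n). smooth (\<lambda>r. jcoord (\<zeta> r) b))"
    proof (intro iffI conjI ballI allI)
      fix b :: "('p, 'q) jindex"
      assume sm: "(\<forall>b\<in>jindex n. smooth (\<lambda>r. jcoord (\<zeta> r) b)) \<and>
        (\<forall>b\<in>jindex n. \<forall>i. smooth (\<lambda>r. direction (jcoord (\<zeta> r)) b i))" and b: "b \<in> jindex (Suc n)"
      show "smooth (\<lambda>r. jcoord (\<zeta> r) b)"
      proof (cases "b \<in> jindex n")
        case False
        then obtain j i C where C: "b = Inr (j, add_mset i C)" "size C = n"
          using jindex_top_cases[OF b] by blast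
        then have "(Inr (j, C) :: ('p, 'q) jindex) \<in> jindex n" by simp
        with sm have "smooth (\<lambda>r. direction (jcoord (\<zeta> r)) (Inr (j, C)) i)" by blast
        then show ?thesis by (simp add: C(1))
      qed (use sm in blast)
    next
      fix b :: "('p, 'q) jindex" and i
      assume sm: "\<forall>b\<in>jindex (Suc n). smooth (\<lambda>r. jcoord (\<zeta> r) b)" and b: "b \<in> jindex n"
      show "smooth (\<lambda>r. jcoord (\<zeta> r) b)" using sm jindex_mono[OF b] by blast
      show "smooth (\<lambda>r. direction (jcoord (\<zeta> r)) b i)"
      proof (cases b)
        case (Inr jA)
        obtain j A where "jA = (j, A)" by force
        with Inr b sm[rule_format, of "Inr (j, add_mset i A)"] show ?thesis by simp
      qed simp
    qed
    finally show ?thesis by (simp only: \<zeta>(2) coord[OF \<zeta>(1)])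
  qed
  moreover have "range c \<subseteq> pts (jets (Suc n))" if c: "c \<in> curves (jets (Suc n))" for c :: "real \<Rightarrow> ('p, 'q) tower"
  proof -
    obtain d where "d \<in> curves (jets1 euclid Jn foot)" "range d \<subseteq> H" "c = encode \<circ> d"
      using c unfolding Suc by (auto simp: image_space_def subspace_on_def)
    then show ?thesis unfolding Suc using curves_jets1_iff[of d] by (auto simp: image_space_def subspace_on_def)
  qed
  ultimately show ?thesis unfolding tower_ok_def using bij by blast
qed

end

subsection \<open>Holonomic jets\<close>

lemma (in charted) tvec_cong2:
  "(\<And>i. i \<in> B \<Longrightarrow> a i = a' i) \<Longrightarrow> (\<And>i. i \<in> B \<Longrightarrow> w i = w' i) \<Longrightarrow> tvec a w = tvec a' w'"
  by (rule tvec_eqI) simp_all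

interpretation vec: charted2 "euclid :: (real ^ 'p::finite) fspace" UNIV "\<lambda>x i. x $ i"
  by (rule vec.charted2)

lemma (in tower) tower_coord_Suc_lower:
  assumes "bij_betw (theta_coords (Suc n) :: _ \<Rightarrow> ('p, 'q) tower) (jet_coords (Suc n)) (pts (jets (Suc n)))"
  shows "(y :: ('p, 'q) tower) \<in> pts (jets (Suc n)) \<Longrightarrow> lower y \<in> pts Jn"
    and "y \<in> pts (jets (Suc n)) \<Longrightarrow> b \<in> jindex n \<Longrightarrow> tower_coord n (lower y) b = tower_coord (Suc n) y b"
proof -
  assume y: "y \<in> pts (jets (Suc n))"
  then obtain z where z: "z \<in> jet_coords (Suc n)" "y = theta_coords (Suc n) z"
    using assms unfolding bij_betw_def by blast
  have "lower y = theta_coords n (truncate_jet n z)" unfolding z(2) by (rule lower_theta_coords)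
  moreover have "tower_coord (Suc n) y = jcoord z"
    unfolding tower_coord_def z(2) by (subst bij_betw_inv_into_left[OF assms z(1)]) (rule refl)
  ultimately show "lower y \<in> pts Jn" "b \<in> jindex n \<Longrightarrow> tower_coord n (lower y) b = tower_coord (Suc n) y b"
    by simp_all
qed

text \<open>The linear part of \<open>direction\<close>, which is affine in the coordinates: the
  identity in the base rows is constant and drops out.\<close>

definition linear_direction :: "(('p::finite, 'q::finite) jindex \<Rightarrow> real) \<Rightarrow> ('p, 'q) jindex \<Rightarrow> 'p \<Rightarrow> real" where
  "linear_direction w b i = (case b of Inl k \<Rightarrow> 0 | Inr (j, A) \<Rightarrow> w (Inr (j, add_mset i A)))"

lemma linear_direction_simps [simp]:
  "linear_direction w (Inl k) i = 0"
  "linear_direction w (Inr (j, A)) i = w (Inr (j, add_mset i A))"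
  by (simp_all add: linear_direction_def)

text \<open>Jets of order n + 2 are carved out by a condition that evaluates a jet over order n + 1
  and takes values over order n, so both levels are interpreted side by side.\<close>

locale tower2 = L: tower ty n + U: tower ty "Suc n"
  for ty :: "('p::finite \<times> 'q::finite) itself" and n :: nat
begin

sublocale L2: charted2 "jets n :: ('p, 'q) tower fspace" "jindex n" "tower_coord n"
  by (rule L.charted2)

lemmas lower_in = L.tower_coord_Suc_lower(1)[OF U.theta_bij]
  and tower_coord_lower = L.tower_coord_Suc_lower(2)[OF U.theta_bij]

lemma lower_smooth_map: "smooth_map U.Jn L.Jn lower"
  unfolding smooth_map_def
proof (intro conjI ballI)
  fix c assume c: "c \<in> curves U.Jn"
  have r: "c r \<in> pts U.Jn" for r by (rule U.range_curve[OF c])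
  have "smooth (\<lambda>r. tower_coord n (lower (c r)) b)" if b: "b \<in> jindex n" for b
    using c jindex_mono[OF b] by (simp add: tower_coord_lower[OF r b] U.curves_iff)
  with lower_in[OF r] show "lower \<circ> c \<in> curves L.Jn" by (auto simp: L.curves_iff)
qed (rule lower_in)

lemma tmap_lower_tvec: "tmap L.Jn ideal_D lower (U.tvec a w) = L.tvec a w"
proof -
  have "lower \<circ> U.affine_curve a w = L.affine_curve a w"
    unfolding L.affine_curve_def U.affine_curve_def
    by (rule ext, rule L.coords_eqI) (simp_all add: lower_in tower_coord_lower jindex_mono)
  then show ?thesis
    unfolding U.tvec_def L.tvec_def
    by (simp add: tmap_tcls[OF weil_ideal_D U.froelicher lower_smooth_map U.affine_curve_mor])
qed

text \<open>Decodes a point of order n + 1: by \<open>theta_coords_Suc\<close> it is the jet whose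
  matrix its own coordinates prescribe, and the stored representatives give back the
  classes.\<close>

lemma jet_map_vtan:
  assumes y: "y \<in> pts U.Jn"
  shows "jet_map L.Jn y (vtan (foot y) v)
    = L.tvec (tower_coord (Suc n) y) (\<lambda>b. \<Sum>i\<in>UNIV. direction (tower_coord (Suc n) y) b i * v $ i)"
proof -
  obtain z where z: "z \<in> jet_coords (Suc n)" "y = theta_coords (Suc n) z" using U.theta_cases[OF y] .
  have k: "tower_coord (Suc n) y = jcoord z" unfolding z(2) by (rule U.tower_coord_theta[OF z(1)])
  define y0 where "y0 = (theta_coords n (truncate_jet n z) :: ('p, 'q) tower)"
  have y0: "tower_coord n y0 b = jcoord z b" if "b \<in> jindex n" for b using that by (simp add: y0_def)
  have ft: "foot y = foot y0" unfolding z(2) y0_def foot_theta_coords by simp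
  have y_eq: "y = encode (y0, L.jet_of y0 (direction (jcoord z)))"
    unfolding z(2) y0_def by (rule L.theta_coords_Suc)
  have "jet_map L.Jn y (vtan (foot y) v) = L.jet_of y0 (direction (jcoord z)) (vtan (foot y0) v)"
    unfolding ft unfolding y_eq encode_def by (simp add: tcls_trep[OF weil_ideal_D])
  also have "\<dots> = L.tvec (jcoord z) (\<lambda>b. \<Sum>i\<in>UNIV. direction (jcoord z) b i * v $ i)"
    unfolding L.jet_of_vtan by (rule L.tvec_cong2) (simp_all add: y0)
  finally show ?thesis unfolding k .
qed

definition pairs :: "(('p, 'q) tower \<times> (real, real ^ 'p) wclass) fspace" where
  "pairs = subspace_on (prod_space U.Jn (tensor euclid ideal_D)) {(x, t). foot x = tbase t}"

definition pair_coord :: "('p, 'q) tower \<times> (real, real ^ 'p) wclass \<Rightarrow> ('p, 'q) jindex + 'p \<times> bool \<Rightarrow> real" where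
  "pair_coord = (\<lambda>(x, t). case_sum (tower_coord (Suc n) x) (vec.tan_coord t))"

lemma pair_coord_simps [simp]:
  "pair_coord p (Inl b) = tower_coord (Suc n) (fst p) b" "pair_coord p (Inr j) = vec.tan_coord (snd p) j"
  by (simp_all add: pair_coord_def case_prod_unfold)

text \<open>The base of the tangent vector is fixed by the foot of the point, so a pair is
  determined by the coordinates of the point and a velocity.\<close>

lemma charted_pairs: "charted pairs (jindex (Suc n) <+> UNIV \<times> {True}) pair_coord"
proof -
  interpret P: charted "prod_space U.Jn (tensor (euclid :: (real ^ 'p) fspace) ideal_D)" "jindex (Suc n) <+> UNIV \<times> UNIV" pair_coord
    unfolding pair_coord_def by (rule charted_prod[OF U.charted_axioms vec.T.charted_axioms])
  have diff: "(jindex (Suc n) <+> UNIV \<times> UNIV) - (jindex (Suc n) <+> UNIV \<times> {True}) = (\<lambda>i :: 'p. Inr (i, False)) ` UNIV"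
    by (auto simp: UNIV_bool Plus_def)
  show ?thesis
    unfolding pairs_def
  proof (rule P.charted_subspace[where e="\<lambda>j a. a (Inl (Inl (fst (projr j))))"])
    fix p assume p: "p \<in> pts (prod_space U.Jn (tensor (euclid :: (real ^ 'p) fspace) ideal_D))"
    then have "fst p \<in> pts U.Jn" by (auto simp: prod_space_def)
    then have "foot (fst p) = tbase (snd p) \<longleftrightarrow> (\<forall>i. vec.tan_coord (snd p) (i, False) = tower_coord (Suc n) (fst p) (Inl i))"
      by (auto simp: vec_eq_iff U.\<rho>_coord vec.tan_coord_False)
    then show "p \<in> {(x, t). foot x = tbase t} \<longleftrightarrow>
        (\<forall>j\<in>(jindex (Suc n) <+> UNIV \<times> UNIV) - (jindex (Suc n) <+> UNIV \<times> {True}).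
          pair_coord p j = pair_coord p (Inl (Inl (fst (projr j)))))"
      unfolding diff by (simp add: case_prod_unfold)
  qed (auto simp: Plus_def)
qed

sublocale Q: charted pairs "jindex (Suc n) <+> UNIV \<times> {True}" pair_coord
  by (rule charted_pairs)

lemma pairs_in: "(y, t) \<in> pts pairs \<longleftrightarrow> y \<in> pts U.Jn \<and> t \<in> pts (tensor euclid ideal_D) \<and> foot y = tbase t"
  by (auto simp: pairs_def subspace_on_def prod_space_def)

lemma fst_smooth_map: "smooth_map pairs U.Jn fst"
  and snd_smooth_map: "smooth_map pairs (tensor euclid ideal_D) snd"
  by (auto simp: smooth_map_def pairs_def subspace_on_def prod_space_def)

definition ev :: "('p, 'q) tower \<times> (real, real ^ 'p) wclass \<Rightarrow> (real, ('p, 'q) tower) wclass" where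
  "ev = (\<lambda>(x, t). jet_map L.Jn x t)"

lemma ev_eq:
  assumes "p \<in> pts pairs"
  shows "ev p = L.tvec (tower_coord (Suc n) (fst p))
    (\<lambda>b. \<Sum>i\<in>UNIV. direction (tower_coord (Suc n) (fst p)) b i * velocity (snd p) $ i)"
proof -
  obtain y t where p: "p = (y, t)" by force
  with assms have y: "y \<in> pts U.Jn" "t \<in> pts (tensor euclid ideal_D)" "foot y = tbase t"
    by (auto simp: pairs_in)
  have "t = vtan (foot y) (velocity t)" using vtan_cases[OF y(2)] y(3) by simp
  then obtain v where v: "t = vtan (foot y) v" by blast
  show ?thesis unfolding p ev_def v by (simp add: jet_map_vtan[OF y(1)])
qed

lemma ev_smooth_map: "smooth_map pairs (tensor L.Jn ideal_D) ev"
  unfolding smooth_map_def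
proof (intro conjI ballI)
  show "ev p \<in> pts (tensor L.Jn ideal_D)" if "p \<in> pts pairs" for p
    by (simp add: ev_eq[OF that])
  fix c assume c: "c \<in> curves pairs"
  have r: "c r \<in> pts pairs" for r by (rule Q.range_curve[OF c])
  have k: "smooth (\<lambda>r. tower_coord (Suc n) (fst (c r)) b)" if "b \<in> jindex (Suc n)" for b
  proof -
    have "Inl b \<in> jindex (Suc n) <+> (UNIV :: 'p set) \<times> {True}" using that by auto
    with c have "smooth (\<lambda>r. pair_coord (c r) (Inl b))" unfolding Q.curves_iff by blast
    then show ?thesis by simp
  qed
  have "snd \<circ> c \<in> curves (tensor euclid ideal_D)" using c snd_smooth_map by (auto simp: smooth_map_def)
  then have v: "smooth (\<lambda>r. velocity (snd (c r)))" by (simp add: curves_tensor_vec_iff)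
  have d: "smooth (\<lambda>r. direction (tower_coord (Suc n) (fst (c r))) b i)" if "b \<in> jindex n" for b i
  proof (cases b)
    case (Inr jA)
    obtain j A where "jA = (j, A)" by force
    with Inr that k[of "Inr (j, add_mset i A)"] show ?thesis by simp
  qed simp
  have "smooth (\<lambda>r. L.tan_coord (ev (c r)) j)" if j: "j \<in> jindex n \<times> UNIV" for j
  proof -
    obtain b e where be: "j = (b, e)" "b \<in> jindex n" using j by auto
    show ?thesis
      unfolding be(1) ev_eq[OF r]
      using be(2) k[OF jindex_mono[OF be(2)]]
      by (cases e) (auto intro!: smooth_sum smooth_mult smooth_vec_nth v d)
  qed
  then show "ev \<circ> c \<in> curves (tensor L.Jn ideal_D)"
    unfolding L2.T.curves_iff by (auto simp: ev_eq[OF r])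
qed

text \<open>Moving along d1 changes the point to k + d1 w and the velocity to v + d1 c. The jet
  stored in the moving point has a matrix affine in d1, and the mixed coefficient is the product
  rule applied to matrix times velocity.\<close>

lemma iterate_quad:
  fixes a v c :: "real ^ 'p"
  assumes x: "x \<in> pts U.Jn" and A: "U.admissible A"
  defines "k \<equiv> tower_coord (Suc n) x"
  defines "w \<equiv> \<lambda>b. \<Sum>i\<in>UNIV. A b i * a $ i"
  shows "iterate L.Jn U.Jn (U.jet_of x A) (vec.quad (($) (foot x)) (($) a) (($) v) (($) c))
    = L.quad k w (\<lambda>b. \<Sum>i\<in>UNIV. direction k b i * v $ i)
        (\<lambda>b. \<Sum>i\<in>UNIV. direction k b i * c $ i + linear_direction w b i * v $ i)"
proof -
  define \<gamma> where "\<gamma> = vec.quad (($) (foot x)) (($) a) (($) v) (($) c)"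
  have ft: "foot x $ i = k (Inl i)" for i using U.\<rho>_coord[OF x] by (simp add: k_def)
  have w_Inl: "w (Inl i) = a $ i" for i
    using A by (simp add: w_def U.admissible_def if_distrib[of "\<lambda>x. x * _"] cong: if_cong)
  have g1: "U.jet_of x A (tpull euclid ideal_D (\<lambda>d. (d, 0)) \<gamma>) = U.tvec k w"
    unfolding \<gamma>_def vec.tpull_quad_axis vtan_eq_tvec[symmetric] U.jet_of_vtan by (simp add: k_def w_def)
  define q where "q e = vtan (foot x + e *\<^sub>R a) (v + e *\<^sub>R c)" for e
  have g2: "outer1 euclid ideal_D ideal_D \<gamma> = tcls (tensor euclid ideal_D) ideal_D q"
  proof -
    have "q = vec.T.affine_curve (\<lambda>(i, b). if b then v $ i else foot x $ i) (\<lambda>(i, b). if b then c $ i else a $ i)"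
      unfolding vec.T.affine_curve_def
    proof (rule ext, rule vec.T.coords_eqI)
      fix e and j :: "'p \<times> bool"
      assume j: "j \<in> UNIV \<times> UNIV"
      show "vec.tan_coord (q e) j = vec.tan_coord (vec.T.pt (\<lambda>j. (case j of (i, b) \<Rightarrow> if b then v $ i else foot x $ i) +
          e * (case j of (i, b) \<Rightarrow> if b then c $ i else a $ i))) j"
        unfolding vec.T.coord_pt[OF j] by (cases j; cases "snd j") (simp_all add: q_def)
    qed (unfold q_def, rule vtan_in_tensor, rule vec.T.pt_in)
    then show ?thesis unfolding \<gamma>_def vec.outer1_quad vec.T.tvec_def by simp
  qed
  \<comment> \<open>A representative of the pair to be found: the point moved by the jet, and
    \<open>\<gamma>\<close> as a family of tangent vectors. By \<open>w_Inl\<close> both have the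
    same foot for every e.\<close>
  define p0 where "p0 e = (U.affine_curve k w e, q e)" for e
  have p0_in: "p0 e \<in> pts pairs" for e
    by (simp add: p0_def pairs_in q_def U.affine_curve_def vec_eq_iff U.\<rho>_coord w_Inl ft)
  have q_mor: "q \<in> mor euclid (tensor euclid ideal_D)"
    unfolding vec.T.mor_euclid_real q_def
    by (intro vtan_curve smooth_add smooth_scaleR smooth_const smooth_ident)
  have p0_mor: "p0 \<in> mor euclid pairs"
    unfolding Q.mor_euclid_iff
  proof (intro conjI allI ballI p0_in)
    fix j :: "('p, 'q) jindex + 'p \<times> bool"
    assume "j \<in> jindex (Suc n) <+> UNIV \<times> {True}"
    then show "smooth (\<lambda>e. pair_coord (p0 e) j)"
      using U.affine_curve_mor[of k w] q_mor
      unfolding U.mor_euclid_iff vec.T.mor_euclid_iff by (auto simp: p0_def Plus_def)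
  qed
  define P0 where "P0 = tcls pairs ideal_D p0"
  have P0_in: "P0 \<in> pts (tensor pairs ideal_D)" unfolding P0_def pts_tensor using p0_mor by blast
  have P0_fst: "tmap U.Jn ideal_D fst P0 = U.tvec k w"
    unfolding P0_def tmap_tcls[OF weil_ideal_D Q.froelicher fst_smooth_map p0_mor]
    by (simp add: p0_def o_def U.tvec_def)
  have P0_snd: "tmap (tensor euclid ideal_D) ideal_D snd P0 = tcls (tensor euclid ideal_D) ideal_D q"
    unfolding P0_def tmap_tcls[OF weil_ideal_D Q.froelicher snd_smooth_map p0_mor]
    by (simp add: p0_def o_def)
  have pair: "(THE z. z \<in> pts (tensor pairs ideal_D) \<and>
      tmap U.Jn ideal_D fst z = U.jet_of x A (tpull euclid ideal_D (\<lambda>d. (d, 0)) \<gamma>) \<and>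
      tmap (tensor euclid ideal_D) ideal_D snd z = outer1 euclid ideal_D ideal_D \<gamma>) = P0"
    unfolding g1 g2
  \<comment> \<open>Uniqueness: the coordinates of a pair are coordinates of its two components, so
    a class of pairs is determined by its projections.\<close>
  proof (rule the_equality)
    fix z assume z: "z \<in> pts (tensor pairs ideal_D) \<and> tmap U.Jn ideal_D fst z = U.tvec k w \<and>
        tmap (tensor euclid ideal_D) ideal_D snd z = tcls (tensor euclid ideal_D) ideal_D q"
    have r: "trep z \<in> mor euclid pairs" and z_eq: "tcls pairs ideal_D (trep z) = z"
      using z trep_mor[OF weil_ideal_D] tcls_trep[OF weil_ideal_D] by blast+
    have "tcls U.Jn ideal_D (fst \<circ> trep z) = tcls U.Jn ideal_D (U.affine_curve k w)"
      using z by (simp add: tmap_def U.tvec_def)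
    then have e1: "\<forall>b\<in>jindex (Suc n). tower_coord (Suc n) (fst (trep z 0)) b = tower_coord (Suc n) (U.affine_curve k w 0) b \<and>
        deriv (\<lambda>d. tower_coord (Suc n) (fst (trep z d)) b) 0 = deriv (\<lambda>d. tower_coord (Suc n) (U.affine_curve k w d) b) 0"
      unfolding U.tcls_D_eq_iff[OF smooth_map_comp_mor[OF fst_smooth_map r] U.affine_curve_mor] by simp
    have "tcls (tensor euclid ideal_D) ideal_D (snd \<circ> trep z) = tcls (tensor euclid ideal_D) ideal_D q"
      using z by (simp add: tmap_def)
    then have e2: "\<forall>j. vec.tan_coord (snd (trep z 0)) j = vec.tan_coord (q 0) j \<and>
        deriv (\<lambda>d. vec.tan_coord (snd (trep z d)) j) 0 = deriv (\<lambda>d. vec.tan_coord (q d) j) 0"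
      unfolding vec.T.tcls_D_eq_iff[OF smooth_map_comp_mor[OF snd_smooth_map r] q_mor] by simp
    have "tcls pairs ideal_D (trep z) = tcls pairs ideal_D p0"
      unfolding Q.tcls_D_eq_iff[OF r p0_mor] using e1 e2 by (auto simp: p0_def Plus_def)
    then show "z = P0" unfolding z_eq P0_def .
  qed (simp add: P0_in P0_fst P0_snd)
  have ev_mor: "ev \<circ> p0 \<in> mor euclid (tensor L.Jn ideal_D)"
    by (rule smooth_map_comp_mor[OF ev_smooth_map p0_mor])
  define S where "S b = (\<Sum>i\<in>UNIV. direction k b i * v $ i)" for b
  define dS where "dS b = (\<Sum>i\<in>UNIV. direction k b i * c $ i + linear_direction w b i * v $ i)" for b
  have ev_p0: "L.tan_coord (ev (p0 e)) (b, False) = k b + e * w b"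
    "L.tan_coord (ev (p0 e)) (b, True) = (\<Sum>i\<in>UNIV. (direction k b i + e * linear_direction w b i) * (v $ i + e * c $ i))"
    if b: "b \<in> jindex n" for b e
  proof -
    have "direction (tower_coord (Suc n) (U.affine_curve k w e)) b i = direction k b i + e * linear_direction w b i" for i
    proof (cases b)
      case (Inr jA)
      obtain j A where "jA = (j, A)" by force
      with Inr b show ?thesis by (simp add: U.affine_curve_def)
    qed simp
    then show "L.tan_coord (ev (p0 e)) (b, True) = (\<Sum>i\<in>UNIV. (direction k b i + e * linear_direction w b i) * (v $ i + e * c $ i))"
      unfolding ev_eq[OF p0_in] using b by (simp add: p0_def q_def)
    show "L.tan_coord (ev (p0 e)) (b, False) = k b + e * w b"
      unfolding ev_eq[OF p0_in] using b jindex_mono[OF b] by (simp add: p0_def U.affine_curve_def)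
  qed
  \<comment> \<open>The term quadratic in e has derivative zero at 0, which leaves the two terms of
    the product rule.\<close>
  have dsum: "deriv (\<lambda>e. \<Sum>i\<in>UNIV. (direction k b i + e * linear_direction w b i) * (v $ i + e * c $ i)) 0 = dS b" for b
    unfolding dS_def by (rule DERIV_imp_deriv) (auto intro!: derivative_eq_intros sum.cong)
  have "tmap (tensor L.Jn ideal_D) ideal_D ev P0 = tcls (tensor L.Jn ideal_D) ideal_D (ev \<circ> p0)"
    unfolding P0_def by (rule tmap_tcls[OF weil_ideal_D Q.froelicher ev_smooth_map p0_mor])
  also have "\<dots> = outer1 L.Jn ideal_D ideal_D (L.quad k w S dS)"
    unfolding L2.outer1_quad
  proof (rule L2.T.tvec_eqI)
    show "tcls (tensor L.Jn ideal_D) ideal_D (ev \<circ> p0) \<in> pts (tensor (tensor L.Jn ideal_D) ideal_D)"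
      unfolding pts_tensor[of "tensor L.Jn ideal_D"] using ev_mor by blast
    fix j :: "('p, 'q) jindex \<times> bool" assume j: "j \<in> jindex n \<times> UNIV"
    obtain b e where be: "j = (b, e)" "b \<in> jindex n" using j by auto
    show "L2.T.tan_coord (tcls (tensor L.Jn ideal_D) ideal_D (ev \<circ> p0)) (j, False) = (case j of (i, b) \<Rightarrow> if b then S i else k i)"
      unfolding L2.T.tan_coord_tcls(1)[OF ev_mor j] using be by (cases e) (simp_all add: ev_p0 S_def)
    show "L2.T.tan_coord (tcls (tensor L.Jn ideal_D) ideal_D (ev \<circ> p0)) (j, True) = (case j of (i, b) \<Rightarrow> if b then dS i else w i)"
      unfolding L2.T.tan_coord_tcls(2)[OF ev_mor j] using be by (cases e) (simp_all add: ev_p0 dsum)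
  qed
  finally have ev_eq_quad: "tmap (tensor L.Jn ideal_D) ideal_D ev P0 = outer1 L.Jn ideal_D ideal_D (L.quad k w S dS)" .
  have "iterate L.Jn U.Jn (U.jet_of x A) \<gamma> = L.quad k w S dS"
    unfolding iterate_def Let_def pairs_def[symmetric] ev_def[symmetric] pair ev_eq_quad by (rule L2.the_outer1_quad)
  then show ?thesis by (simp add: \<gamma>_def S_def[abs_def] dS_def[abs_def])
qed

end

text \<open>The entries in the rows of order m have to become coordinates of order m + 1, which are
  indexed by multisets. This is possible when an entry depends on row and column only through the
  combined multiset, as \<open>top\<close> demands.\<close>

lemma jet_extension:
  fixes z :: "('p::finite, 'q::finite) jcoords"
  assumes z: "z \<in> jet_coords m"
    and Inl: "\<And>k i. A (Inl k) i = (if k = i then 1 else 0)"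
    and low: "\<And>j C i. size C < m \<Longrightarrow> A (Inr (j, C)) i = snd z (add_mset i C) $ j"
    and top: "\<And>j C C' i i'. size C = m \<Longrightarrow> add_mset i C = add_mset i' C' \<Longrightarrow> A (Inr (j, C)) i = A (Inr (j, C')) i'"
  shows "\<exists>z'\<in>jet_coords (Suc m). truncate_jet m z' = z \<and> (\<forall>b\<in>jindex m. \<forall>i. A b i = direction (jcoord z') b i)"
proof -
  \<comment> \<open>An arbitrary element of D serves as column index and the rest as row index; by
    \<open>top\<close> the choice does not matter.\<close>
  define s where "s D = (SOME i. i \<in># D)" for D :: "'p multiset"
  have s: "add_mset (s D) (D - {#s D#}) = D" if "size D = Suc m" for D
  proof -
    have "\<exists>i. i \<in># D" using that by (cases D) auto
    then have "s D \<in># D" unfolding s_def by (rule someI_ex)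
    then show ?thesis by simp
  qed
  define z' where "z' = (fst z, \<lambda>D. if size D = Suc m then \<chi> j. A (Inr (j, D - {#s D#})) (s D) else snd z D)"
  have big: "snd z D = 0" if "m < size D" for D using z that by (auto simp: jet_coords_def)
  have "z' \<in> jet_coords (Suc m)"
    by (auto simp: z'_def jet_coords_def big)
  moreover have "truncate_jet m z' = z"
    by (auto simp: z'_def truncate_jet_def prod_eq_iff fun_eq_iff big)
  moreover have "A b i = direction (jcoord z') b i" if b: "b \<in> jindex m" for b i
  proof (cases b)
    case (Inl k) then show ?thesis by (simp add: assms(2))
  next
    case (Inr jC)
    obtain j C where jC: "jC = (j, C)" by force
    show ?thesis
    proof (cases "size C = m")
      case True
      then have "add_mset i C = add_mset (s (add_mset i C)) (add_mset i C - {#s (add_mset i C)#})"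
        using s[of "add_mset i C"] by simp
      from top[OF True this] True show ?thesis by (simp add: Inr jC z'_def)
    next
      case False
      then show ?thesis using b low[of C] by (simp add: Inr jC z'_def)
    qed
  qed
  ultimately show ?thesis by blast
qed

context tower2 begin

text \<open>Both sides are tangent vectors over the same point and linear in the velocity, so
  equality can be tested on the directions \<open>axis i 1\<close>, that is, column by
  column.\<close>

lemma related_iff:
  assumes x: "x \<in> pts U.Jn"
  shows "(\<forall>t \<in> pts (fibre euclid ideal_D (foot x)). tmap L.Jn ideal_D lower (U.jet_of x A t) = jet_map L.Jn x t)
    \<longleftrightarrow> (\<forall>b\<in>jindex n. \<forall>i. A b i = direction (tower_coord (Suc n) x) b i)"
proof -
  define k where "k = tower_coord (Suc n) x"
  have eq: "tmap L.Jn ideal_D lower (U.jet_of x A (vtan (foot x) v)) = jet_map L.Jn x (vtan (foot x) v) \<longleftrightarrow>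
      L.tvec k (\<lambda>b. \<Sum>i\<in>UNIV. A b i * v $ i) = L.tvec k (\<lambda>b. \<Sum>i\<in>UNIV. direction k b i * v $ i)" for v
    by (simp add: tmap_lower_tvec jet_map_vtan[OF x] k_def)
  show ?thesis
    unfolding k_def[symmetric]
  proof (intro iffI ballI allI)
    fix b :: "('p, 'q) jindex" and i
    assume R: "\<forall>t\<in>pts (fibre euclid ideal_D (foot x)). tmap L.Jn ideal_D lower (U.jet_of x A t) = jet_map L.Jn x t"
      and b: "b \<in> jindex n"
    have "L.tvec k (\<lambda>b. \<Sum>l\<in>UNIV. A b l * axis i 1 $ l) = L.tvec k (\<lambda>b. \<Sum>l\<in>UNIV. direction k b l * axis i 1 $ l)"
      using R vtan_in_fibre[of "foot x" "axis i 1"] eq[of "axis i 1"] by blast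
    then have "L.tan_coord (L.tvec k (\<lambda>b. \<Sum>l\<in>UNIV. A b l * axis i 1 $ l)) (b, True)
        = L.tan_coord (L.tvec k (\<lambda>b. \<Sum>l\<in>UNIV. direction k b l * axis i 1 $ l)) (b, True)" by simp
    with b show "A b i = direction k b i"
      by (simp add: axis_def if_distrib cong: if_cong)
  next
    fix t assume A: "\<forall>b\<in>jindex n. \<forall>i. A b i = direction k b i"
      and t: "t \<in> pts (fibre euclid ideal_D (foot x))"
    obtain v where t_v: "t = vtan (foot x) v" using vtan_fibre_cases[OF t] by blast
    show "tmap L.Jn ideal_D lower (U.jet_of x A t) = jet_map L.Jn x t"
      unfolding t_v eq by (rule L.tvec_cong) (use A in simp)
  qed
qed

text \<open>By \<open>low\<close> the first-order coefficients of both sides agree, and only the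
  mixed one is left to compare. Its part in c is common to both sides; the rest is a bilinear form
  in a and v, symmetric exactly when its coefficients are.\<close>

lemma symmetric_iff:
  assumes x: "x \<in> pts U.Jn" and A: "U.admissible A"
    and low: "\<And>b i. b \<in> jindex n \<Longrightarrow> A b i = direction (tower_coord (Suc n) x) b i"
  shows "(\<forall>\<gamma> \<in> pts (fibre euclid ideal_DD (foot x)).
      iterate L.Jn U.Jn (U.jet_of x A) \<gamma> = transpose2 L.Jn (iterate L.Jn U.Jn (U.jet_of x A) (transpose2 euclid \<gamma>)))
    \<longleftrightarrow> (\<forall>j C i l. size C \<le> n \<longrightarrow> A (Inr (j, add_mset i C)) l = A (Inr (j, add_mset l C)) i)"
    (is "?L \<longleftrightarrow> ?R")
proof -
  define k where "k = tower_coord (Suc n) x"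
  define w where "w a b = (\<Sum>i\<in>UNIV. A b i * a $ i)" for a :: "real ^ 'p" and b
  define S where "S v b = (\<Sum>i\<in>UNIV. direction k b i * v $ i)" for v :: "real ^ 'p" and b
  define dS where "dS a v c b = (\<Sum>i\<in>UNIV. direction k b i * c $ i + linear_direction (w a) b i * v $ i)"
    for a v c :: "real ^ 'p" and b
  define \<Gamma> where "\<Gamma> a v c = vec.quad (($) (foot x)) (($) a) (($) v) (($) c)" for a v c :: "real ^ 'p"
  have it: "iterate L.Jn U.Jn (U.jet_of x A) (\<Gamma> a v c) = L.quad k (w a) (S v) (dS a v c)" for a v c
    using iterate_quad[OF x A, of a v c] by (simp add: \<Gamma>_def k_def w_def[abs_def] S_def[abs_def] dS_def[abs_def])
  have wS: "w a b = S a b" if "b \<in> jindex n" for a b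
    using low[OF that] by (simp add: w_def S_def k_def)
  have cond: "iterate L.Jn U.Jn (U.jet_of x A) (\<Gamma> a v c)
        = transpose2 L.Jn (iterate L.Jn U.Jn (U.jet_of x A) (transpose2 euclid (\<Gamma> a v c))) \<longleftrightarrow>
      (\<forall>b\<in>jindex n. dS a v c b = dS v a c b)" for a v c
  proof -
    have "transpose2 euclid (\<Gamma> a v c) = \<Gamma> v a c" by (simp add: \<Gamma>_def vec.transpose2_quad)
    then show ?thesis by (simp add: it L.transpose2_quad L2.quad_eq_iff wS)
  qed
  have all: "?L \<longleftrightarrow> (\<forall>a v c. \<forall>b\<in>jindex n. dS a v c b = dS v a c b)"
  proof (intro iffI allI ballI)
    fix a v c :: "real ^ 'p" and b :: "('p, 'q) jindex" assume L: ?L and b: "b \<in> jindex n"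
    have "tbase (\<Gamma> a v c) = foot x"
      unfolding \<Gamma>_def vec.tbase_quad by (simp add: vec_eq_iff)
    then have "\<Gamma> a v c \<in> pts (fibre euclid ideal_DD (foot x))"
      unfolding pts_fibre \<Gamma>_def by simp
    with L have "iterate L.Jn U.Jn (U.jet_of x A) (\<Gamma> a v c)
        = transpose2 L.Jn (iterate L.Jn U.Jn (U.jet_of x A) (transpose2 euclid (\<Gamma> a v c)))" by (rule bspec)
    with cond b show "dS a v c b = dS v a c b" by blast
  next
    fix \<gamma> assume R: "\<forall>a v c. \<forall>b\<in>jindex n. dS a v c b = dS v a c b"
      and \<gamma>: "\<gamma> \<in> pts (fibre euclid ideal_DD (foot x))"
    then have g: "\<gamma> \<in> pts (tensor euclid ideal_DD)" "tbase \<gamma> = foot x" by (auto simp: pts_fibre)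
    obtain a0 a1 a2 a12 where q: "\<gamma> = vec.quad a0 a1 a2 a12" using vec.quad_cases[OF g(1)] .
    have "a0 i = foot x $ i" for i
      using g(2) vec.coord_pt[of i a0] unfolding q vec.tbase_quad by simp
    then have "\<gamma> = \<Gamma> (\<chi> i. a1 i) (\<chi> i. a2 i) (\<chi> i. a12 i)"
      unfolding q \<Gamma>_def by (intro vec.quad_eq_iff[THEN iffD2]) simp
    then show "iterate L.Jn U.Jn (U.jet_of x A) \<gamma> = transpose2 L.Jn (iterate L.Jn U.Jn (U.jet_of x A) (transpose2 euclid \<gamma>))"
      using cond R by blast
  qed
  have ax: "(\<Sum>l\<in>UNIV. f l * axis m 1 $ l) = f m" for f :: "'p \<Rightarrow> real" and m
    by (simp add: axis_def if_distrib cong: if_cong)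
  \<comment> \<open>On coordinate directions with c = 0 the mixed coefficient isolates one matrix
    entry, which turns the identity of forms into one of entries.\<close>
  have dS_axis: "dS (axis l 1) (axis i 1) 0 (Inr (j, C)) = A (Inr (j, add_mset i C)) l" for i l j C
    unfolding dS_def w_def linear_direction_simps ax sum.distrib by simp
  have dS_Inr: "dS a v c (Inr (j, C)) = (\<Sum>i\<in>UNIV. k (Inr (j, add_mset i C)) * c $ i)
      + (\<Sum>i\<in>UNIV. \<Sum>l\<in>UNIV. A (Inr (j, add_mset i C)) l * a $ l * v $ i)" for a v c j C
    by (simp add: dS_def w_def sum.distrib sum_distrib_right)
  show ?thesis
    unfolding all
  proof (intro iffI allI impI ballI)
    fix j :: 'q and C :: "'p multiset" and i l :: 'p
    assume D: "\<forall>a v c. \<forall>b\<in>jindex n. dS a v c b = dS v a c b" and C: "size C \<le> n"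
    have "dS (axis l 1) (axis i 1) 0 (Inr (j, C)) = dS (axis i 1) (axis l 1) 0 (Inr (j, C))"
      by (rule D[rule_format]) (simp add: C)
    then show "A (Inr (j, add_mset i C)) l = A (Inr (j, add_mset l C)) i"
      by (simp only: dS_axis)
  next
    fix a v c :: "real ^ 'p" and b :: "('p, 'q) jindex"
    assume sym: ?R and b: "b \<in> jindex n"
    show "dS a v c b = dS v a c b"
    proof (cases b)
      case (Inl m) then show ?thesis by (simp add: dS_def)
    next
      case (Inr jC)
      obtain j C where jC: "jC = (j, C)" by force
      with Inr b have C: "size C \<le> n" by simp
      have s: "A (Inr (j, add_mset i C)) l = A (Inr (j, add_mset l C)) i" for i l using sym C by blast
      have "(\<Sum>i\<in>UNIV. \<Sum>l\<in>UNIV. A (Inr (j, add_mset i C)) l * a $ l * v $ i)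
          = (\<Sum>i\<in>UNIV. \<Sum>l\<in>UNIV. A (Inr (j, add_mset l C)) i * a $ l * v $ i)"
        by (rule sum.cong[OF refl], rule sum.cong[OF refl], subst s, rule refl)
      also have "\<dots> = (\<Sum>l\<in>UNIV. \<Sum>i\<in>UNIV. A (Inr (j, add_mset l C)) i * v $ i * a $ l)"
        by (subst sum.swap) (simp add: mult_ac)
      finally show ?thesis unfolding Inr jC dS_Inr by simp
    qed
  qed
qed

text \<open>Row indices are multisets and hence symmetric already; the exchange of one row index
  with the column index adds the missing transposition. So the new entries depend on the combined
  multiset alone and \<open>jet_extension\<close> applies.\<close>

lemma holonomic_iff:
  assumes z: "z \<in> jet_coords (Suc n)" and A: "U.admissible A"
  shows "(theta_coords (Suc n) z, U.jet_of (theta_coords (Suc n) z) A) \<in> holonomic L.Jn U.Jn \<longleftrightarrow>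
    (\<exists>z'\<in>jet_coords (Suc (Suc n)). truncate_jet (Suc n) z' = z \<and>
      (\<forall>b\<in>jindex (Suc n). \<forall>i. A b i = direction (jcoord z') b i))"
proof -
  define x where "x = (theta_coords (Suc n) z :: ('p, 'q) tower)"
  have x: "x \<in> pts U.Jn" unfolding x_def by (rule U.theta_in[OF z])
  have k: "tower_coord (Suc n) x = jcoord z" unfolding x_def by (rule U.tower_coord_theta[OF z])
  have "(x, U.jet_of x A) \<in> holonomic L.Jn U.Jn \<longleftrightarrow>
      (\<forall>b\<in>jindex n. \<forall>i. A b i = direction (jcoord z) b i) \<and>
      (\<forall>j C i l. size C \<le> n \<longrightarrow> A (Inr (j, add_mset i C)) l = A (Inr (j, add_mset l C)) i)"
    unfolding holonomic_def mem_Collect_eq case_prod_conv related_iff[OF x] k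
    using symmetric_iff[OF x A, unfolded k] by blast
  also have "\<dots> \<longleftrightarrow> (\<exists>z'\<in>jet_coords (Suc (Suc n)). truncate_jet (Suc n) z' = z \<and>
      (\<forall>b\<in>jindex (Suc n). \<forall>i. A b i = direction (jcoord z') b i))"
  proof (intro iffI, elim conjE)
    assume low: "\<forall>b\<in>jindex n. \<forall>i. A b i = direction (jcoord z) b i"
      and sym: "\<forall>j C i l. size C \<le> n \<longrightarrow> A (Inr (j, add_mset i C)) l = A (Inr (j, add_mset l C)) i"
    show "\<exists>z'\<in>jet_coords (Suc (Suc n)). truncate_jet (Suc n) z' = z \<and>
        (\<forall>b\<in>jindex (Suc n). \<forall>i. A b i = direction (jcoord z') b i)"
    proof (rule jet_extension[OF z])
      show "A (Inl k) i = (if k = i then 1 else 0)" for k i using A by (simp add: U.admissible_def)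
      show "A (Inr (j, C)) i = snd z (add_mset i C) $ j" if "size C < Suc n" for j C i
        using low[rule_format, of "Inr (j, C)" i] that by simp
      fix j :: 'q and C C' :: "'p multiset" and i i' :: 'p assume C: "size C = Suc n" and eq: "add_mset i C = add_mset i' C'"
      \<comment> \<open>Two ways to split one element off a multiset either coincide or differ by
        exchanging the two elements, the case covered by \<open>sym\<close>.\<close>
      from eq consider "C = C'" "i = i'" | D where "C = add_mset i' D" "C' = add_mset i D"
        unfolding add_eq_conv_ex by blast
      then show "A (Inr (j, C)) i = A (Inr (j, C')) i'"
      proof cases
        case 2
        with C sym show ?thesis by simp
      qed simp
    qed
  next
    assume "\<exists>z'\<in>jet_coords (Suc (Suc n)). truncate_jet (Suc n) z' = z \<and>
        (\<forall>b\<in>jindex (Suc n). \<forall>i. A b i = direction (jcoord z') b i)"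
    then obtain z' where z': "truncate_jet (Suc n) z' = z"
      "\<And>b i. b \<in> jindex (Suc n) \<Longrightarrow> A b i = direction (jcoord z') b i" by blast
    have k': "jcoord z b = jcoord z' b" if "b \<in> jindex (Suc n)" for b
      using z'(1) jcoord_truncate_jet[OF that, of z'] by simp
    have "A b i = direction (jcoord z) b i" if b: "b \<in> jindex n" for b i
    proof (cases b)
      case (Inl m) then show ?thesis using z'(2)[of b i] by simp
    next
      case (Inr jC)
      obtain j C where "jC = (j, C)" by force
      with Inr b show ?thesis using z'(2)[of b i] k'[of "Inr (j, add_mset i C)"] by simp
    qed
    moreover have "A (Inr (j, add_mset i C)) l = A (Inr (j, add_mset l C)) i" if "size C \<le> n" for j C i l
      using z'(2)[of "Inr (j, add_mset i C)" l] z'(2)[of "Inr (j, add_mset l C)" i] that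
      by (simp add: add_mset_commute)
    ultimately show "(\<forall>b\<in>jindex n. \<forall>i. A b i = direction (jcoord z) b i) \<and>
        (\<forall>j C i l. size C \<le> n \<longrightarrow> A (Inr (j, add_mset i C)) l = A (Inr (j, add_mset l C)) i)" by blast
  qed
  finally show ?thesis by (simp only: x_def)
qed

end

section \<open>Induction along the tower\<close>

lemma tower_ok_0: "tower_ok (ty :: ('p::finite \<times> 'q::finite) itself) 0"
proof -
  have inj: "inj_on (theta_coords 0 :: _ \<Rightarrow> ('p, 'q) tower) (jet_coords 0)"
  proof (rule inj_onI)
    fix z z' :: "('p, 'q) jcoords"
    assume z: "z \<in> jet_coords 0" "z' \<in> jet_coords 0" and eq: "theta_coords 0 z = (theta_coords 0 z' :: ('p, 'q) tower)"
    show "z = z'"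
      by (rule jcoord_eqI[OF z]) (use eq in \<open>auto simp: jindex_def\<close>)
  qed
  have z: "(x, \<lambda>A. if A = {#} then u else 0) \<in> jet_coords 0" "theta_coords 0 (x, \<lambda>A. if A = {#} then u else 0) = Pt (x, u)"
    for x :: "real ^ 'p" and u :: "real ^ 'q"
    by (auto simp: jet_coords_def)
  have pts0: "pts (jets 0 :: ('p, 'q) tower fspace) = range Pt"
    by (simp add: image_space_def)
  have "theta_coords 0 ` jet_coords 0 = (range Pt :: ('p, 'q) tower set)"
  proof
    show "range Pt \<subseteq> theta_coords 0 ` (jet_coords 0 :: ('p, 'q) jcoords set)"
    proof
      fix y :: "('p, 'q) tower" assume "y \<in> range Pt"
      then obtain x u where "y = Pt (x, u)" by auto
      then show "y \<in> theta_coords 0 ` jet_coords 0" using z[of x u] by (metis image_eqI)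
    qed
  qed auto
  with inj pts0 have bij: "bij_betw (theta_coords 0 :: _ \<Rightarrow> ('p, 'q) tower) (jet_coords 0) (pts (jets 0))"
    by (simp add: bij_betw_def)
  have co: "tower_coord 0 (Pt e :: ('p, 'q) tower) (Inl i) = fst e $ i"
    "tower_coord 0 (Pt e :: ('p, 'q) tower) (Inr (j, {#})) = snd e $ j" for e i j
  proof -
    define \<zeta> where "\<zeta> = (fst e, \<lambda>A :: 'p multiset. if A = {#} then snd e else 0)"
    have "\<zeta> \<in> jet_coords 0" "theta_coords 0 \<zeta> = Pt e"
      using z[of "fst e" "snd e"] by (simp_all add: \<zeta>_def)
    then have "tower_coord 0 (Pt e :: ('p, 'q) tower) = jcoord \<zeta>"
      unfolding tower_coord_def by (metis bij_betw_inv_into_left[OF bij])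
    then show "tower_coord 0 (Pt e :: ('p, 'q) tower) (Inl i) = fst e $ i"
      "tower_coord 0 (Pt e :: ('p, 'q) tower) (Inr (j, {#})) = snd e $ j"
      by (simp_all add: \<zeta>_def)
  qed
  have "c \<in> curves (jets 0) \<longleftrightarrow> range c \<subseteq> pts (jets 0) \<and> (\<forall>b\<in>jindex 0. smooth (\<lambda>r. tower_coord 0 (c r) b))"
    for c :: "real \<Rightarrow> ('p, 'q) tower"
  proof -
    have sm: "(\<forall>b\<in>jindex 0. smooth (\<lambda>r. tower_coord 0 (Pt (d r) :: ('p, 'q) tower) b)) \<longleftrightarrow> smooth d" for d :: "real \<Rightarrow> _"
    proof -
      have j0: "(jindex 0 :: ('p, 'q) jindex set) = range Inl \<union> range (\<lambda>j. Inr (j, {#}))"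
        by (auto simp: jindex_def)
      have 1: "smooth (\<lambda>r. fst (d r)) \<longleftrightarrow> (\<forall>i. smooth (\<lambda>r. fst (d r) $ i))"
        and 2: "smooth (\<lambda>r. snd (d r)) \<longleftrightarrow> (\<forall>j. smooth (\<lambda>r. snd (d r) $ j))"
        by (rule smooth_vec_iff)+
      have 3: "smooth (\<lambda>r. fst (d r)) \<and> smooth (\<lambda>r. snd (d r)) \<longleftrightarrow> smooth d"
        using smooth_fst[of d] smooth_snd[of d] smooth_Pair[of "\<lambda>r. fst (d r)" "\<lambda>r. snd (d r)"]
        unfolding prod.collapse by blast
      show ?thesis unfolding 3[symmetric] 1 2 j0 ball_Un ball_simps co by blast
    qed
    show ?thesis
    proof
      assume "c \<in> curves (jets 0)"
      then obtain d where d: "smooth d" "c = Pt \<circ> d" by (auto simp: image_space_def)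
      then show "range c \<subseteq> pts (jets 0) \<and> (\<forall>b\<in>jindex 0. smooth (\<lambda>r. tower_coord 0 (c r) b))"
        using sm[of d] unfolding pts0 by auto
    next
      assume c: "range c \<subseteq> pts (jets 0) \<and> (\<forall>b\<in>jindex 0. smooth (\<lambda>r. tower_coord 0 (c r) b))"
      then have "\<forall>r. \<exists>d. c r = Pt d" unfolding pts0 by blast
      then obtain d where d: "\<And>r. c r = Pt (d r)" by metis
      with c sm[of d] have "smooth d" by simp
      then have "Pt \<circ> d \<in> curves (jets 0 :: ('p, 'q) tower fspace)" by (simp add: image_space_def)
      moreover have "c = Pt \<circ> d" by (simp add: d fun_eq_iff)
      ultimately show "c \<in> curves (jets 0)" by simp
    qed
  qed
  with bij show ?thesis unfolding tower_ok_def by blast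
qed

lemma subspace_on_UNIV: "subspace_on Y UNIV = Y"
  by (cases Y) (simp add: subspace_on_def)

text \<open>No symmetry is at stake at order 1: the fibre rows have empty lower index, so the
  combined multiset is the column itself and every admissible matrix extends.\<close>

lemma tower_ok_1: "tower_ok (ty :: ('p::finite \<times> 'q::finite) itself) (Suc 0)"
proof -
  interpret tower ty 0 by (rule tower.intro[OF tower_ok_0])
  show ?thesis
  proof (rule tower_step[where H=UNIV])
    show "jets (Suc 0) = image_space encode (subspace_on (jets1 euclid Jn foot) UNIV)"
      by (simp add: subspace_on_UNIV)
    fix z :: "('p, 'q) jcoords" and A assume z: "z \<in> jet_coords 0" and A: "admissible A"
    have "\<exists>z'\<in>jet_coords (Suc 0). truncate_jet 0 z' = z \<and> (\<forall>b\<in>jindex 0. \<forall>i. A b i = direction (jcoord z') b i)"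
      by (rule jet_extension[OF z]) (use A in \<open>auto simp: admissible_def\<close>)
    then show "(theta_coords 0 z, jet_of (theta_coords 0 z) A) \<in> UNIV \<longleftrightarrow>
        (\<exists>z'\<in>jet_coords (Suc 0). truncate_jet 0 z' = z \<and> (\<forall>b\<in>jindex 0. \<forall>i. A b i = direction (jcoord z') b i))"
      by simp
  qed
qed

text \<open>Two consecutive orders are carried, since the holonomic condition refers to
  both.\<close>

lemma tower_ok_all: "tower_ok (ty :: ('p::finite \<times> 'q::finite) itself) n"
proof -
  have "tower_ok ty n \<and> tower_ok ty (Suc n)"
  proof (induction n)
    case 0 show ?case using tower_ok_0 tower_ok_1 by blast
  next
    case (Suc n)
    then interpret tower2 ty n by (intro tower2.intro tower.intro) auto
    have "tower_ok ty (Suc (Suc n))"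
      by (rule U.tower_step[OF _ holonomic_iff]) simp
    with Suc show ?case by blast
  qed
  then show ?thesis by blast
qed

theorem theta_coords_bij:
  "bij_betw (theta_coords n) (jet_coords n) (pts (jets n :: ('p::finite, 'q::finite) tower fspace))"
  using tower_ok_all[of "TYPE('p \<times> 'q)" n] unfolding tower_ok_def by blast

subsection \<open>Taylor coefficients\<close>

definition monomial :: "'p multiset \<Rightarrow> real ^ 'p::finite \<Rightarrow> real" where
  "monomial A v = (\<Prod>i\<in>#A. v $ i)"

lemma monomial_simps [simp]:
  "monomial {#} v = 1" "monomial (add_mset i A) v = v $ i * monomial A v"
  by (simp_all add: monomial_def)

lemma monomial_at_0: "A \<noteq> {#} \<Longrightarrow> monomial A 0 = 0"
  by (cases A) simp_all

lemma smooth_monomial: "smooth (monomial A)"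
proof (induction A)
  case empty
  have "monomial {#} = (\<lambda>v :: real ^ 'a. 1)" by (simp add: fun_eq_iff)
  then show ?case by simp
next
  case (add i A)
  have "smooth (\<lambda>v. v $ i * monomial A v)"
    by (intro smooth_mult smooth_vec_nth smooth_ident add)
  moreover have "monomial (add_mset i A) = (\<lambda>v. v $ i * monomial A v)" by (simp add: fun_eq_iff)
  ultimately show ?case by simp
qed

lemma ideal_Dpn_eq: "ideal_Dpn n = gen_ideal {monomial A | A. size A = Suc n}"
  unfolding ideal_Dpn_def monomial_def[abs_def] by simp

lemma monomial_generator_smooth: "s \<in> {monomial A | A. size A = Suc n} \<Longrightarrow> smooth s"
  using smooth_monomial by blast

lemma weil_ideal_Dpn: "weil_ideal (ideal_Dpn n)"
  unfolding ideal_Dpn_eq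
proof (rule weil_ideal_gen_ideal)
  fix s :: "real ^ 'a \<Rightarrow> real"
  assume "s \<in> {monomial A | A. size A = Suc n}"
  then obtain A where "s = monomial A" "size A = Suc n" by blast
  then show "smooth s \<and> s 0 = 0" by (auto simp: smooth_monomial intro!: monomial_at_0)
qed

lemma monomial_in_ideal_Dpn: "size A = Suc n \<Longrightarrow> smooth a \<Longrightarrow> (\<lambda>v. a v * monomial A v) \<in> ideal_Dpn n"
  unfolding ideal_Dpn_eq by (rule gen_ideal_generator) auto

lemma coordinate_mult_ideal_Dpn:
  assumes "f \<in> ideal_Dpn n" shows "(\<lambda>v. v $ i * f v) \<in> ideal_Dpn (Suc n)"
proof -
  have "(\<lambda>v. v $ i * f v) \<in> ideal_Dpn (Suc n) \<and> smooth f"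
    using assms unfolding ideal_Dpn_eq[of n]
  proof (induction rule: gen_ideal_induct)
    case zero show ?case by (simp add: weil_ideal_zero[OF weil_ideal_Dpn])
  next
    case (add f a s)
    then obtain A where A: "s = monomial A" "size A = Suc n" by blast
    have "(\<lambda>v. a v * monomial (add_mset i A) v) \<in> ideal_Dpn (Suc n)"
      by (rule monomial_in_ideal_Dpn) (use A add in auto)
    from weil_ideal_add[OF weil_ideal_Dpn add(1) this] show ?case by (simp add: A(1) algebra_simps)
  qed (rule monomial_generator_smooth)
  then show ?thesis by blast
qed

text \<open>Hadamard's lemma in several variables: f is compared at v and at the constant point 0,
  whose coordinates differ by the generators v_i.\<close>

lemma minus_value_in_ideal_Dpn_0:
  fixes f :: "real ^ 'p::finite \<Rightarrow> real"
  assumes "smooth f" shows "(\<lambda>v. f v - f 0) \<in> ideal_Dpn 0"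
proof (rule vec.smooth_function_diff_in_ideal[OF _ weil_ideal_Dpn])
  show "f \<in> smooth_functions (euclid :: (real ^ 'p) fspace)"
    using smooth_compose[OF assms] by (auto simp: mor_def euclid_def o_def)
  show "(\<lambda>v. v $ i - 0 $ i) \<in> ideal_Dpn 0" for i
    using monomial_in_ideal_Dpn[of "{#i#}" 0 "\<lambda>_. 1"] by simp
qed (auto simp: vec.mor_euclid_iff intro!: smooth_vec_nth)

lemma sum_monomials_shift:
  "(\<Sum>A | size A \<le> n. a A * monomial (add_mset i A) v)
    = (\<Sum>D | size D \<le> Suc n. (if i \<in># D then a (D - {#i#}) else 0) * monomial D (v :: real ^ 'p::finite))"
proof -
  have "(\<Sum>A | size A \<le> n. a A * monomial (add_mset i A) v)
      = (\<Sum>D\<in>add_mset i ` {A. size A \<le> n}. (if i \<in># D then a (D - {#i#}) else 0) * monomial D v)"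
    by (subst sum.reindex) (auto simp: inj_on_def)
  also have "\<dots> = (\<Sum>D | size D \<le> Suc n. (if i \<in># D then a (D - {#i#}) else 0) * monomial D v)"
  proof (rule sum.mono_neutral_left[OF finite_multisets_size])
    show "\<forall>D\<in>{D. size D \<le> Suc n} - add_mset i ` {A. size A \<le> n}. (if i \<in># D then a (D - {#i#}) else 0) * monomial D v = 0"
    proof
      fix D assume D: "D \<in> {D. size D \<le> Suc n} - add_mset i ` {A. size A \<le> n}"
      have "i \<notin># D"
      proof
        assume "i \<in># D"
        then obtain A where "D = add_mset i A" by (meson multi_member_split)
        with D show False by auto
      qed
      then show "(if i \<in># D then a (D - {#i#}) else 0) * monomial D v = 0" by simp
    qed
  qed auto
  finally show ?thesis .
qed

text \<open>Membership of f - f 0 in the ideal of order 0 writes it as a sum of terms h * v_i.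
  Expanding each h to order n and multiplying by v_i gives the expansion of order n + 1.\<close>

lemma taylor_expansion:
  fixes f :: "real ^ 'p::finite \<Rightarrow> real"
  assumes "smooth f"
  shows "\<exists>a. (\<lambda>v. f v - (\<Sum>A | size A \<le> n. a A * monomial A v)) \<in> ideal_Dpn n"
  using assms
proof (induction n arbitrary: f)
  case 0
  have "(\<Sum>A | size A \<le> 0. (\<lambda>_. f 0) A * monomial A v) = f 0" for v :: "real ^ 'p" by simp
  with minus_value_in_ideal_Dpn_0[OF 0] show ?case by (intro exI[of _ "\<lambda>_. f 0"]) simp
next
  case (Suc n)
  let ?P = "\<lambda>g :: real ^ 'p \<Rightarrow> real. \<exists>a. (\<lambda>v. g v - (\<Sum>A | size A \<le> Suc n. a A * monomial A v)) \<in> ideal_Dpn (Suc n)"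
  have const: "(\<Sum>A | size A \<le> Suc n. (if A = {#} then c else 0) * monomial A v) = c" for c and v :: "real ^ 'p"
  proof -
    have "(\<Sum>A | size A \<le> Suc n. (if A = {#} then c else 0) * monomial A v)
        = (\<Sum>A | size (A :: 'p multiset) \<le> Suc n. if A = {#} then c else 0)"
      by (rule sum.cong) auto
    also have "\<dots> = c" using finite_multisets_size[where ?'p='p, of "Suc n"] by (simp add: sum.delta)
    finally show ?thesis .
  qed
  have add_expansion: "?P (\<lambda>v. g v + h v)" if "?P g" "?P h" for g h
  proof -
    obtain a b where "(\<lambda>v. g v - (\<Sum>A | size A \<le> Suc n. a A * monomial A v)) \<in> ideal_Dpn (Suc n)"
      "(\<lambda>v. h v - (\<Sum>A | size A \<le> Suc n. b A * monomial A v)) \<in> ideal_Dpn (Suc n)"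
      using \<open>?P g\<close> \<open>?P h\<close> by blast
    from weil_ideal_add[OF weil_ideal_Dpn this] show ?thesis
      by (intro exI[of _ "\<lambda>A. a A + b A"]) (simp add: distrib_right sum.distrib algebra_simps)
  qed
  have "?P (\<lambda>v. f v - f 0) \<and> smooth (\<lambda>v. f v - f 0)"
    using minus_value_in_ideal_Dpn_0[OF Suc.prems] unfolding ideal_Dpn_eq[of 0]
  proof (induction rule: gen_ideal_induct)
    case zero
    show ?case by (rule exI[of _ "\<lambda>_. 0"]) (simp add: weil_ideal_zero[OF weil_ideal_Dpn])
  next
    case (add g h s)
    then obtain A where "s = monomial A" "size A = Suc 0" by auto
    then obtain i where s: "s = (\<lambda>v. v $ i)"
      by (cases A) (auto simp: fun_eq_iff)
    obtain b where b: "(\<lambda>v. h v - (\<Sum>A | size A \<le> n. b A * monomial A v)) \<in> ideal_Dpn n"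
      using Suc.IH[OF add(3)] by blast
    have "(\<lambda>v. v $ i * (h v - (\<Sum>A | size A \<le> n. b A * monomial A v))) \<in> ideal_Dpn (Suc n)"
      by (rule coordinate_mult_ideal_Dpn[OF b])
    moreover have "v $ i * (h v - (\<Sum>A | size A \<le> n. b A * monomial A v)) =
        h v * s v - (\<Sum>D | size D \<le> Suc n. (if i \<in># D then b (D - {#i#}) else 0) * monomial D v)" for v
      unfolding sum_monomials_shift[symmetric] by (simp add: s right_diff_distrib sum_distrib_left mult_ac)
    ultimately have "?P (\<lambda>v. h v * s v)" by (intro exI) simp
    with add(1) show ?case by (rule add_expansion)
  qed (rule monomial_generator_smooth)
  moreover have "?P (\<lambda>_. f 0)"
    by (rule exI[of _ "\<lambda>A. if A = {#} then f 0 else 0"])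
      (simp only: const diff_self weil_ideal_zero[OF weil_ideal_Dpn])
  ultimately have "?P (\<lambda>v. (f v - f 0) + f 0)" by (intro add_expansion) auto
  then show ?case by simp
qed

section \<open>Partial derivatives and uniqueness of Taylor coefficients\<close>

definition partial :: "'p::finite \<Rightarrow> (real ^ 'p \<Rightarrow> real) \<Rightarrow> real ^ 'p \<Rightarrow> real" where
  "partial i f v = deriv (\<lambda>t. f (v + t *\<^sub>R axis i 1)) 0"

lemma smooth_axis_line: "smooth f \<Longrightarrow> smooth (\<lambda>t. f (v + t *\<^sub>R axis i 1))" for f :: "real ^ 'p::finite \<Rightarrow> real"
  by (erule smooth_compose) (intro smooth_add smooth_scaleR smooth_const smooth_ident)

lemma smooth_partial_axis: "smooth f \<Longrightarrow> smooth (partial i f)"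
  unfolding partial_def[abs_def] by (rule smooth_dir_deriv)

lemma partial_add: "smooth f \<Longrightarrow> smooth g \<Longrightarrow> partial i (\<lambda>v. f v + g v) v = partial i f v + partial i g v"
  unfolding partial_def by (intro deriv_add_smooth smooth_axis_line)

lemma partial_mult:
  "smooth f \<Longrightarrow> smooth g \<Longrightarrow> partial i (\<lambda>v. f v * g v) v = f v * partial i g v + partial i f v * g v"
  unfolding partial_def by (subst deriv_mult_smooth) (auto intro: smooth_axis_line)

lemma partial_const [simp]: "partial i (\<lambda>_. c) v = 0"
  by (simp add: partial_def)

lemma partial_sum:
  "(\<And>k. k \<in> S \<Longrightarrow> smooth (f k)) \<Longrightarrow> partial i (\<lambda>v. \<Sum>k\<in>S. f k v) v = (\<Sum>k\<in>S. partial i (f k) v)"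
  by (induction S rule: infinite_finite_induct) (auto simp: partial_add smooth_sum)

lemma partial_coordinate: "partial i (\<lambda>v. v $ j) v = (if i = j then 1 else 0)"
  unfolding partial_def by (rule DERIV_imp_deriv) (auto simp: axis_def intro!: derivative_eq_intros)

lemma partial_monomial: "partial i (monomial A) v = real (count A i) * monomial (A - {#i#}) v"
proof (induction A)
  case empty
  have "monomial {#} = (\<lambda>v :: real ^ 'a. 1)" by (simp add: fun_eq_iff)
  then show ?case by simp
next
  case (add j A)
  have "monomial (add_mset j A) = (\<lambda>v. v $ j * monomial A v)" by (simp add: fun_eq_iff)
  then have eq: "partial i (monomial (add_mset j A)) v
      = v $ j * (real (count A i) * monomial (A - {#i#}) v) + (if i = j then 1 else 0) * monomial A v"
    by (simp add: partial_mult smooth_vec_nth smooth_monomial partial_coordinate add)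
  show ?case
  proof (cases "i \<in># A")
    case True
    then obtain C where "A = add_mset i C" by (meson multi_member_split)
    then show ?thesis unfolding eq by (cases "i = j") (simp_all add: algebra_simps)
  next
    case False
    then show ?thesis unfolding eq by (cases "i = j") (simp_all add: not_in_iff)
  qed
qed

text \<open>In the product rule the derivative of a generator loses one factor, and in the other
  term one factor is moved into the coefficient; so the order drops by one.\<close>

lemma partial_ideal_Dpn:
  assumes "f \<in> ideal_Dpn (Suc n)" shows "partial i f \<in> ideal_Dpn n"
proof -
  have "partial i f \<in> ideal_Dpn n \<and> smooth f"
    using assms unfolding ideal_Dpn_eq[of "Suc n"]
  proof (induction rule: gen_ideal_induct)
    case zero show ?case by (simp add: partial_def weil_ideal_zero[OF weil_ideal_Dpn])
  next
    case (add f a s)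
    then obtain A where A: "s = monomial A" "size A = Suc (Suc n)" by auto
    then obtain j C where C: "A = add_mset j C" "size C = Suc n" by (cases A) auto
    have 1: "(\<lambda>v. a v * partial i s v) \<in> ideal_Dpn n"
    proof (cases "i \<in># A")
      case True
      then obtain D where D: "A = add_mset i D" by (meson multi_member_split)
      have "partial i s = (\<lambda>v. real (count A i) * monomial D v)"
        unfolding A(1) by (rule ext) (simp add: partial_monomial D)
      moreover have "size D = Suc n" using A(2) by (simp add: D)
      ultimately show ?thesis using monomial_in_ideal_Dpn[of D n "\<lambda>v. a v * real (count A i)"] add(3)
        by (simp add: smooth_mult mult.assoc)
    next
      case False
      then show ?thesis by (simp add: A partial_monomial not_in_iff weil_ideal_zero[OF weil_ideal_Dpn])
    qed
    have "(\<lambda>v. (partial i a v * v $ j) * monomial C v) \<in> ideal_Dpn n"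
      by (rule monomial_in_ideal_Dpn[OF C(2)]) (intro smooth_mult smooth_partial_axis add smooth_vec_nth smooth_ident)
    then have 2: "(\<lambda>v. partial i a v * s v) \<in> ideal_Dpn n" by (simp add: A C mult.assoc)
    have "partial i (\<lambda>v. f v + a v * s v) = (\<lambda>v. partial i f v + (a v * partial i s v + partial i a v * s v))"
      using add by (simp add: fun_eq_iff partial_add partial_mult smooth_mult)
    then show ?case
      using weil_ideal_add[OF weil_ideal_Dpn add(1) weil_ideal_add[OF weil_ideal_Dpn 1 2]] by simp
  qed (rule monomial_generator_smooth)
  then show ?thesis by blast
qed

text \<open>Evaluation at 0 isolates the constant coefficient. Any other coefficient is reached by
  differentiating in a direction i of its multiset, which shifts the coefficients with a nonzero
  factor and lowers the order.\<close>

lemma taylor_coefficients_unique: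
  assumes "(\<lambda>v :: real ^ 'p::finite. \<Sum>A | size A \<le> n. c A * monomial A v) \<in> ideal_Dpn n" "size A \<le> n"
  shows "c A = 0"
proof -
  have c_empty: "c {#} = 0" if "(\<lambda>v :: real ^ 'p. \<Sum>A | size A \<le> n. c A * monomial A v) \<in> ideal_Dpn n" for n c
  proof -
    have "0 = (\<Sum>A | size A \<le> n. c A * monomial A (0 :: real ^ 'p))"
      using weil_ideal_vanishes[OF weil_ideal_Dpn that] by simp
    also have "\<dots> = (\<Sum>A | size (A :: 'p multiset) \<le> n. if A = {#} then c {#} else 0)"
      by (rule sum.cong) (auto simp: monomial_at_0)
    also have "\<dots> = c {#}" using finite_multisets_size[where ?'p='p, of n] by (simp add: sum.delta)
    finally show ?thesis by simp
  qed
  show ?thesis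
    using assms
  proof (induction n arbitrary: c A)
    case 0 then show ?case using c_empty[OF 0(1)] by simp
  next
    case (Suc n)
    show ?case
    proof (cases A)
      case empty
      then show ?thesis using c_empty[OF Suc.prems(1)] by simp
    next
      case (add i C)
      have "partial i (\<lambda>v. \<Sum>A | size A \<le> Suc n. c A * monomial A v) v
          = (\<Sum>A | size A \<le> n. (c (add_mset i A) * real (Suc (count A i))) * monomial A v)" for v :: "real ^ 'p"
      proof -
        have "partial i (\<lambda>v. \<Sum>A | size A \<le> Suc n. c A * monomial A v) v
            = (\<Sum>A | size A \<le> Suc n. c A * (real (count A i) * monomial (A - {#i#}) v))"
          by (subst partial_sum) (auto intro!: smooth_mult smooth_monomial sum.cong simp: partial_mult smooth_monomial partial_monomial)
        also have "\<dots> = (\<Sum>A \<in> add_mset i ` {A. size A \<le> n}. c A * (real (count A i) * monomial (A - {#i#}) v))"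
        proof (rule sum.mono_neutral_right[OF finite_multisets_size])
          show "\<forall>D\<in>{D. size D \<le> Suc n} - add_mset i ` {A. size A \<le> n}. c D * (real (count D i) * monomial (D - {#i#}) v) = 0"
          proof
            fix D assume D: "D \<in> {D. size D \<le> Suc n} - add_mset i ` {A. size A \<le> n}"
            have "i \<notin># D"
            proof
              assume "i \<in># D"
              then obtain A where "D = add_mset i A" by (meson multi_member_split)
              with D show False by auto
            qed
            then show "c D * (real (count D i) * monomial (D - {#i#}) v) = 0" by (simp add: not_in_iff)
          qed
        qed auto
        also have "\<dots> = (\<Sum>A | size A \<le> n. (c (add_mset i A) * real (Suc (count A i))) * monomial A v)"
          by (subst sum.reindex) (auto simp: inj_on_def mult.assoc)
        finally show ?thesis .
      qed
      then have "partial i (\<lambda>v. \<Sum>A | size A \<le> Suc n. c A * monomial A v)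
          = (\<lambda>v. \<Sum>A | size A \<le> n. (c (add_mset i A) * real (Suc (count A i))) * monomial A v)" by blast
      with partial_ideal_Dpn[OF Suc.prems(1), of i]
      have "(\<lambda>v :: real ^ 'p. \<Sum>A | size A \<le> n. (c (add_mset i A) * real (Suc (count A i))) * monomial A v) \<in> ideal_Dpn n"
        by simp
      from Suc.IH[OF this, of C] Suc.prems(2) have "c (add_mset i C) * real (Suc (count C i)) = 0"
        by (simp add: add)
      then show ?thesis by (simp add: add del: of_nat_Suc)
    qed
  qed
qed

section \<open>The total space and the Taylor coordinates of jets\<close>

lemma prod_space_euclid:
  "prod_space euclid euclid = (euclid :: ('a::euclidean_space \<times> 'b::euclidean_space) fspace)"
proof -
  have "smooth (fst \<circ> c) \<and> smooth (snd \<circ> c) \<longleftrightarrow> smooth c" for c :: "real \<Rightarrow> 'a \<times> 'b"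
    using smooth_fst[of c] smooth_snd[of c] smooth_Pair[of "fst \<circ> c" "snd \<circ> c"] by (auto simp: o_def)
  then show ?thesis by (simp add: prod_space_def euclid_def)
qed

interpretation total: charted "euclid :: ((real ^ 'p::finite) \<times> (real ^ 'q::finite)) fspace" "UNIV <+> UNIV"
  "\<lambda>(x, y). case_sum (\<lambda>i. x $ i) (\<lambda>j. y $ j)"
  unfolding prod_space_euclid[symmetric] by (rule charted_prod[OF charted_euclid_vec charted_euclid_vec])

definition taylor_polynomial :: "nat \<Rightarrow> ('p::finite, 'q::finite) jcoords \<Rightarrow> real ^ 'p \<Rightarrow> (real ^ 'p) \<times> (real ^ 'q)" where
  "taylor_polynomial n z v =
     (fst z, \<Sum>A | size A \<le> n. (monomial A v / (\<Prod>i\<in>UNIV. fact (count A i))) *\<^sub>R snd z A)"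

lemma taylor_eq: "taylor n z = tcls euclid (ideal_Dpn n) (taylor_polynomial n z)"
  unfolding taylor_def taylor_polynomial_def[abs_def] monomial_def by (simp add: case_prod_unfold)

lemma taylor_polynomial_snd:
  "snd (taylor_polynomial n z v) $ j = (\<Sum>A | size A \<le> n. (snd z A $ j / (\<Prod>i\<in>UNIV. fact (count A i))) * monomial A v)"
  by (simp add: taylor_polynomial_def mult.commute)

lemma total_mor_iff:
  "f \<in> mor (euclid :: 'k::euclidean_space fspace) (euclid :: ((real ^ 'p::finite) \<times> (real ^ 'q::finite)) fspace) \<longleftrightarrow>
    (\<forall>i. smooth (\<lambda>v. fst (f v) $ i)) \<and> (\<forall>j. smooth (\<lambda>v. snd (f v) $ j))"
  unfolding total.mor_euclid_iff by (simp add: Plus_def ball_Un case_prod_unfold)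

lemma total_tcls_eq_iff:
  assumes "weil_ideal I" "f \<in> mor euclid euclid" "g \<in> mor euclid euclid"
  shows "tcls (euclid :: ((real ^ 'p::finite) \<times> (real ^ 'q::finite)) fspace) I f = tcls euclid I g \<longleftrightarrow>
    (\<forall>i. (\<lambda>v. fst (f v) $ i - fst (g v) $ i) \<in> I) \<and> (\<forall>j. (\<lambda>v. snd (f v) $ j - snd (g v) $ j) \<in> I)"
  unfolding total.tcls_eq_iff[OF assms] by (simp add: Plus_def ball_Un case_prod_unfold)

lemma taylor_polynomial_mor: "taylor_polynomial n z \<in> mor euclid euclid"
proof -
  have "smooth (\<lambda>v. snd (taylor_polynomial n z v) $ j)" for j
    unfolding taylor_polynomial_snd by (intro smooth_sum smooth_mult smooth_const smooth_monomial)
  then show ?thesis unfolding total_mor_iff by (simp add: taylor_polynomial_def)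
qed

lemma fst_total_smooth_map: "smooth_map (euclid :: ((real ^ 'p::finite) \<times> (real ^ 'q::finite)) fspace) euclid fst"
  by (auto simp: smooth_map_def o_def intro: smooth_fst)

text \<open>Injectivity is uniqueness of Taylor coefficients and surjectivity their existence,
  componentwise in the fibre; the base component of a coordinate jet is constant modulo the ideal
  and contributes its value alone.\<close>

theorem taylor_bij: "bij_betw (taylor n) (jet_coords n) (coord_jets n :: (real ^ 'p::finite, (real ^ 'p) \<times> (real ^ 'q::finite)) wclass set)"
  unfolding bij_betw_def
proof
  show "inj_on (taylor n) (jet_coords n :: ('p, 'q) jcoords set)"
  proof (rule inj_onI)
    fix z z' :: "('p, 'q) jcoords"
    assume z: "z \<in> jet_coords n" "z' \<in> jet_coords n" and "taylor n z = taylor n z'"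
    then have eq: "(\<lambda>v. fst (taylor_polynomial n z v) $ i - fst (taylor_polynomial n z' v) $ i) \<in> ideal_Dpn n"
      "(\<lambda>v. snd (taylor_polynomial n z v) $ j - snd (taylor_polynomial n z' v) $ j) \<in> ideal_Dpn n" for i j
      unfolding taylor_eq total_tcls_eq_iff[OF weil_ideal_Dpn taylor_polynomial_mor taylor_polynomial_mor] by blast+
    have fst: "fst z $ i = fst z' $ i" for i
      using weil_ideal_vanishes[OF weil_ideal_Dpn eq(1), of i] by (simp add: taylor_polynomial_def)
    have snd: "snd z A $ j = snd z' A $ j" if A: "size A \<le> n" for A j
    proof -
      have "(\<lambda>v. \<Sum>A | size A \<le> n. ((snd z A $ j - snd z' A $ j) / (\<Prod>i\<in>UNIV. fact (count A i))) * monomial A v) \<in> ideal_Dpn n"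
        using eq(2)[of j] unfolding taylor_polynomial_snd
        by (simp add: sum_subtractf[symmetric] left_diff_distrib diff_divide_distrib)
      from taylor_coefficients_unique[OF this A] show ?thesis by simp
    qed
    show "z = z'"
      by (rule jcoord_eqI[OF z]) (auto simp: jindex_def fst snd)
  qed
  show "taylor n ` jet_coords n = (coord_jets n :: (real ^ 'p, (real ^ 'p) \<times> (real ^ 'q)) wclass set)"
  proof
    have "taylor n z \<in> coord_jets n" for z :: "('p, 'q) jcoords"
    proof -
      have "tmap euclid (ideal_Dpn n) fst (taylor n z) = tcls euclid (ideal_Dpn n) (fst \<circ> taylor_polynomial n z)"
        unfolding taylor_eq by (rule tmap_tcls[OF weil_ideal_Dpn total.froelicher fst_total_smooth_map taylor_polynomial_mor])
      also have "fst \<circ> taylor_polynomial n z = (\<lambda>_. fst z)" by (simp add: fun_eq_iff taylor_polynomial_def)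
      finally show ?thesis
        unfolding coord_jets_def taylor_eq pts_tensor using taylor_polynomial_mor[of n z] by blast
    qed
    then show "taylor n ` jet_coords n \<subseteq> (coord_jets n :: (real ^ 'p, (real ^ 'p) \<times> (real ^ 'q)) wclass set)" by blast
    show "(coord_jets n :: (real ^ 'p, (real ^ 'p) \<times> (real ^ 'q)) wclass set) \<subseteq> taylor n ` jet_coords n"
    proof
      fix \<gamma> :: "(real ^ 'p, (real ^ 'p) \<times> (real ^ 'q)) wclass" assume "\<gamma> \<in> coord_jets n"
      then obtain x where \<gamma>: "\<gamma> \<in> pts (tensor euclid (ideal_Dpn n))"
        and x: "tmap euclid (ideal_Dpn n) fst \<gamma> = tcls euclid (ideal_Dpn n) (\<lambda>_. x)"
        by (auto simp: coord_jets_def)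
      define g where "g = trep \<gamma>"
      have g: "g \<in> mor euclid euclid" "tcls euclid (ideal_Dpn n) g = \<gamma>"
        unfolding g_def by (rule trep_mor[OF weil_ideal_Dpn \<gamma>], rule tcls_trep[OF weil_ideal_Dpn \<gamma>])
      have "fst \<circ> g \<in> mor euclid euclid" by (rule smooth_map_comp_mor[OF fst_total_smooth_map g(1)])
      moreover have "(\<lambda>_. x) \<in> mor (euclid :: (real ^ 'p) fspace) euclid" by (simp add: vec.mor_euclid_iff)
      moreover have "tcls euclid (ideal_Dpn n) (fst \<circ> g) = tcls euclid (ideal_Dpn n) (\<lambda>_. x)"
        using x by (simp add: tmap_def g_def)
      ultimately have gx: "(\<lambda>v. fst (g v) $ i - x $ i) \<in> ideal_Dpn n" for i
        by (simp add: vec.tcls_eq_iff[OF weil_ideal_Dpn])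
      have "\<forall>j. \<exists>a. (\<lambda>v. snd (g v) $ j - (\<Sum>A | size A \<le> n. a A * monomial A v)) \<in> ideal_Dpn n"
        by (rule allI, rule taylor_expansion) (use g(1) in \<open>simp add: total_mor_iff\<close>)
      from choice[OF this] obtain a
        where a: "\<forall>j. (\<lambda>v. snd (g v) $ j - (\<Sum>A | size A \<le> n. a j A * monomial A v)) \<in> ideal_Dpn n" ..
      \<comment> \<open>The factorials undo the normalization in \<open>taylor\<close>, whose
        coordinates are partial derivatives rather than coefficients.\<close>
      define z where "z = (x, \<lambda>A. if size A \<le> n then \<chi> j. a j A * (\<Prod>i\<in>UNIV. fact (count A i)) else 0)"
      have z: "z \<in> jet_coords n" by (simp add: z_def jet_coords_def)
      have "snd (taylor_polynomial n z v) $ j = (\<Sum>A | size A \<le> n. a j A * monomial A v)" for v j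
        unfolding taylor_polynomial_snd by (rule sum.cong) (simp_all add: z_def)
      moreover have "fst (taylor_polynomial n z v) = x" for v by (simp add: taylor_polynomial_def z_def)
      ultimately have "tcls euclid (ideal_Dpn n) g = tcls euclid (ideal_Dpn n) (taylor_polynomial n z)"
        unfolding total_tcls_eq_iff[OF weil_ideal_Dpn g(1) taylor_polynomial_mor] using gx a by simp
      then have "\<gamma> = taylor n z" by (simp add: taylor_eq g(2))
      with z show "\<gamma> \<in> taylor n ` jet_coords n" by blast
    qed
  qed
qed

theorem theta_bij_betw:
  "bij_betw (theta n) (coord_jets n) (pts (jets n :: ('p::finite, 'q::finite) tower fspace))"
proof -
  have "bij_betw (coords n :: _ \<Rightarrow> ('p, 'q) jcoords) (coord_jets n) (jet_coords n)"
    unfolding coords_def by (rule bij_betw_inv_into[OF taylor_bij])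
  from bij_betw_trans[OF this theta_coords_bij] show ?thesis
    by (simp add: theta_def[abs_def] o_def)
qed

theorem theorem75:
  fixes n :: nat
  assumes "n \<ge> 1"
  shows "bij_betw (theta (n + 1)) (coord_jets (n + 1))
           (pts (jets (n + 1) :: ('p::finite, 'q::finite) tower fspace))"
  by (rule theta_bij_betw)

end
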